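(* Let $A$ be a $C^*$-algebra and let $I \subseteq A$ be a (two-sided, not necessarily norm-closed) ideal. Then the following are equivalent: (1) $I$ is semiprime. (2) $I$ is idempotent (factors weakly), that is, $I = I^2$. (3) $I^m = I^n$ for some integers $m,n \geq 1$ with $m \neq n$. (4) $I$ factors, that is, for every $x \in I$ there exist $y,z \in I$ such that $x = yz$. (5) $I$ is closed under arbitrary roots of positive elements. (6) $I$ is closed under square roots of positive elements. (7) The Dixmier interior $\operatorname{int}_D(I)$ is semiprime. (8) The Dixmier closure $\operatorname{cl}_D(I)$ is semiprime. If these conditions hold, then $I$ is a Dixmier ideal and thus $\operatorname{int}_D(I) = I = \operatorname{cl}_D(I)$.
   Context: $C^*$-algebras are not assumed unital, and $A_+$ denotes the set of positive elements of $A$. An ideal in $A$ is an additive subgroup $I \subseteq A$ with $aI \cup Ia \subseteq I$ for all $a \in A$; it is not assumed norm-closed, self-adjoint, or closed under complex scalars. Put $I_+ := I \cap A_+$. For an ideal $I$, $I^n$ is the additive subgroup generated by $\{x_1\cdots x_n : x_1,\ldots,x_n \in I\}$ (so $I^1 = I$). An ideal $I$ is semiprime if for all ideals $J \subseteq A$, $J^2 \subseteq I$ implies $J \subseteq I$. An ideal $I$ factors weakly if it is the linear span of the products $xy$ with $x,y \in I$; this is the same as $I = I^2$. An ideal $I$ is closed under square roots of positive elements if $a^{1/2} \in I$ for all $a \in I_+$, and closed under arbitrary roots of positive elements if $a^{1/n} \in I$ for all $a \in I_+$ and all integers $n \geq 1$. An order ideal in $A_+$ is an additive submonoid $M \subseteq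 A_+$ such that $a,b \in A_+$, $a \leq b$ and $b \in M$ imply $a \in M$; it is strongly invariant if for all $x \in A$, $x^*x \in M$ if and only if $xx^* \in M$. A Dixmier ideal in $A$ is a two-sided ideal $I$ (not necessarily norm-closed) that is positively spanned ($I$ is the complex linear span of $I_+$), hereditary ($I_+$ is an order ideal), and such that $I_+$ is strongly invariant. For any ideal $I \subseteq A$, the Dixmier interior $\operatorname{int}_D(I)$ is the sum (set of finite sums of elements of the union) of all Dixmier ideals of $A$ contained in $I$, and the Dixmier closure $\operatorname{cl}_D(I)$ is the intersection of all Dixmier ideals of $A$ containing $I$; these are themselves Dixmier ideals. *)

theory Defs
  imports "HOL-Analysis.Analysis" "HOL-Computational_Algebra.Group_Closure"
begin

section \<open>C*-algebras, not assumed unital\<close>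

class cstar_algebra = real_normed_algebra + banach +
  fixes scaleC :: "complex \<Rightarrow> 'a \<Rightarrow> 'a"  (infixr \<open>*\<^sub>C\<close> 75)
    and star :: "'a \<Rightarrow> 'a"
  assumes scaleC_add_right: "c *\<^sub>C (x + y) = c *\<^sub>C x + c *\<^sub>C y"
    and scaleC_add_left: "(c + d) *\<^sub>C x = c *\<^sub>C x + d *\<^sub>C x"
    and scaleC_scaleC: "c *\<^sub>C (d *\<^sub>C x) = (c * d) *\<^sub>C x"
    and scaleC_of_real: "complex_of_real r *\<^sub>C x = r *\<^sub>R x"
    and mult_scaleC_left: "(c *\<^sub>C x) * y = c *\<^sub>C (x * y)"
    and mult_scaleC_right: "x * (c *\<^sub>C y) = c *\<^sub>C (x * y)"
    and norm_scaleC: "norm (c *\<^sub>C x) = cmod c * norm x"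
    and star_star: "star (star x) = x"
    and star_add: "star (x + y) = star x + star y"
    and star_scaleC: "star (c *\<^sub>C x) = cnj c *\<^sub>C star x"
    and star_mult: "star (x * y) = star y * star x"
    and norm_star_mult_self: "norm (star x * x) = (norm x)\<^sup>2"

interpretation complex_space: vector_space
  "scaleC :: complex \<Rightarrow> 'a \<Rightarrow> 'a::cstar_algebra"
  using scaleC_of_real [of 1]
  by unfold_locales (simp_all add: scaleC_add_right scaleC_add_left scaleC_scaleC)

abbreviation complex_span :: "'a::cstar_algebra set \<Rightarrow> 'a set"
  where "complex_span \<equiv> module.span scaleC"

section \<open>Positive elements, products and roots\<close>

text \<open>Multiplication of the unitization: the pair \<open>(a, s)\<close> stands for \<open>a + s 1\<close>, and the
  unit is \<open>(0, 1)\<close>.\<close>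

definition unitization_mult ::
    "'a::cstar_algebra \<times> complex \<Rightarrow> 'a \<times> complex \<Rightarrow> 'a \<times> complex"
  where "unitization_mult u v =
    (fst u * fst v + snd u *\<^sub>C fst v + snd v *\<^sub>C fst u, snd u * snd v)"

text \<open>The spectrum is always taken in the unitization. If the algebra already has a unit,
  this adds at most the point 0 to the usual spectrum and does not affect positivity.\<close>

definition spectrum :: "'a::cstar_algebra \<Rightarrow> complex set"
  where "spectrum a = {l. \<not> (\<exists>v. unitization_mult (a, - l) v = (0, 1) \<and>
                                  unitization_mult v (a, - l) = (0, 1))}"

definition positives :: "'a::cstar_algebra set"
  where "positives = {a. star a = a \<and> spectrum a \<subseteq> \<real>\<^sub>\<ge>\<^sub>0}"

definition cstar_le :: "'a::cstar_algebra \<Rightarrow> 'a \<Rightarrow> bool"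
  where "cstar_le a b \<longleftrightarrow> b - a \<in> positives"

text \<open>There may be no unit, so \<open>prod_list\<close> and \<open>(^)\<close> are not available.
  The value on the empty list is a dummy; only nonempty lists are used.\<close>

fun list_product :: "'a::cstar_algebra list \<Rightarrow> 'a"
  where
    "list_product [] = 0"
  | "list_product [x] = x"
  | "list_product (x # y # zs) = x * list_product (y # zs)"

text \<open>\<open>a^(1/n)\<close> for positive \<open>a\<close> and \<open>n \<ge> 1\<close>: the unique positive element whose
  \<open>n\<close>-th power is \<open>a\<close>.\<close>

definition positive_root :: "nat \<Rightarrow> 'a::cstar_algebra \<Rightarrow> 'a"
  where "positive_root n a = (THE b. b \<in> positives \<and> list_product (replicate n b) = a)"

section \<open>Ideals\<close>

text \<open>Ideals are purely ring-theoretic: neither norm-closed nor self-adjoint, and not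
  assumed to be closed under complex scalars.\<close>

definition is_ideal :: "'a::cstar_algebra set \<Rightarrow> bool"
  where "is_ideal I \<longleftrightarrow>
    0 \<in> I \<and> (\<forall>x\<in>I. \<forall>y\<in>I. x + y \<in> I) \<and> (\<forall>x\<in>I. - x \<in> I) \<and>
    (\<forall>a. \<forall>x\<in>I. a * x \<in> I \<and> x * a \<in> I)"

text \<open>Meaningful for \<open>n \<ge> 1\<close> only.\<close>

definition ideal_power :: "'a::cstar_algebra set \<Rightarrow> nat \<Rightarrow> 'a set"
  where "ideal_power I n = group_closure {list_product xs | xs. length xs = n \<and> set xs \<subseteq> I}"

definition semiprime :: "'a::cstar_algebra set \<Rightarrow> bool"
  where "semiprime I \<longleftrightarrow>
    is_ideal I \<and> (\<forall>J. is_ideal J \<longrightarrow> ideal_power J 2 \<subseteq> I \<longrightarrow> J \<subseteq> I)"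

definition factors :: "'a::cstar_algebra set \<Rightarrow> bool"
  where "factors I \<longleftrightarrow> (\<forall>x\<in>I. \<exists>y\<in>I. \<exists>z\<in>I. x = y * z)"

definition closed_under_roots :: "'a::cstar_algebra set \<Rightarrow> bool"
  where "closed_under_roots I \<longleftrightarrow> (\<forall>a\<in>I \<inter> positives. \<forall>n\<ge>1. positive_root n a \<in> I)"

definition closed_under_square_roots :: "'a::cstar_algebra set \<Rightarrow> bool"
  where "closed_under_square_roots I \<longleftrightarrow> (\<forall>a\<in>I \<inter> positives. positive_root 2 a \<in> I)"

section \<open>Dixmier ideals\<close>

definition order_ideal :: "'a::cstar_algebra set \<Rightarrow> bool"
  where "order_ideal M \<longleftrightarrow>
    M \<subseteq> positives \<and> 0 \<in> M \<and> (\<forall>a\<in>M. \<forall>b\<in>M. a + b \<in> M) \<and>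
    (\<forall>a\<in>positives. \<forall>b\<in>positives. cstar_le a b \<longrightarrow> b \<in> M \<longrightarrow> a \<in> M)"

definition strongly_invariant :: "'a::cstar_algebra set \<Rightarrow> bool"
  where "strongly_invariant M \<longleftrightarrow> (\<forall>x. star x * x \<in> M \<longleftrightarrow> x * star x \<in> M)"

definition dixmier_ideal :: "'a::cstar_algebra set \<Rightarrow> bool"
  where "dixmier_ideal I \<longleftrightarrow>
    is_ideal I \<and> I = complex_span (I \<inter> positives) \<and>
    order_ideal (I \<inter> positives) \<and> strongly_invariant (I \<inter> positives)"

definition dixmier_interior :: "'a::cstar_algebra set \<Rightarrow> 'a set"
  where "dixmier_interior I = {sum_list xs | xs. set xs \<subseteq> \<Union>{J. dixmier_ideal J \<and> J \<subseteq> I}}"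

definition dixmier_closure :: "'a::cstar_algebra set \<Rightarrow> 'a set"
  where "dixmier_closure I = \<Inter>{J. dixmier_ideal J \<and> I \<subseteq> J}"

end

theory Submission
  imports Defs "HOL-Computational_Algebra.Fundamental_Theorem_Algebra"
begin

text \<open>
  Everything is reduced to closure under square roots of positive elements. The tools are the
  factorization \<open>x = u (x\<^sup>* x)\<^sup>\<alpha>\<close> with \<open>\<alpha> < 1/2\<close> and the operator monotonicity of powers: if \<open>I\<close> is an
  ideal, \<open>0 \<le> a \<le> b\<close> and \<open>b\<^sup>\<sigma> \<in> I\<close> with \<open>\<sigma> < \<theta> \<le> 1\<close>, then \<open>a\<^sup>\<theta> = u b\<^sup>\<tau> u\<^sup>* \<in> I\<close> for some \<open>\<tau> > \<sigma>\<close>; moreover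
  \<open>(x x\<^sup>*)\<^sup>r \<in> I\<close> implies \<open>(x\<^sup>* x)\<^sup>s \<in> I\<close> for \<open>s > r\<close>.

  If \<open>I\<close> is semiprime, \<open>a \<in> I\<close> is positive and \<open>b = a\<^sup>1\<^sup>/\<^sup>2\<close>, then these facts show \<open>t A t \<subseteq> I\<close> for \<open>t = b z\<^sup>* z b\<close>,
  hence \<open>t \<in> I\<close>, hence \<open>b A b \<subseteq> I\<close> and \<open>b \<in> I\<close>. If \<open>I\<close> is idempotent, then a positive \<open>y = \<Sum> p q\<close> in \<open>I\<close> satisfies
  \<open>y \<le> \<Sum> (p p\<^sup>* + q\<^sup>* q) / 2\<close>, which gives \<open>y\<^sup>3\<^sup>/\<^sup>4 \<in> I\<close>; if \<open>I\<^sup>m = I\<^sup>n\<close> this applies to \<open>I\<^sup>m\<close>.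

  For the interior and the closure, the span of the squares \<open>w\<^sup>* w\<close> with \<open>(w\<^sup>* w)\<^sup>r \<in> I\<close> for some \<open>r < 1\<close>
  is a Dixmier ideal \<open>D \<subseteq> I\<close>, and the span of the squares with \<open>(w\<^sup>* w)\<^sup>r \<in> D\<close> for some \<open>r < 2\<close> is a Dixmier
  ideal \<open>E \<supseteq> I\<close>. As \<open>a\<^sup>2 \<in> D\<close> for positive \<open>a \<in> I\<close> and \<open>a\<^sup>2 \<in> D\<close> for positive \<open>a \<in> E\<close>, roots in a semiprime interior or
  closure carry \<open>I\<close> into the interior and the closure into \<open>I\<close>.
\<close>

section \<open>The unitization as a unital C*-algebra\<close>

text \<open>The obstacle is that an ideal comes without norm closure, involution or complex scalars,
  and that the partial isometry of a true polar decomposition need not lie in A. Quotients such as x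
  y^(-\<alpha>) exist in A only for exponents strictly below a critical value, so every flip,
  domination or factorization costs an arbitrarily small amount of exponent. The strict inequalities
  between exponents are this slack. It also absorbs scalars: c a^r = (c a^(r-s)) a^s lies in the
  ideal as soon as a^s does. Closure under square roots makes the loss harmless, because all
  positive powers are then available. The concrete fractions are convenient points of open
  intervals. The functional calculus underneath avoids spectral theory: positivity is a norm
  condition in the unitization, square roots come from an iteration, and polynomials that are
  nonnegative on an interval take positive values because they can be factored. The spectrum is
  matched with this only in \<open>positives_iff\<close>. Operator monotonicity is proved for the
  exponents 1/2, 3/4, 7/8, ..., which accumulate at 1; that is enough.\<close>

lemma scaleC_one [simp]: "1 *\<^sub>C x = (x::'a::cstar_algebra)"
  using scaleC_of_real [of 1 x] by simp

lemma scaleC_diff_right: "c *\<^sub>C (x - y) = c *\<^sub>C x - c *\<^sub>C (y::'a::cstar_algebra)"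
  using scaleC_add_right [of c x "- y"] by simp

lemma scaleC_scaleR: "c *\<^sub>C (r *\<^sub>R x) = (of_real r * c) *\<^sub>C (x::'a::cstar_algebra)"
  by (metis mult.commute scaleC_of_real scaleC_scaleC)

lemma scaleR_scaleC: "r *\<^sub>R (c *\<^sub>C x) = (of_real r * c) *\<^sub>C (x::'a::cstar_algebra)"
  by (metis scaleC_of_real scaleC_scaleC)

lemma star_zero [simp]: "star 0 = (0::'a::cstar_algebra)"
  using star_add [of "0::'a" 0] by simp

lemma star_minus [simp]: "star (- x) = - star (x::'a::cstar_algebra)"
  using star_add [of x "- x"] by (simp add: eq_neg_iff_add_eq_0 add.commute)

lemma star_diff: "star (x - y) = star x - star (y::'a::cstar_algebra)"
  using star_add [of x "- y"] by simp

lemma star_scaleR [simp]: "star (r *\<^sub>R x) = r *\<^sub>R star (x::'a::cstar_algebra)"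
  using star_scaleC [of "of_real r" x] by (simp add: scaleC_of_real)

lemma star_sum_list: "star (\<Sum>x\<leftarrow>xs. f x) = (\<Sum>x\<leftarrow>xs. star (f x :: 'a::cstar_algebra))"
  by (induction xs) (simp_all add: star_add)

lemma norm_star [simp]: "norm (star x) = norm (x::'a::cstar_algebra)"
proof -
  have "norm x \<le> norm (star x)" for x :: 'a
  proof (cases "x = 0")
    case False
    have "norm x * norm x \<le> norm (star x) * norm x"
      using norm_star_mult_self [of x] norm_mult_ineq [of "star x" x] by (simp add: power2_eq_square)
    then show ?thesis using False by simp
  qed simp
  from this [of x] this [of "star x"] show ?thesis by (simp add: star_star)
qed

lemma bounded_linear_star: "bounded_linear (star :: 'a::cstar_algebra \<Rightarrow> 'a)"
  by (rule bounded_linear_intro [where K = 1]) (simp_all add: star_add)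

lemmas tendsto_star = bounded_linear.tendsto [OF bounded_linear_star]

lemma star_mult_self_eq_0: "star x * x = 0 \<longleftrightarrow> x = (0::'a::cstar_algebra)"
  using norm_star_mult_self [of x] by auto

text \<open>A type of its own instead of the pairs in \<open>unitization_mult\<close>: products
  already carry the Euclidean norm as their instance, while a C*-norm is wanted here.\<close>

datatype 'a unitization = Unitization (ubase: 'a) (uscalar: complex)

lemma unitization_eqI: "ubase u = ubase v \<Longrightarrow> uscalar u = uscalar v \<Longrightarrow> u = v"
  by (simp add: unitization.expand)

instantiation unitization :: (cstar_algebra) real_algebra_1
begin

definition "0 = Unitization 0 0"
definition "1 = Unitization 0 1"
definition "u + v = Unitization (ubase u + ubase v) (uscalar u + uscalar v)"
definition "- u = Unitization (- ubase u) (- uscalar u)"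
definition "u - v = Unitization (ubase u - ubase v) (uscalar u - uscalar v)"
definition "r *\<^sub>R u = Unitization (r *\<^sub>R ubase u) (r *\<^sub>R uscalar u)"
definition "u * v = Unitization (ubase u * ubase v + uscalar u *\<^sub>C ubase v + uscalar v *\<^sub>C ubase u)
                                (uscalar u * uscalar v)"

lemmas unitization_ops = zero_unitization_def one_unitization_def plus_unitization_def
  uminus_unitization_def minus_unitization_def scaleR_unitization_def times_unitization_def

instance
  by intro_classes
    (simp_all add: unitization_ops algebra_simps scaleR_add_right scaleR_add_left
      scaleC_add_right scaleC_add_left scaleC_scaleC mult_scaleC_left mult_scaleC_right
      scaleC_scaleR scaleR_scaleC scaleR_conv_of_real)

end

definition unit_act :: "'a::cstar_algebra unitization \<Rightarrow> 'a \<Rightarrow> 'a"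
  where "unit_act u x = ubase u * x + uscalar u *\<^sub>C x"

lemma norm_unit_act_le: "norm (unit_act u x) \<le> (norm (ubase u) + cmod (uscalar u)) * norm x"
  unfolding unit_act_def distrib_right
  by (rule norm_triangle_le) (simp add: norm_scaleC norm_mult_ineq add_mono)

lemma bounded_linear_unit_act: "bounded_linear (unit_act u)"
proof (rule bounded_linear_intro)
  show "norm (unit_act u x) \<le> norm x * (norm (ubase u) + cmod (uscalar u))" for x
    using norm_unit_act_le [of u x] by (simp add: mult.commute)
qed (simp_all add: unit_act_def algebra_simps scaleC_add_right scaleC_scaleR scaleR_scaleC)

lemma unit_act_mult: "unit_act (u * v) x = unit_act u (unit_act v x)"
  by (simp add: unit_act_def unitization_ops algebra_simps scaleC_add_right scaleC_scaleC
      mult_scaleC_left mult_scaleC_right)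

lemma unit_act_add: "unit_act (u + v) x = unit_act u x + unit_act v x"
  by (simp add: unit_act_def unitization_ops algebra_simps scaleC_add_left)

lemma unit_act_scaleR: "unit_act (r *\<^sub>R u) x = r *\<^sub>R unit_act u x"
  by (simp add: unit_act_def unitization_ops algebra_simps scaleR_scaleC scaleR_conv_of_real [where 'a=complex])

text \<open>By the C*-identity the bound is attained at the vector \<open>star a\<close>. Hence A
  sits isometrically in its unitization.\<close>

lemma onorm_unit_act_base: "onorm (unit_act (Unitization a 0)) = norm a"
proof (rule antisym)
  show "onorm (unit_act (Unitization a 0)) \<le> norm a"
    by (rule onorm_bound) (simp_all add: unit_act_def norm_mult_ineq)
  show "norm a \<le> onorm (unit_act (Unitization a 0))"
  proof (cases "a = 0")
    case False
    have "norm a * norm a = norm (a * star a)"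
      using norm_star_mult_self [of "star a"] by (simp add: star_star power2_eq_square)
    also have "\<dots> \<le> onorm (unit_act (Unitization a 0)) * norm (star a)"
      using onorm [OF bounded_linear_unit_act, of "Unitization a 0" "star a"] by (simp add: unit_act_def)
    finally show ?thesis using False by simp
  qed (use onorm_pos_le [OF bounded_linear_unit_act] in auto)
qed

lemma onorm_unit_act_le: "onorm (unit_act u) \<le> norm (ubase u) + cmod (uscalar u)"
  by (rule onorm_bound) (simp_all add: norm_unit_act_le)

text \<open>If the algebra is already unital, the operator norm alone only gives a seminorm,
  which vanishes on the difference of the two units.\<close>

instantiation unitization :: (cstar_algebra) real_normed_algebra_1
begin

definition "norm u = max (cmod (uscalar u)) (onorm (unit_act u))"
definition "sgn u = inverse (norm u) *\<^sub>R (u :: 'a unitization)"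
definition "dist u v = norm (u - v :: 'a unitization)"
definition
  "(uniformity :: ('a unitization \<times> 'a unitization) filter) = (INF e\<in>{0<..}. principal {(x, y). dist x y < e})"
definition
  "open (U :: 'a unitization set) \<longleftrightarrow> (\<forall>x\<in>U. eventually (\<lambda>(x', y). x' = x \<longrightarrow> y \<in> U) uniformity)"

instance
proof
  fix u v :: "'a unitization" and r :: real and U :: "'a unitization set"
  show "dist u v = norm (u - v)" "sgn u = inverse (norm u) *\<^sub>R u"
    "(uniformity :: ('a unitization \<times> 'a unitization) filter) = (INF e\<in>{0<..}. principal {(x, y). dist x y < e})"
    "open U \<longleftrightarrow> (\<forall>x\<in>U. eventually (\<lambda>(x', y). x' = x \<longrightarrow> y \<in> U) uniformity)"
    by (rule dist_unitization_def sgn_unitization_def uniformity_unitization_def open_unitization_def)+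
  show "norm u = 0 \<longleftrightarrow> u = 0"
  proof
    assume "norm u = 0"
    then have s: "uscalar u = 0" and o: "onorm (unit_act u) = 0"
      using onorm_pos_le [OF bounded_linear_unit_act, of u]
      by (simp_all add: norm_unitization_def max_def split: if_splits)
    have "ubase u = 0"
      using o s onorm_unit_act_base [of "ubase u"] by (metis norm_eq_zero unitization.collapse)
    with s show "u = 0" by (simp add: unitization_ops unitization_eqI)
  next
    assume "u = 0"
    then show "norm u = 0"
      using onorm_unit_act_base [of "0::'a"] by (simp add: norm_unitization_def unitization_ops)
  qed
  have "onorm (unit_act (u + v)) \<le> onorm (unit_act u) + onorm (unit_act v)"
    using onorm_triangle [OF bounded_linear_unit_act bounded_linear_unit_act, of u v]
    by (simp add: unit_act_add [abs_def])
  moreover have "cmod (uscalar (u + v)) \<le> cmod (uscalar u) + cmod (uscalar v)"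
    by (simp add: unitization_ops norm_triangle_ineq)
  ultimately show "norm (u + v) \<le> norm u + norm v"
    by (auto simp: norm_unitization_def)
  have "onorm (unit_act (r *\<^sub>R u)) = \<bar>r\<bar> * onorm (unit_act u)"
    using onorm_scaleR [OF bounded_linear_unit_act, of r u] by (simp add: unit_act_scaleR [abs_def])
  then show "norm (r *\<^sub>R u) = \<bar>r\<bar> * norm u"
    by (simp add: norm_unitization_def unitization_ops max_mult_distrib_left)
  have "onorm (unit_act (u * v)) \<le> onorm (unit_act u) * onorm (unit_act v)"
    using onorm_compose [OF bounded_linear_unit_act bounded_linear_unit_act, of u v]
    by (simp add: unit_act_mult [abs_def] comp_def)
  also have "\<dots> \<le> norm u * norm v"
    using onorm_pos_le [OF bounded_linear_unit_act]
    by (intro mult_mono) (auto simp: norm_unitization_def le_max_iff_disj)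
  finally show "norm (u * v) \<le> norm u * norm v"
    using mult_mono [of "cmod (uscalar u)" "norm u" "cmod (uscalar v)" "norm v"]
    by (auto simp: norm_unitization_def unitization_ops norm_mult le_max_iff_disj)
  have "onorm (unit_act (1 :: 'a unitization)) \<le> 1"
    by (rule onorm_bound) (simp_all add: unit_act_def unitization_ops)
  then show "norm (1 :: 'a unitization) = 1"
    by (simp add: norm_unitization_def unitization_ops)
qed

end

lemma norm_Unitization_zero [simp]: "norm (Unitization a 0) = norm a"
  using onorm_unit_act_base [of a] by (simp add: norm_unitization_def)

lemma norm_uscalar_le: "cmod (uscalar u) \<le> norm u"
  by (simp add: norm_unitization_def)

lemma norm_ubase_le: "norm (ubase u) \<le> 2 * norm u"
proof -
  have "Unitization (ubase u) 0 = u - Unitization 0 (uscalar u)"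
    by (simp add: unitization_ops)
  then have "norm (ubase u) \<le> norm u + norm (Unitization (0::'a) (uscalar u))"
    by (metis norm_Unitization_zero norm_triangle_ineq4)
  moreover have "norm (Unitization (0::'a) (uscalar u)) \<le> cmod (uscalar u)"
    using onorm_unit_act_le [of "Unitization (0::'a) (uscalar u)"] by (simp add: norm_unitization_def)
  ultimately show ?thesis using norm_uscalar_le [of u] by linarith
qed

lemma bounded_linear_ubase: "bounded_linear (ubase :: 'a::cstar_algebra unitization \<Rightarrow> 'a)"
  using norm_ubase_le
  by (intro bounded_linear_intro [where K = 2]) (simp_all add: unitization_ops mult.commute)

lemma bounded_linear_uscalar: "bounded_linear (uscalar :: 'a::cstar_algebra unitization \<Rightarrow> complex)"
  by (rule bounded_linear_intro [where K = 1])
    (simp_all add: unitization_ops norm_uscalar_le)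

lemma norm_unitization_le: "norm u \<le> norm (ubase u) + cmod (uscalar u)"
  using onorm_unit_act_le [of u] by (simp add: norm_unitization_def)

instance unitization :: (cstar_algebra) banach
proof
  fix X :: "nat \<Rightarrow> 'a unitization"
  assume X: "Cauchy X"
  obtain a where a: "(\<lambda>n. ubase (X n)) \<longlonglongrightarrow> a"
    using bounded_linear.Cauchy [OF bounded_linear_ubase X] Cauchy_convergent convergent_def by blast
  obtain s where s: "(\<lambda>n. uscalar (X n)) \<longlonglongrightarrow> s"
    using bounded_linear.Cauchy [OF bounded_linear_uscalar X] Cauchy_convergent convergent_def by blast
  have "(\<lambda>n. norm (ubase (X n) - a) + cmod (uscalar (X n) - s)) \<longlonglongrightarrow> 0"
    using tendsto_add [OF tendsto_norm_zero [OF LIM_zero [OF a]] tendsto_norm_zero [OF LIM_zero [OF s]]]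
    by simp
  then have "(\<lambda>n. X n - Unitization a s) \<longlonglongrightarrow> 0"
  proof (rule Lim_null_comparison [rotated])
    show "\<forall>\<^sub>F n in sequentially. norm (X n - Unitization a s)
            \<le> norm (ubase (X n) - a) + cmod (uscalar (X n) - s)"
      using norm_unitization_le [of "X _ - Unitization a s"] by (auto simp: unitization_ops)
  qed
  then show "convergent X" by (auto simp: convergent_def intro: LIM_zero_cancel)
qed

instantiation unitization :: (cstar_algebra) cstar_algebra
begin

definition "c *\<^sub>C u = Unitization (c *\<^sub>C ubase u) (c * uscalar u)"
definition "star u = Unitization (star (ubase u)) (cnj (uscalar u))"

instance
proof
  fix u v :: "'a unitization" and c d :: complex and r :: real
  show "c *\<^sub>C (u + v) = c *\<^sub>C u + c *\<^sub>C v" "(c + d) *\<^sub>C u = c *\<^sub>C u + d *\<^sub>C u"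
    "c *\<^sub>C (d *\<^sub>C u) = (c * d) *\<^sub>C u" "complex_of_real r *\<^sub>C u = r *\<^sub>R u"
    "(c *\<^sub>C u) * v = c *\<^sub>C (u * v)" "u * (c *\<^sub>C v) = c *\<^sub>C (u * v)"
    by (simp_all add: scaleC_unitization_def unitization_ops algebra_simps scaleC_add_right
        scaleC_add_left scaleC_scaleC scaleC_of_real mult_scaleC_left mult_scaleC_right
        scaleR_conv_of_real [where 'a=complex])
  show "star (star u) = u" "star (u + v) = star u + star v" "star (c *\<^sub>C u) = cnj c *\<^sub>C star u"
    "star (u * v) = star v * star u"
    by (simp_all add: scaleC_unitization_def star_unitization_def unitization_ops star_star star_add
        star_scaleC star_mult)
  have "unit_act (c *\<^sub>C u) x = c *\<^sub>C unit_act u x" for x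
    by (simp add: unit_act_def scaleC_unitization_def scaleC_add_right scaleC_scaleC mult_scaleC_left)
  then have "onorm (unit_act (c *\<^sub>C u)) = onorm (\<lambda>x. cmod c *\<^sub>R unit_act u x)"
    unfolding onorm_def by (simp add: norm_scaleC)
  then have "onorm (unit_act (c *\<^sub>C u)) = cmod c * onorm (unit_act u)"
    using onorm_scaleR [OF bounded_linear_unit_act, of "cmod c" u] by simp
  then show "norm (c *\<^sub>C u) = cmod c * norm u"
    by (simp add: norm_unitization_def scaleC_unitization_def norm_mult max_mult_distrib_left)
  \<comment> \<open>Half of the C*-identity, from that of A: the square of the norm of
    \<open>unit_act u x\<close> is the norm of
    \<open>star x * unit_act (star u * u) x\<close>.\<close>
  have sq: "(onorm (unit_act u))\<^sup>2 \<le> onorm (unit_act (star u * u))" for u :: "'a unitization"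
  proof -
    have "norm (unit_act u x) \<le> sqrt (onorm (unit_act (star u * u))) * norm x" for x
    proof -
      have "star (unit_act u x) * unit_act u x = star x * unit_act (star u * u) x"
        by (simp add: unit_act_mult)
          (simp add: unit_act_def star_unitization_def star_add star_mult star_scaleC algebra_simps
            scaleC_add_right scaleC_scaleC mult_scaleC_left mult_scaleC_right)
      then have "(norm (unit_act u x))\<^sup>2 \<le> norm x * norm (unit_act (star u * u) x)"
        by (metis norm_mult_ineq norm_star norm_star_mult_self)
      also have "\<dots> \<le> norm x * (onorm (unit_act (star u * u)) * norm x)"
        by (intro mult_left_mono onorm bounded_linear_unit_act) simp
      finally have "(norm (unit_act u x))\<^sup>2 \<le> onorm (unit_act (star u * u)) * (norm x)\<^sup>2"
        by (simp add: power2_eq_square algebra_simps)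
      then show ?thesis
        by (metis abs_norm_cancel real_le_rsqrt real_sqrt_abs real_sqrt_mult)
    qed
    then have "onorm (unit_act u) \<le> sqrt (onorm (unit_act (star u * u)))"
      using onorm_pos_le [OF bounded_linear_unit_act] by (intro onorm_bound) simp_all
    then show ?thesis
      using onorm_pos_le [OF bounded_linear_unit_act] by (metis power_mono real_sqrt_pow2)
  qed
  have mult: "onorm (unit_act (u * v)) \<le> onorm (unit_act u) * onorm (unit_act v)"
    for u v :: "'a unitization"
    using onorm_compose [OF bounded_linear_unit_act bounded_linear_unit_act, of u v]
    by (simp add: unit_act_mult [abs_def] comp_def)
  have le: "onorm (unit_act u) \<le> onorm (unit_act (star u))" for u :: "'a unitization"
  proof (cases "onorm (unit_act u) = 0")
    case False
    have "onorm (unit_act u) * onorm (unit_act u) \<le> onorm (unit_act (star u)) * onorm (unit_act u)"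
      using sq [of u] mult [of "star u" u] by (simp add: power2_eq_square)
    then show ?thesis using False onorm_pos_le [OF bounded_linear_unit_act, of u] by simp
  qed (use onorm_pos_le [OF bounded_linear_unit_act] in auto)
  have "star (star u) = u" by (simp add: star_unitization_def star_star)
  then have "onorm (unit_act (star u)) = onorm (unit_act u)" using le [of u] le [of "star u"] by simp
  then have "onorm (unit_act (star u * u)) = (onorm (unit_act u))\<^sup>2"
    using sq [of u] mult [of "star u" u] by (simp add: power2_eq_square)
  moreover have "cmod (uscalar (star u * u)) = (cmod (uscalar u))\<^sup>2"
    by (simp add: star_unitization_def unitization_ops norm_mult power2_eq_square)
  ultimately show "norm (star u * u) = (norm u)\<^sup>2"
    using onorm_pos_le [OF bounded_linear_unit_act, of u]
    by (simp add: norm_unitization_def max_def power_mono_iff)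
qed

end

section \<open>Positivity in unital C*-algebras\<close>

class cstar_algebra_1 = cstar_algebra + real_normed_algebra_1

instance unitization :: (cstar_algebra) cstar_algebra_1 ..

lemma star_one [simp]: "star 1 = (1::'a::cstar_algebra_1)"
  by (metis mult_1_right star_mult star_star)

lemma star_of_real [simp]: "star (of_real t) = (of_real t :: 'a::cstar_algebra_1)"
  by (simp add: of_real_def)

text \<open>A spectrum-free form of positivity: the condition says that the spectrum lies in
  [0, 2t]. It makes sums a matter of the triangle inequality; that it agrees with
  \<open>positives\<close> is shown in \<open>positives_iff\<close>.\<close>

definition cpos :: "'a::cstar_algebra_1 \<Rightarrow> bool"
  where "cpos a \<longleftrightarrow> star a = a \<and> (\<exists>t. norm (of_real t - a) \<le> t)"

lemma cpos_sa: "cpos a \<Longrightarrow> star a = a"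
  by (simp add: cpos_def)

lemma cpos_add: "cpos a \<Longrightarrow> cpos b \<Longrightarrow> cpos (a + b)"
proof -
  assume "cpos a" "cpos b"
  then obtain s t where *: "star a = a" "star b = b" "norm (of_real s - a) \<le> s" "norm (of_real t - b) \<le> t"
    by (auto simp: cpos_def)
  have "of_real (s + t) - (a + b) = (of_real s - a) + (of_real t - b)" by simp
  then have "norm (of_real (s + t) - (a + b)) \<le> s + t"
    using * by (metis add_mono norm_triangle_le)
  with * show ?thesis unfolding cpos_def by (metis star_add)
qed

lemma cpos_scaleR: "cpos a \<Longrightarrow> 0 \<le> r \<Longrightarrow> cpos (r *\<^sub>R a)"
proof -
  assume "cpos a" and r: "0 \<le> r"
  then obtain t where *: "star a = a" "norm (of_real t - a) \<le> t" by (auto simp: cpos_def)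
  have "of_real (r * t) - r *\<^sub>R a = r *\<^sub>R (of_real t - a)"
    by (simp add: of_real_def scaleR_diff_right)
  then have "norm (of_real (r * t) - r *\<^sub>R a) \<le> r * t"
    using * r by (simp add: mult_left_mono)
  with * show ?thesis unfolding cpos_def by (metis star_scaleR)
qed

lemma cpos_of_real: "0 \<le> t \<Longrightarrow> cpos (of_real t)"
  by (auto simp: cpos_def intro!: exI [of _ t])

lemma cpos_zero [simp]: "cpos 0"
  using cpos_of_real [of 0] by simp

lemma cpos_diff_of_real: "star a = a \<Longrightarrow> norm a \<le> t \<Longrightarrow> cpos (of_real t - a)"
  by (auto simp: cpos_def star_diff intro!: exI [of _ t])

lemma cpos_add_of_real: "star a = a \<Longrightarrow> norm a \<le> t \<Longrightarrow> cpos (of_real t + a)"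
  using cpos_diff_of_real [of "- a" t] by simp

text \<open>The equation for y is the fixed point equation y = (z + y^2)/2. Its iterates are
  majorized, together with their increments, by the scalar iteration \<open>s\<close> for z = 1,
  which increases and is bounded by 1. This covers the boundary case norm z = 1 without any power
  series.\<close>

lemma sqrt_one_minus:
  fixes z :: "'a::cstar_algebra_1"
  assumes z: "norm z \<le> 1"
  obtains y where "(1 - y) * (1 - y) = 1 - z" "\<And>x. x * z = z * x \<Longrightarrow> x * y = y * x"
    "star z = z \<Longrightarrow> star y = y"
proof -
  define Y where "Y = rec_nat 0 (\<lambda>_ y. (1/2) *\<^sub>R (z + y * y))"
  define s where "s = rec_nat 0 (\<lambda>_ s. (1 + s * s) / (2::real))"
  have Y0: "Y 0 = 0" and YS: "Y (Suc n) = (1/2) *\<^sub>R (z + Y n * Y n)" for n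
    by (simp_all add: Y_def)
  have s0: "s 0 = 0" and sS: "s (Suc n) = (1 + s n * s n) / 2" for n
    by (simp_all add: s_def)
  have s01: "0 \<le> s n \<and> s n \<le> 1" for n
    by (induction n) (auto simp: s0 sS intro: mult_le_one)
  have s_mono: "s n \<le> s (Suc n)" for n
    using sum_squares_ge_zero [of "s n - 1" 0] by (simp add: sS algebra_simps)
  have nY: "norm (Y n) \<le> s n" for n
  proof (induction n)
    case (Suc n)
    have "norm (Y n * Y n) \<le> s n * s n"
      using mult_mono [OF Suc Suc] s01 by (intro order_trans [OF norm_mult_ineq]) auto
    then have "norm (z + Y n * Y n) \<le> 1 + s n * s n"
      using z by (intro norm_triangle_le) simp
    then show ?case by (simp add: YS sS)
  qed (simp add: Y0 s0)
  have step: "norm (Y (Suc n) - Y n) \<le> s (Suc n) - s n" for n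
  proof (induction n)
    case 0
    show ?case using z by (simp add: Y0 s0 YS sS)
  next
    case (Suc n)
    let ?d = "Y (Suc n) - Y n" and ?e = "s (Suc n) - s n"
    have "Y (Suc (Suc n)) - Y (Suc n) = (1/2) *\<^sub>R (?d * Y (Suc n) + Y n * ?d)"
      by (subst (1 2) YS) (simp add: algebra_simps)
    moreover have "norm (?d * Y (Suc n)) \<le> ?e * s (Suc n)" "norm (Y n * ?d) \<le> s n * ?e"
      using mult_mono [OF Suc nY [of "Suc n"]] mult_mono [OF nY [of n] Suc] s01 s_mono [of n]
      by (auto intro!: order_trans [OF norm_mult_ineq])
    ultimately have "norm (Y (Suc (Suc n)) - Y (Suc n)) \<le> (1/2) * (?e * s (Suc n) + s n * ?e)"
      by (simp add: norm_triangle_le)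
    also have "\<dots> = s (Suc (Suc n)) - s (Suc n)"
      by (subst (5) sS, subst (3) sS) (simp add: field_simps)
    finally show ?case .
  qed
  have YY: "norm (Y (n + k) - Y n) \<le> s (n + k) - s n" for n k
  proof (induction k)
    case (Suc k)
    then show ?case
      using norm_triangle_ineq [of "Y (Suc (n + k)) - Y (n + k)" "Y (n + k) - Y n"] step [of "n + k"]
      by (simp del: Suc_eq_plus1)
  qed simp
  have "incseq s" using s_mono by (simp add: incseq_Suc_iff)
  moreover have "bdd_above (range s)" using s01 by (auto intro!: bdd_aboveI [of _ 1])
  ultimately have "Cauchy s"
    by (meson LIMSEQ_imp_Cauchy LIMSEQ_incseq_SUP)
  have "Cauchy Y"
  proof (rule metric_CauchyI)
    fix e :: real assume "0 < e"
    then obtain N where N: "\<And>m n. m \<ge> N \<Longrightarrow> n \<ge> N \<Longrightarrow> dist (s m) (s n) < e"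
      using \<open>Cauchy s\<close> unfolding Cauchy_def by meson
    have lt: "dist (Y m) (Y n) < e" if "N \<le> n" "n \<le> m" for m n
      using YY [of n "m - n"] N [of m n] that by (simp add: dist_norm dist_real_def)
    show "\<exists>M. \<forall>m\<ge>M. \<forall>n\<ge>M. dist (Y m) (Y n) < e"
      using lt by (metis dist_commute nle_le)
  qed
  then obtain y where y: "Y \<longlonglongrightarrow> y" by (auto simp: Cauchy_convergent_iff convergent_def)
  have "(\<lambda>n. Y (Suc n)) \<longlonglongrightarrow> (1/2) *\<^sub>R (z + y * y)"
    unfolding YS by (intro tendsto_intros y)
  then have "y = (1/2) *\<^sub>R (z + y * y)"
    using y LIMSEQ_Suc LIMSEQ_unique by blast
  then have "2 *\<^sub>R y = z + y * y" by (metis scaleR_half_double scaleR_2 scaleR_right_distrib)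
  then have 1: "(1 - y) * (1 - y) = 1 - z" by (simp add: algebra_simps scaleR_2)
  have 2: "x * y = y * x" if "x * z = z * x" for x
  proof -
    have c: "x * Y n = Y n * x" for n
    proof (induction n)
      case (Suc n)
      have "x * (Y n * Y n) = Y n * Y n * x" by (metis Suc mult.assoc)
      then show ?case using that by (simp add: YS distrib_left distrib_right)
    qed (simp add: Y0)
    have "(\<lambda>n. x * Y n) \<longlonglongrightarrow> x * y" "(\<lambda>n. x * Y n) \<longlonglongrightarrow> y * x"
      by (intro tendsto_intros y, unfold c, intro tendsto_intros y)
    then show ?thesis using LIMSEQ_unique by blast
  qed
  have 3: "star y = y" if "star z = z"
  proof -
    have "star (Y n) = Y n" for n
      by (induction n) (simp_all add: Y0 YS star_add star_mult that)
    then show ?thesis using tendsto_star [OF y] y LIMSEQ_unique by fastforce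
  qed
  show ?thesis using that 1 2 3 by blast
qed

lemma cpos_sqrt:
  fixes a :: "'a::cstar_algebra_1"
  assumes "cpos a"
  obtains q where "star q = q" "q * q = a" "\<And>x. x * a = a * x \<Longrightarrow> x * q = q * x"
proof -
  obtain t where t: "norm (of_real t - a) \<le> t" and sa: "star a = a"
    using assms by (auto simp: cpos_def)
  consider "t = 0" | "0 < t" using t norm_ge_zero [of "of_real t - a"] by linarith
  then show ?thesis
  proof cases
    case 1
    then show ?thesis using t that [of 0] by simp
  next
    case 2
    define z where "z = 1 - (1/t) *\<^sub>R a"
    have "z = (1/t) *\<^sub>R (of_real t - a)"
      using 2 by (simp add: z_def of_real_def scaleR_diff_right)
    then have "norm z = norm (of_real t - a) / t" using 2 by (simp only: norm_scaleR) simp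
    then have "norm z \<le> 1" using 2 t by simp
    then obtain y where y: "(1 - y) * (1 - y) = 1 - z" "\<And>x. x * z = z * x \<Longrightarrow> x * y = y * x"
      "star z = z \<Longrightarrow> star y = y" using sqrt_one_minus by blast
    show ?thesis
    proof (rule that)
      have "star z = z" by (simp add: z_def star_diff sa)
      then show "star (sqrt t *\<^sub>R (1 - y)) = sqrt t *\<^sub>R (1 - y)" by (simp add: star_diff y(3))
      show "(sqrt t *\<^sub>R (1 - y)) * (sqrt t *\<^sub>R (1 - y)) = a"
        using 2 y(1) by (simp add: z_def)
      show "x * (sqrt t *\<^sub>R (1 - y)) = (sqrt t *\<^sub>R (1 - y)) * x" if "x * a = a * x" for x
      proof -
        have "x * z = z * x" using that by (simp add: z_def algebra_simps)
        then show ?thesis using y(2) by (simp add: algebra_simps)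
      qed
    qed
  qed
qed

lemma norm_unitary:
  fixes u :: "'a::cstar_algebra_1"
  assumes "star u * u = of_real (M\<^sup>2)" "0 \<le> M"
  shows "norm u = M"
proof -
  have "(norm u)\<^sup>2 = M\<^sup>2"
    using assms(1) norm_star_mult_self [of u] by (metis abs_of_nonneg norm_of_real real_norm_def zero_le_power2)
  then show ?thesis using assms(2) by simp
qed

text \<open>If \<open>a\<close> and \<open>w\<close> are commuting and self-adjoint with \<open>a\<^sup>2 + w\<^sup>2 = M\<^sup>2\<close>, then \<open>a + \<i>w\<close> is \<open>M\<close> times a unitary.\<close>

lemma norm_le_of_sum_squares:
  fixes a w :: "'a::cstar_algebra_1"
  assumes sa: "star a = a" "star w = w" and c: "a * w = w * a"
    and sq: "a * a + w * w = of_real (M\<^sup>2)" and M: "0 \<le> M"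
  shows "norm a \<le> M" "norm w \<le> M"
proof -
  define u where "u = a + \<i> *\<^sub>C w"
  have su: "star u = a - \<i> *\<^sub>C w" by (simp add: u_def star_add star_scaleC sa)
  have "star u * u = a * a + w * w"
    unfolding su by (simp add: u_def algebra_simps mult_scaleC_left mult_scaleC_right scaleC_scaleC c)
  then have nu: "norm u = M" using sq M by (simp add: norm_unitary)
  have "norm (2 *\<^sub>R a) = norm (u + star u)"
    unfolding su by (simp add: u_def scaleR_2)
  also have "\<dots> \<le> 2 * M" using norm_triangle_ineq [of u "star u"] nu by simp
  finally show "norm a \<le> M" by simp
  have "norm (2 *\<^sub>R (\<i> *\<^sub>C w)) = norm (u - star u)"
    unfolding su by (simp add: u_def scaleR_2)
  also have "\<dots> \<le> 2 * M" using norm_triangle_ineq4 [of u "star u"] nu by simp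
  finally show "norm w \<le> M" by (simp add: norm_scaleC)
qed

text \<open>After scaling to norm at most 1, the root 1 - y of 1 - g^2 commutes with g and g^2 + (1
  - y)^2 = 1. So 1 - y has norm at most 1, and so has its square 1 - g^2, which is the condition
  \<open>cpos\<close> with t = 1.\<close>

lemma cpos_square:
  fixes h :: "'a::cstar_algebra_1"
  assumes "star h = h"
  shows "cpos (h * h)"
proof (cases "h = 0")
  case False
  define g where "g = (1 / norm h) *\<^sub>R h"
  have g: "star g = g" "norm (g * g) \<le> 1"
    using False assms norm_mult_ineq [of g g] by (simp_all add: g_def)
  obtain y where y: "(1 - y) * (1 - y) = 1 - g * g" "\<And>x. x * (g * g) = g * g * x \<Longrightarrow> x * y = y * x"
      "star (g * g) = g * g \<Longrightarrow> star y = y" using sqrt_one_minus [OF g(2)] by blast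
  have "g * y = y * g" using y(2) [of g] by (simp add: mult.assoc)
  then have c: "g * (1 - y) = (1 - y) * g" by (simp add: algebra_simps)
  have "star (1 - y) = 1 - y" using y(3) g(1) by (simp add: star_mult star_diff)
  then have "norm (1 - y) \<le> 1"
    using norm_le_of_sum_squares(2) [of g "1 - y" 1] g(1) c y(1) by simp
  then have "norm (1 - g * g) \<le> 1"
    using norm_mult_ineq [of "1 - y" "1 - y"] mult_le_one [of "norm (1 - y)" "norm (1 - y)"]
    by (simp add: y(1))
  then have "cpos (g * g)"
    by (auto simp: cpos_def star_mult g(1) intro!: exI [of _ 1])
  moreover have "h * h = (norm h)\<^sup>2 *\<^sub>R (g * g)"
    using False by (simp add: g_def power2_eq_square)
  ultimately show ?thesis by (simp add: cpos_scaleR)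
qed simp

lemma cpos_mult_commuting:
  assumes a: "cpos a" and b: "cpos b" and c: "a * b = b * a"
  shows "cpos (a * b)"
proof -
  obtain p where p: "star p = p" "p * p = a" "\<And>x. x * a = a * x \<Longrightarrow> x * p = p * x"
    using cpos_sqrt [OF a] by blast
  obtain q where q: "star q = q" "q * q = b" "\<And>x. x * b = b * x \<Longrightarrow> x * q = q * x"
    using cpos_sqrt [OF b] by blast
  have pq: "p * q = q * p" using q(3) [of p] p(3) [of b] c by simp
  have "star (p * q) = p * q" by (simp only: star_mult p(1) q(1) pq)
  moreover have "p * q * (p * q) = a * b" unfolding p(2) [symmetric] q(2) [symmetric]
    by (metis pq mult.assoc)
  ultimately show ?thesis by (metis cpos_square)
qed

text \<open>The product (M - a)(M + a) = M^2 - a^2 of commuting positive elements has a root w with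
  a^2 + w^2 = M^2, so a is the real part of M times a unitary.\<close>

lemma norm_le_if_cpos:
  fixes a :: "'a::cstar_algebra_1"
  assumes sa: "star a = a" and 1: "cpos (of_real M - a)" and 2: "cpos (of_real M + a)" and M: "0 \<le> M"
  shows "norm a \<le> M"
proof -
  have eq: "(of_real M - a) * (of_real M + a) = of_real (M\<^sup>2) - a * a"
    "(of_real M + a) * (of_real M - a) = of_real (M\<^sup>2) - a * a"
    by (simp_all add: algebra_simps of_real_def power2_eq_square)
  then have "cpos (of_real (M\<^sup>2) - a * a)"
    using cpos_mult_commuting [OF 1 2] by simp
  then obtain w where w: "star w = w" "w * w = of_real (M\<^sup>2) - a * a"
    "\<And>x. x * (of_real (M\<^sup>2) - a * a) = (of_real (M\<^sup>2) - a * a) * x \<Longrightarrow> x * w = w * x"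
    using cpos_sqrt by blast
  have "a * w = w * a"
    by (rule w(3)) (simp add: algebra_simps of_real_def)
  then show ?thesis
    using norm_le_of_sum_squares(1) [OF sa w(1)] w(2) M by simp
qed

text \<open>Replaces the unspecified t of the definition by every t above the norm. A convergent
  sequence then has a common t, which is how \<open>cpos_lim\<close> closes positivity under
  limits.\<close>

lemma cpos_iff_norm: "cpos a \<longleftrightarrow> star a = a \<and> (\<forall>t\<ge>norm a. norm (of_real t - a) \<le> t)"
proof
  assume a: "cpos a"
  have "norm (of_real t - a) \<le> t" if t: "norm a \<le> t" for t
  proof (rule norm_le_if_cpos)
    show "star (of_real t - a) = of_real t - a" using a by (simp add: star_diff cpos_sa)
    show "cpos (of_real t - (of_real t - a))" using a by simp
    have "cpos (of_real t + (of_real t - a))"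
      using t norm_ge_zero [of a] by (intro cpos_add cpos_of_real cpos_diff_of_real cpos_sa [OF a]) linarith+
    then show "cpos (of_real t + (of_real t - a))" .
    show "0 \<le> t" using t norm_ge_zero [of a] by linarith
  qed
  then show "star a = a \<and> (\<forall>t\<ge>norm a. norm (of_real t - a) \<le> t)" using a by (simp add: cpos_sa)
qed (auto simp: cpos_def)

lemma cpos_lim:
  assumes X: "X \<longlonglongrightarrow> a" and pos: "\<And>n. cpos (X n)"
  shows "cpos a"
proof -
  have "star a = a"
    using tendsto_star [OF X] X pos by (simp add: cpos_sa) (metis LIMSEQ_unique)
  define t where "t = norm a + 1"
  have "(\<lambda>n. norm (X n)) \<longlonglongrightarrow> norm a" by (intro tendsto_norm X)
  then have "\<forall>\<^sub>F n in sequentially. norm (X n) < t" by (rule order_tendstoD) (simp add: t_def)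
  then have "\<forall>\<^sub>F n in sequentially. norm (of_real t - X n) \<le> t"
    by eventually_elim (use pos in \<open>simp add: cpos_iff_norm\<close>)
  moreover have "(\<lambda>n. norm (of_real t - X n)) \<longlonglongrightarrow> norm (of_real t - a)" by (intro tendsto_intros X)
  ultimately have "norm (of_real t - a) \<le> t"
    by (intro tendsto_upperbound) auto
  with \<open>star a = a\<close> show ?thesis by (auto simp: cpos_def)
qed

section \<open>Functional calculus for positive elements\<close>

text \<open>Real coefficients at a point of a possibly noncommutative algebra, where
  \<open>poly\<close> does not apply. Complex points are used too, to find the nonreal roots of real
  polynomials.\<close>

definition peval :: "real poly \<Rightarrow> 'a::real_algebra_1 \<Rightarrow> 'a"
  where "peval p a = fold_coeffs (\<lambda>c x. of_real c + a * x) p 0"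

lemma peval_0 [simp]: "peval 0 a = 0"
  by (simp add: peval_def)

lemma peval_pCons [simp]: "peval (pCons c p) a = of_real c + a * peval p a"
  by (cases "p = 0 \<and> c = 0") (auto simp add: peval_def)

lemma peval_add [simp]: "peval (p + q) a = peval p a + peval q a"
proof (induction p arbitrary: q)
  case (pCons c p)
  then show ?case by (cases q) (simp add: algebra_simps)
qed simp

lemma peval_smult [simp]: "peval (smult c p) a = c *\<^sub>R peval p a"
  by (induction p) (simp_all add: algebra_simps of_real_def)

lemma peval_minus [simp]: "peval (- p) a = - peval p a"
  using peval_smult [of "- 1" p a] by simp

lemma peval_diff [simp]: "peval (p - q) a = peval p a - peval q a"
  using peval_add [of p "- q" a] by simp

lemma peval_mult [simp]: "peval (p * q) a = peval p a * peval q a"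
  by (induction p) (simp_all add: algebra_simps of_real_def)

lemma peval_of_real: "peval p (of_real t) = of_real (poly p t)"
  by (induction p) simp_all

lemma peval_intertwine: "x * a = b * x \<Longrightarrow> x * peval p a = peval p b * x"
proof (induction p)
  case (pCons c p)
  then have "x * (a * peval p a) = b * peval p b * x" by (metis mult.assoc)
  then show ?case by (simp add: distrib_left distrib_right of_real_def)
qed simp

lemma peval_commute: "peval p a * peval q a = peval q a * peval p a"
  by (metis mult.commute peval_mult)

lemma star_peval: "star a = a \<Longrightarrow> star (peval p a) = peval p (a::'a::cstar_algebra_1)"
proof (induction p)
  case (pCons c p)
  then show ?case using peval_intertwine [of a a a p] by (simp add: star_add star_mult)
qed simp

section \<open>Polynomials nonnegative on an interval\<close>

lemma poly_nonneg_at_limit: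
  fixes q :: "real poly"
  assumes "l < u" "r \<in> {l..u}" "\<And>t. t \<in> {l..u} \<Longrightarrow> t \<noteq> r \<Longrightarrow> 0 \<le> poly q t"
  shows "0 \<le> poly q r"
proof (rule continuous_ge_on_closure [of "{l..u} - {r}" "poly q"])
  show "continuous_on (closure ({l..u} - {r})) (poly q)" by (intro continuous_intros)
  show "r \<in> closure ({l..u} - {r})"
    using assms islimpt_Icc [of l u r] by (simp flip: islimpt_in_closure)
qed (use assms in auto)

lemma real_poly_complex_root:
  assumes "degree p > 0"
  obtains z :: complex where "peval p z = 0"
proof -
  let ?q = "map_poly complex_of_real p"
  have "degree ?q = degree p" by (rule degree_map_poly) simp
  then have "\<not> constant (poly ?q)" using assms by (simp add: constant_degree)
  then obtain z where "poly ?q z = 0" using fundamental_theorem_of_algebra by blast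
  moreover have "peval p z = poly (map_poly complex_of_real p) z"
    by (induction p) (simp_all add: map_poly_pCons)
  ultimately show ?thesis using that by metis
qed

text \<open>The divisor is (X - z)(X - cnj z). The remainder is real of degree at most 1 and
  vanishes at the nonreal z, so it is zero.\<close>

lemma real_poly_quadratic_dvd:
  fixes z :: complex
  assumes z: "peval p z = 0" and im: "Im z \<noteq> 0"
  shows "[:(cmod z)\<^sup>2, - 2 * Re z, 1:] dvd p"
proof -
  define d where "d = [:(cmod z)\<^sup>2, - 2 * Re z, 1:]"
  define r where "r = p mod d"
  have dz: "peval d z = 0"
    by (simp add: d_def complex_eq_iff cmod_def power2_eq_square algebra_simps)
  have "p = d * (p div d) + r" by (simp add: r_def)
  then have rz: "peval r z = 0" using z dz by (metis add_0 mult_zero_left peval_add peval_mult)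
  have d0: "d \<noteq> 0" by (simp add: d_def)
  have "coeff r n = 0" if "n \<ge> 2" for n
  proof (cases "r = 0")
    case False
    then have "degree r < degree d" using degree_mod_less [OF d0, of p] by (simp add: r_def)
    then show ?thesis using that by (intro coeff_eq_0) (simp add: d_def)
  qed simp
  then have r: "r = [:coeff r 0, coeff r 1:]"
    by (intro poly_eqI) (auto simp: coeff_pCons split: nat.splits)
  then have "complex_of_real (coeff r 0) + z * of_real (coeff r 1) = 0"
    using rz by (metis add.right_neutral mult_zero_right peval_0 peval_pCons)
  then have "coeff r 1 = 0" "coeff r 0 = 0" using im by (auto simp: complex_eq_iff)
  then have "r = 0" using r by simp
  then show ?thesis by (simp add: r_def d_def mod_eq_0_iff_dvd)
qed

text \<open>Takes the place of the spectral mapping theorem. By induction on the degree, a positive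
  factor is split off at a complex root: a nonreal pair gives a square plus a positive constant, a
  real root r outside the open interval gives a - r or r - a, and a root r inside is at least double
  and gives the square of a - r. Commuting positive factors have a positive product.\<close>

lemma cpos_peval:
  assumes a: "cpos a" and M: "norm a \<le> M" "0 < M"
    and "\<And>t. t \<in> {0..M} \<Longrightarrow> 0 \<le> poly p t"
  shows "cpos (peval p a)"
  using assms(4)
proof (induction "degree p" arbitrary: p rule: less_induct)
  case less
  have mult: "cpos (peval q a * peval s a)" if "cpos (peval q a)" "cpos (peval s a)" for q s
    using that by (simp add: cpos_mult_commuting peval_commute)
  show ?case
  proof (cases "degree p = 0")
    case True
    then obtain c where "p = [:c:]" by (rule degree_eq_zeroE)
    then show ?thesis using less.prems [of 0] M by (simp add: cpos_of_real)
  next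
    case False
    then obtain z :: complex where z: "peval p z = 0" using real_poly_complex_root by blast
    show ?thesis
    proof (cases "Im z = 0")
      case im: False
      define d where "d = [:(cmod z)\<^sup>2, - 2 * Re z, 1:]"
      obtain s where s: "p = d * s"
        using real_poly_quadratic_dvd [OF z im] by (auto simp: d_def elim: dvdE)
      have d: "poly d t = (t - Re z)\<^sup>2 + (Im z)\<^sup>2" for t
        by (simp add: d_def cmod_def power2_eq_square algebra_simps)
      have "0 \<le> poly s t" if "t \<in> {0..M}" for t
      proof -
        have "0 < poly d t" using im by (simp add: d add_nonneg_pos)
        then show ?thesis using less.prems [OF that] by (simp add: s zero_le_mult_iff)
      qed
      moreover have "degree s < degree p"
      proof -
        have "s \<noteq> 0" using s False by auto
        then show ?thesis unfolding s by (subst degree_mult_eq) (auto simp: d_def)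
      qed
      ultimately have "cpos (peval s a)" using less.hyps by blast
      moreover have "peval d a = (a - of_real (Re z)) * (a - of_real (Re z)) + of_real ((Im z)\<^sup>2)"
        by (simp add: d_def cmod_def power2_eq_square algebra_simps of_real_def flip: scaleR_add_left)
      then have "cpos (peval d a)"
        using a by (simp add: cpos_add cpos_square cpos_of_real star_diff cpos_sa del: of_real_power)
      ultimately show ?thesis using mult by (simp add: s)
    next
      case True
      define r where "r = Re z"
      have "z = of_real r" using True by (simp add: r_def complex_eq_iff)
      then have "complex_of_real (poly p r) = 0"
        using z by (simp add: peval_of_real)
      then have pr: "poly p r = 0" by simp
      then obtain q where q: "p = [:- r, 1:] * q" using poly_eq_0_iff_dvd by (metis dvdE)
      have q0: "q \<noteq> 0" using q False by auto
      have degq: "degree q < degree p" unfolding q using q0 by (subst degree_mult_eq) auto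
      have pt: "poly p t = (t - r) * poly q t" for t by (simp add: q algebra_simps)
      have pos: "0 \<le> poly q t" if "t \<in> {0..M}" "t > r" for t
        using less.prems [OF that(1)] that(2) by (simp add: pt zero_le_mult_iff)
      have neg: "0 \<le> poly (- q) t" if "t \<in> {0..M}" "t < r" for t
        using less.prems [OF that(1)] that(2) by (simp add: pt zero_le_mult_iff)
      consider "r \<le> 0" | "M \<le> r" | "0 < r" "r < M" by linarith
      then show ?thesis
      proof cases
        case 1
        have "0 \<le> poly q t" if "t \<in> {0..M}" for t
          using pos poly_nonneg_at_limit [of 0 M t q] 1 that M
          by (cases "t = r") (auto simp: less_le)
        then have "cpos (peval q a)" using less.hyps degq by blast
        moreover have "cpos (peval [:- r, 1:] a)"
          using cpos_add [OF a cpos_of_real [of "- r"]] 1 by (simp add: add.commute)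
        ultimately show ?thesis using mult unfolding q peval_mult by blast
      next
        case 2
        have "0 \<le> poly (- q) t" if "t \<in> {0..M}" for t
          using neg poly_nonneg_at_limit [of 0 M t "- q"] 2 that M
          by (cases "t = r") (auto simp: less_le)
        then have "cpos (peval (- q) a)" using less.hyps [of "- q"] degq by simp
        moreover have "cpos (peval [:r, - 1:] a)"
          using cpos_diff_of_real [of a r] 2 M a by (simp add: cpos_sa)
        moreover have "p = [:r, - 1:] * (- q)" by (simp add: q)
        ultimately show ?thesis using mult by (metis peval_mult)
      next
        case 3
        have "0 \<le> poly q r"
        proof (rule poly_nonneg_at_limit [of r M])
          show "0 \<le> poly q t" if "t \<in> {r..M}" "t \<noteq> r" for t
            using 3 that by (intro pos) auto
        qed (use 3 in auto)
        moreover have "0 \<le> poly (- q) r"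
        proof (rule poly_nonneg_at_limit [of 0 r])
          show "0 \<le> poly (- q) t" if "t \<in> {0..r}" "t \<noteq> r" for t
            using 3 that by (intro neg) auto
        qed (use 3 in auto)
        ultimately have "poly q r = 0" by simp
        then obtain s where s: "q = [:- r, 1:] * s" using poly_eq_0_iff_dvd by (metis dvdE)
        have st: "poly p t = (t - r)\<^sup>2 * poly s t" for t
          by (simp add: pt s power2_eq_square algebra_simps)
        have "0 \<le> poly s t" if "t \<in> {0..M}" "t \<noteq> r" for t
          using less.prems [OF that(1)] that(2) by (simp add: st zero_le_mult_iff)
        then have "0 \<le> poly s t" if "t \<in> {0..M}" for t
          using poly_nonneg_at_limit [of 0 M t s] that M by (cases "t = r") auto
        moreover have "degree s < degree p"
          using degq q0 unfolding s by (subst (asm) degree_mult_eq) auto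
        ultimately have "cpos (peval s a)" using less.hyps by blast
        moreover have "cpos (peval ([:- r, 1:] * [:- r, 1:]) a)"
          unfolding peval_mult using a by (intro cpos_square star_peval cpos_sa)
        moreover have "p = ([:- r, 1:] * [:- r, 1:]) * s" by (simp only: q s mult.assoc)
        ultimately show ?thesis using mult by (metis peval_mult)
      qed
    qed
  qed
qed

text \<open>Positivity of e - p and e + p at a. Evaluation is thus contractive for the supremum norm
  and extends from polynomials to continuous functions.\<close>

lemma norm_peval_le:
  assumes a: "cpos a" and M: "norm a \<le> M" "0 < M"
    and p: "\<And>t. t \<in> {0..M} \<Longrightarrow> \<bar>poly p t\<bar> \<le> e"
  shows "norm (peval p a) \<le> e"
proof (rule norm_le_if_cpos)
  show "star (peval p a) = peval p a" using a by (simp add: star_peval cpos_sa)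
  show "0 \<le> e" using p [of 0] M by simp
  have "cpos (peval ([:e:] - p) a)"
    using p by (intro cpos_peval [OF a M]) (auto simp: abs_le_iff)
  then show "cpos (of_real e - peval p a)" by simp
  have "cpos (peval ([:e:] + p) a)"
  proof (intro cpos_peval [OF a M])
    show "0 \<le> poly ([:e:] + p) t" if "t \<in> {0..M}" for t
      using p [OF that] by simp
  qed
  then show "cpos (of_real e + peval p a)" by (simp only: peval_add) simp
qed

text \<open>Functions are only evaluated on \<open>{0..}\<close>; \<open>fc f a\<close> is meaningful for \<open>a\<close> positive and \<open>f\<close> continuous there.\<close>

definition fc :: "(real \<Rightarrow> real) \<Rightarrow> 'a::cstar_algebra_1 \<Rightarrow> 'a"
  where "fc f a = lim (\<lambda>n. peval
    ((SOME p. uniform_limit {0..norm a + 1} (\<lambda>n. poly (p n)) f sequentially) n) a)"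

lemma poly_approx:
  fixes f :: "real \<Rightarrow> real"
  assumes "continuous_on {0..} f" "0 < e"
  obtains p where "\<And>t. t \<in> {0..M} \<Longrightarrow> \<bar>f t - poly p t\<bar> \<le> e"
proof -
  have "continuous_on {0..M} f" using assms(1) by (rule continuous_on_subset) auto
  then obtain g where g: "real_polynomial_function g" "\<And>t. t \<in> {0..M} \<Longrightarrow> \<bar>f t - g t\<bar> < e"
    using Stone_Weierstrass_real_polynomial_function [of "{0..M}" f e] assms(2) by auto
  obtain c n where "g = (\<lambda>x. \<Sum>i\<le>n. c i * x ^ i)"
    using g(1) by (auto simp: real_polynomial_function_iff_sum)
  then have "poly (\<Sum>i\<le>n. monom (c i) i) t = g t" for t
    by (simp add: poly_sum poly_monom)
  then show ?thesis using g(2) that [of "\<Sum>i\<le>n. monom (c i) i"] by (auto intro: less_imp_le)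
qed

lemma poly_uniform_limit:
  fixes f :: "real \<Rightarrow> real"
  assumes "continuous_on {0..} f"
  obtains p where "uniform_limit {0..M} (\<lambda>n. poly (p n)) f sequentially"
proof -
  have "\<exists>p. \<forall>t\<in>{0..M}. \<bar>f t - poly p t\<bar> \<le> inverse (Suc n)" for n
    using poly_approx [OF assms, of "inverse (Suc n)" M] by (metis inverse_positive_iff_positive of_nat_0_less_iff zero_less_Suc)
  then obtain p where p: "\<bar>f t - poly (p n) t\<bar> \<le> inverse (Suc n)" if "t \<in> {0..M}" for n t by metis
  have "uniform_limit {0..M} (\<lambda>n. poly (p n)) f sequentially"
  proof (rule uniform_limitI)
    fix e :: real assume "0 < e"
    with LIMSEQ_inverse_real_of_nat have "\<forall>\<^sub>F n in sequentially. inverse (Suc n) < e" by (rule order_tendstoD)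
    then show "\<forall>\<^sub>F n in sequentially. \<forall>t\<in>{0..M}. dist (poly (p n) t) (f t) < e"
    proof eventually_elim
      case (elim n)
      show ?case
      proof
        fix t assume "t \<in> {0..M}"
        then show "dist (poly (p n) t) (f t) < e" using p [of t n] elim unfolding dist_real_def by linarith
      qed
    qed
  qed
  then show ?thesis by (rule that)
qed

text \<open>Independence of the polynomials and of the interval chosen in \<open>fc\<close>: on the
  shorter of the two intervals both sequences approximate f uniformly, so by
  \<open>norm_peval_le\<close> their values at a have the same limit.\<close>

lemma fc_tendsto:
  assumes a: "cpos a" and f: "continuous_on {0..} f" and M: "norm a \<le> M" "0 < M"
    and p: "uniform_limit {0..M} (\<lambda>n. poly (p n)) f sequentially"
  shows "(\<lambda>n. peval (p n) a) \<longlonglongrightarrow> fc f a"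
proof -
  define q where "q = (SOME p. uniform_limit {0..norm a + 1} (\<lambda>n. poly (p n)) f sequentially)"
  have q: "uniform_limit {0..norm a + 1} (\<lambda>n. poly (q n)) f sequentially"
  proof -
    obtain r where "uniform_limit {0..norm a + 1} (\<lambda>n. poly (r n)) f sequentially" by (rule poly_uniform_limit [OF f])
    then show ?thesis
      unfolding q_def by (rule someI [where P = "\<lambda>p. uniform_limit {0..norm a + 1} (\<lambda>n. poly (p n)) f sequentially"])
  qed
  let ?K = "min M (norm a + 1)"
  have K: "norm a \<le> ?K" "0 < ?K" using M by (auto intro: add_nonneg_pos)
  have pK: "uniform_limit {0..?K} (\<lambda>n. poly (p n)) f sequentially"
    and qK: "uniform_limit {0..?K} (\<lambda>n. poly (q n)) f sequentially"
    using uniform_limit_on_subset [OF p, of "{0..?K}"] uniform_limit_on_subset [OF q, of "{0..?K}"] by simp_all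
  have close: "\<exists>N. \<forall>m\<ge>N. \<forall>n\<ge>N. dist (peval (r m) a) (peval (q n) a) < e"
    if r: "uniform_limit {0..?K} (\<lambda>n. poly (r n)) f sequentially" and e: "0 < e" for r e
  proof -
    have "0 < e / 3" using e by simp
    from eventually_conj [OF uniform_limitD [OF r this] uniform_limitD [OF qK this]]
    obtain N where N: "dist (poly (r n) t) (f t) < e / 3" "dist (poly (q n) t) (f t) < e / 3"
      if "n \<ge> N" "t \<in> {0..?K}" for n t
      unfolding eventually_sequentially by blast
    have "norm (peval (r m - q n) a) \<le> 2 * e / 3" if "m \<ge> N" "n \<ge> N" for m n
    proof (rule norm_peval_le [OF a K])
      show "\<bar>poly (r m - q n) t\<bar> \<le> 2 * e / 3" if "t \<in> {0..?K}" for t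
        using N(1) [OF \<open>m \<ge> N\<close> that] N(2) [OF \<open>n \<ge> N\<close> that]
        unfolding dist_real_def poly_diff by linarith
    qed
    moreover have "2 * e / 3 < e" using e by simp
    ultimately have "dist (peval (r m) a) (peval (q n) a) < e" if "m \<ge> N" "n \<ge> N" for m n
      unfolding dist_norm peval_diff [symmetric] using that by (meson le_less_trans)
    then show ?thesis by blast
  qed
  have "Cauchy (\<lambda>n. peval (q n) a)" using close [OF qK] unfolding Cauchy_def by blast
  then have lim: "(\<lambda>n. peval (q n) a) \<longlonglongrightarrow> fc f a"
    unfolding fc_def q_def [symmetric] by (simp add: Cauchy_convergent_iff convergent_LIMSEQ_iff)
  have "(\<lambda>n. peval (p n) a - peval (q n) a) \<longlonglongrightarrow> 0"
    unfolding lim_sequentially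
  proof (intro allI impI)
    fix e :: real assume "0 < e"
    then obtain N where "\<And>m n. m \<ge> N \<Longrightarrow> n \<ge> N \<Longrightarrow> dist (peval (p m) a) (peval (q n) a) < e" using close [OF pK] by meson
    then show "\<exists>N. \<forall>n\<ge>N. dist (peval (p n) a - peval (q n) a) 0 < e" by (auto simp: dist_norm)
  qed
  from tendsto_add [OF this lim] show ?thesis by simp
qed

lemma fc_approx:
  assumes a: "cpos a" and f: "continuous_on {0..} f" and M: "norm a \<le> M" "0 < M"
    and p: "\<And>t. t \<in> {0..M} \<Longrightarrow> \<bar>f t - poly p t\<bar> \<le> e"
  shows "norm (fc f a - peval p a) \<le> e"
proof (rule field_le_epsilon)
  fix d :: real assume d: "0 < d"
  obtain q where q: "uniform_limit {0..M} (\<lambda>n. poly (q n)) f sequentially" by (rule poly_uniform_limit [OF f])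
  have "(\<lambda>n. norm (peval (q n) a - peval p a)) \<longlonglongrightarrow> norm (fc f a - peval p a)"
    by (intro tendsto_intros fc_tendsto [OF a f M q])
  moreover have "\<forall>\<^sub>F n in sequentially. norm (peval (q n) a - peval p a) \<le> e + d"
    using uniform_limitD [OF q d]
  proof eventually_elim
    case (elim n)
    have "norm (peval (q n - p) a) \<le> e + d"
    proof (rule norm_peval_le [OF a M])
      fix t assume t: "t \<in> {0..M}"
      then have "dist (poly (q n) t) (f t) < d" using elim by blast
      then show "\<bar>poly (q n - p) t\<bar> \<le> e + d" using p [OF t] unfolding dist_real_def poly_diff by linarith
    qed
    then show ?case by simp
  qed
  ultimately show "norm (fc f a - peval p a) \<le> e + d" by (rule tendsto_upperbound) simp
qed

lemma fc_cong: "(\<And>t. 0 \<le> t \<Longrightarrow> f t = g t) \<Longrightarrow> fc f a = fc g a"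
proof -
  assume "\<And>t. 0 \<le> t \<Longrightarrow> f t = g t"
  then have "uniform_limit {0..norm a + 1} h f sequentially \<longleftrightarrow> uniform_limit {0..norm a + 1} h g sequentially" for h
    by (intro uniform_limit_cong') auto
  then show ?thesis by (simp add: fc_def)
qed

lemma fc_poly: "cpos a \<Longrightarrow> (\<And>t. 0 \<le> t \<Longrightarrow> f t = poly p t) \<Longrightarrow> fc f a = peval p a"
proof -
  assume a: "cpos a" and f: "\<And>t. 0 \<le> t \<Longrightarrow> f t = poly p t"
  have "continuous_on {0..} f \<longleftrightarrow> continuous_on {0..} (poly p)"
    using f by (intro continuous_on_cong) auto
  then have "continuous_on {0..} f" by (simp add: continuous_intros)
  then have "norm (fc f a - peval p a) \<le> 0"
    using f by (intro fc_approx [OF a, of f "norm a + 1"]) (auto intro: add_nonneg_pos)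
  then show ?thesis by simp
qed

lemma fc_id: "cpos a \<Longrightarrow> fc (\<lambda>t. t) a = a"
  by (subst fc_poly [of _ _ "[:0, 1:]"]) auto

lemma fc_const: "cpos a \<Longrightarrow> fc (\<lambda>t. c) a = of_real c"
  by (subst fc_poly [of _ _ "[:c:]"]) auto

lemma fc_norm_le:
  assumes a: "cpos a" and f: "continuous_on {0..} f" and M: "norm a \<le> M" "0 < M"
    and e: "\<And>t. t \<in> {0..M} \<Longrightarrow> \<bar>f t\<bar> \<le> e"
  shows "norm (fc f a) \<le> e"
  using fc_approx [OF a f M, of 0 e] e by simp

lemma fc_add:
  assumes a: "cpos a" and f: "continuous_on {0..} f" and g: "continuous_on {0..} g"
  shows "fc (\<lambda>t. f t + g t) a = fc f a + fc g a"
proof -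
  let ?M = "norm a + 1"
  have M: "norm a \<le> ?M" "0 < ?M" by (auto intro: add_nonneg_pos)
  obtain p where p: "uniform_limit {0..?M} (\<lambda>n. poly (p n)) f sequentially" by (rule poly_uniform_limit [OF f])
  obtain q where q: "uniform_limit {0..?M} (\<lambda>n. poly (q n)) g sequentially" by (rule poly_uniform_limit [OF g])
  have "(\<lambda>n. peval (p n + q n) a) \<longlonglongrightarrow> fc (\<lambda>t. f t + g t) a"
  proof (rule fc_tendsto [OF a _ M])
    show "uniform_limit {0..?M} (\<lambda>n. poly (p n + q n)) (\<lambda>t. f t + g t) sequentially"
      using uniform_limit_add [OF p q] by (simp cong: uniform_limit_cong')
  qed (intro continuous_intros f g)
  moreover have "(\<lambda>n. peval (p n + q n) a) \<longlonglongrightarrow> fc f a + fc g a"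
    unfolding peval_add by (intro tendsto_add fc_tendsto [OF a f M p] fc_tendsto [OF a g M q])
  ultimately show ?thesis by (rule LIMSEQ_unique)
qed

lemma continuous_on_bounded_Icc:
  fixes f :: "real \<Rightarrow> real"
  assumes "continuous_on {0..} f"
  shows "bounded (f ` {0..M})"
proof -
  have "continuous_on {0..M} f" using assms by (rule continuous_on_subset) auto
  then show ?thesis by (intro compact_imp_bounded compact_continuous_image) auto
qed

lemma fc_mult:
  assumes a: "cpos a" and f: "continuous_on {0..} f" and g: "continuous_on {0..} g"
  shows "fc (\<lambda>t. f t * g t) a = fc f a * fc g a"
proof -
  let ?M = "norm a + 1"
  have M: "norm a \<le> ?M" "0 < ?M" by (auto intro: add_nonneg_pos)
  obtain p where p: "uniform_limit {0..?M} (\<lambda>n. poly (p n)) f sequentially" by (rule poly_uniform_limit [OF f])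
  obtain q where q: "uniform_limit {0..?M} (\<lambda>n. poly (q n)) g sequentially" by (rule poly_uniform_limit [OF g])
  have "(\<lambda>n. peval (p n * q n) a) \<longlonglongrightarrow> fc (\<lambda>t. f t * g t) a"
  proof (rule fc_tendsto [OF a _ M])
    show "uniform_limit {0..?M} (\<lambda>n. poly (p n * q n)) (\<lambda>t. f t * g t) sequentially"
      using uniform_lim_mult [OF p q] continuous_on_bounded_Icc f g by (simp cong: uniform_limit_cong')
  qed (intro continuous_intros f g)
  moreover have "(\<lambda>n. peval (p n * q n) a) \<longlonglongrightarrow> fc f a * fc g a"
    unfolding peval_mult by (intro tendsto_mult fc_tendsto [OF a f M p] fc_tendsto [OF a g M q])
  ultimately show ?thesis by (rule LIMSEQ_unique)
qed

lemma fc_scale: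
  assumes "cpos a" "continuous_on {0..} f"
  shows "fc (\<lambda>t. c * f t) a = c *\<^sub>R fc f a"
  using assms fc_mult [of a "\<lambda>t. c" f] by (simp add: fc_const scaleR_conv_of_real continuous_intros)

lemma fc_diff:
  assumes "cpos a" "continuous_on {0..} f" "continuous_on {0..} g"
  shows "fc (\<lambda>t. f t - g t) a = fc f a - fc g a"
proof -
  have "fc (\<lambda>t. f t + (- 1) * g t) a = fc f a + fc (\<lambda>t. (- 1) * g t) a"
    using assms by (intro fc_add continuous_intros)
  also have "fc (\<lambda>t. (- 1) * g t) a = (- 1) *\<^sub>R fc g a" using assms by (intro fc_scale)
  finally show ?thesis by simp
qed

lemma star_fc:
  assumes a: "cpos a" and f: "continuous_on {0..} f"
  shows "star (fc f a) = fc f a"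
proof -
  obtain p where p: "uniform_limit {0..norm a + 1} (\<lambda>n. poly (p n)) f sequentially" by (rule poly_uniform_limit [OF f])
  have lim: "(\<lambda>n. peval (p n) a) \<longlonglongrightarrow> fc f a"
    by (rule fc_tendsto [OF a f _ _ p]) (auto intro: add_nonneg_pos)
  then have "(\<lambda>n. star (peval (p n) a)) \<longlonglongrightarrow> star (fc f a)" by (rule tendsto_star)
  with lim show ?thesis using a by (simp add: star_peval cpos_sa LIMSEQ_unique)
qed

text \<open>One sequence of polynomials serves both elements, on an interval that is long enough for
  both. The typical use is x f(star x * x) = f(x * star x) x.\<close>

lemma fc_intertwine:
  assumes a: "cpos a" and b: "cpos b" and f: "continuous_on {0..} f" and x: "x * a = b * x"
  shows "x * fc f a = fc f b * x"
proof -
  let ?M = "max (norm a) (norm b) + 1"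
  have M: "norm a \<le> ?M" "norm b \<le> ?M" "0 < ?M" by (auto intro: add_nonneg_pos simp: le_max_iff_disj)
  obtain p where p: "uniform_limit {0..?M} (\<lambda>n. poly (p n)) f sequentially" by (rule poly_uniform_limit [OF f])
  have "(\<lambda>n. x * peval (p n) a) \<longlonglongrightarrow> x * fc f a"
    by (intro tendsto_mult_left fc_tendsto [OF a f M(1,3) p])
  moreover have "(\<lambda>n. x * peval (p n) a) \<longlonglongrightarrow> fc f b * x"
    unfolding peval_intertwine [OF x] by (intro tendsto_mult_right fc_tendsto [OF b f M(2,3) p])
  ultimately show ?thesis by (rule LIMSEQ_unique)
qed

lemma fc_commute: "cpos a \<Longrightarrow> continuous_on {0..} f \<Longrightarrow> x * a = a * x \<Longrightarrow> x * fc f a = fc f a * x"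
  by (rule fc_intertwine)

lemma cpos_fc:
  assumes a: "cpos a" and f: "continuous_on {0..} f" and nn: "\<And>t. 0 \<le> t \<Longrightarrow> 0 \<le> f t"
  shows "cpos (fc f a)"
proof -
  have s: "continuous_on {0..} (\<lambda>t. sqrt (f t))" by (intro continuous_intros f)
  have "fc f a = fc (\<lambda>t. sqrt (f t) * sqrt (f t)) a"
    by (rule fc_cong) (simp add: nn)
  also have "\<dots> = fc (\<lambda>t. sqrt (f t)) a * fc (\<lambda>t. sqrt (f t)) a" by (rule fc_mult [OF a s s])
  finally show ?thesis by (simp add: cpos_square star_fc [OF a s])
qed

lemma fc_compose:
  assumes a: "cpos a" and f: "continuous_on {0..} f" and g: "continuous_on {0..} g"
    and nn: "\<And>t. 0 \<le> t \<Longrightarrow> 0 \<le> g t"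
  shows "fc f (fc g a) = fc (\<lambda>t. f (g t)) a"
proof -
  let ?K = "norm a + 1"
  have K: "norm a \<le> ?K" "0 < ?K" by (auto intro: add_nonneg_pos)
  obtain M where M: "0 < M" "\<And>t. t \<in> {0..?K} \<Longrightarrow> \<bar>g t\<bar> \<le> M"
    using continuous_on_bounded_Icc [OF g, where M = ?K] by (auto simp: bounded_pos)
  have gM: "norm (fc g a) \<le> M" using M by (intro fc_norm_le [OF a g K]) auto
  have ga: "cpos (fc g a)" by (rule cpos_fc [OF a g nn])
  have fg: "continuous_on {0..} (\<lambda>t. f (g t))"
    by (rule continuous_on_compose2 [OF f g]) (auto simp: nn)
  have pg: "continuous_on {0..} (\<lambda>t. poly p (g t))" for p by (intro continuous_intros g)
  have poly: "peval p (fc g a) = fc (\<lambda>t. poly p (g t)) a" for p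
  proof (induction p)
    case 0
    then show ?case using a by (simp add: fc_const)
  next
    case (pCons c p)
    then show ?case using a g pg
      by (simp add: fc_add fc_mult fc_const continuous_intros)
  qed
  have "norm (fc f (fc g a) - fc (\<lambda>t. f (g t)) a) \<le> 0"
  proof (rule field_le_epsilon)
    fix e :: real assume "0 < e"
    then have e: "0 < e / 2" by simp
    obtain p where p: "\<And>t. t \<in> {0..M} \<Longrightarrow> \<bar>f t - poly p t\<bar> \<le> e / 2"
      using poly_approx [OF f e, where M = M] by blast
    have "norm (fc f (fc g a) - peval p (fc g a)) \<le> e / 2"
      using M by (intro fc_approx [OF ga f gM _ p]) auto
    moreover have "norm (fc (\<lambda>t. f (g t) - poly p (g t)) a) \<le> e / 2"
    proof (rule fc_norm_le [OF a _ K])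
      show "continuous_on {0..} (\<lambda>t. f (g t) - poly p (g t))" by (intro continuous_intros fg pg)
      show "\<bar>f (g t) - poly p (g t)\<bar> \<le> e / 2" if "t \<in> {0..?K}" for t
        using M(2) [OF that] nn [of t] that by (intro p) auto
    qed
    ultimately show "norm (fc f (fc g a) - fc (\<lambda>t. f (g t)) a) \<le> 0 + e"
      using norm_triangle_ineq4 [of "fc f (fc g a) - peval p (fc g a)" "fc (\<lambda>t. f (g t) - poly p (g t)) a"]
      by (simp add: fc_diff [OF a fg pg] poly)
  qed
  then show ?thesis by simp
qed

section \<open>Powers and operator monotonicity\<close>

lemma fc_sqrt_square:
  assumes "cpos c"
  shows "fc sqrt (c * c) = c"
proof -
  have "c * c = fc (\<lambda>t. t * t) c"
    using assms fc_mult [of c "\<lambda>t. t" "\<lambda>t. t"] by (simp add: fc_id continuous_intros)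
  then have "fc sqrt (c * c) = fc sqrt (fc (\<lambda>t. t * t) c)" by simp
  also have "\<dots> = fc (\<lambda>t. sqrt (t * t)) c"
    by (rule fc_compose [OF assms]) (auto intro!: continuous_intros)
  also have "\<dots> = fc (\<lambda>t. t) c"
    by (rule fc_cong) simp
  finally show ?thesis by (simp add: fc_id assms)
qed

text \<open>Since \<open>fc\<close> accepts only positive elements, h is shifted by m = norm h, and
  the two parts are the positive and negative part of t - m evaluated at h + m.\<close>

lemma positive_negative_parts:
  fixes h :: "'a::cstar_algebra_1"
  assumes h: "star h = h"
  obtains p n where "cpos p" "cpos n" "h = p - n" "p * n = 0" "n * p = 0"
proof -
  define m where "m = norm h"
  define a where "a = of_real m + h"
  have a: "cpos a" unfolding a_def m_def by (rule cpos_add_of_real [OF h]) simp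
  define f g where "f t = max 0 (t - m)" and "g t = max 0 (m - t)" for t :: real
  have cont: "continuous_on {0..} f" "continuous_on {0..} g"
    unfolding f_def g_def by (intro continuous_intros)+
  have fg: "f t * g t = 0" "g t * f t = 0" for t by (auto simp: f_def g_def max_def)
  have 0: "fc f a * fc g a = 0" "fc g a * fc f a = 0"
    using a cont fc_mult [of a f g] fc_mult [of a g f] by (simp_all add: fg fc_const)
  have "fc f a - fc g a = fc (\<lambda>t. f t - g t) a"
    by (rule fc_diff [OF a cont, symmetric])
  also have "\<dots> = peval [:- m, 1:] a"
    by (rule fc_poly [OF a]) (auto simp: f_def g_def)
  also have "\<dots> = h" by (simp add: a_def)
  finally have eq: "h = fc f a - fc g a" ..
  show ?thesis
  proof (rule that)
    show "cpos (fc f a)" by (rule cpos_fc [OF a cont(1)]) (simp add: f_def)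
    show "cpos (fc g a)" by (rule cpos_fc [OF a cont(2)]) (simp add: g_def)
  qed (rule eq 0)+
qed

text \<open>With \<open>n\<close> the negative part of \<open>x\<^sup>* x\<close> and \<open>z = x n\<close>, one has \<open>z\<^sup>* z = - n\<^sup>3\<close>, while
  \<open>z z\<^sup>*\<close> is positive; as \<open>z\<close> intertwines the squares of \<open>n\<^sup>3\<close> and \<open>z z\<^sup>*\<close>, it also intertwines
  their positive square roots, which forces \<open>z = 0\<close>.\<close>

lemma cpos_star_mult_self: "cpos (star x * x)"
  for x :: "'a::cstar_algebra_1"
proof -
  obtain p n where pn: "cpos p" "cpos n" "star x * x = p - n" "p * n = 0" "n * p = 0"
    using positive_negative_parts [of "star x * x"] by (auto simp: star_mult star_star)
  define z where "z = x * n"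
  define c where "c = n * n * n"
  define q where "q = z * star z"
  have sn: "star n = n" using pn(2) by (rule cpos_sa)
  have c: "cpos c"
    unfolding c_def using pn(2) sn by (auto intro!: cpos_mult_commuting cpos_square simp: mult.assoc)
  have "star z * z = n * (star x * x) * n" by (simp add: z_def star_mult sn mult.assoc)
  then have zz: "star z * z = - c" using pn(4) by (simp add: pn(3) c_def left_diff_distrib right_diff_distrib mult.assoc)
  \<comment> \<open>Twice z z^* + z^* z is the sum of the squares of the self-adjoint elements z +
    z^* and k. Adding c to z z^* + z^* z = q - c shows that q is positive.\<close>
  define k where "k = \<i> *\<^sub>C (z - star z)"
  have kk: "k * k = - ((z - star z) * (z - star z))"
    by (simp add: k_def mult_scaleC_left mult_scaleC_right scaleC_scaleC)
  have "star k = k"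
    by (simp add: k_def star_scaleC star_diff star_star scaleC_diff_right)
  then have "cpos ((z + star z) * (z + star z) + k * k)"
    by (intro cpos_add cpos_square) (simp_all add: star_add star_star add.commute)
  also have "(z + star z) * (z + star z) + k * k = 2 *\<^sub>R (q - c)"
    unfolding kk using zz by (simp add: q_def algebra_simps scaleR_2)
  finally have "cpos ((1/2) *\<^sub>R (2 *\<^sub>R (q - c)))" by (rule cpos_scaleR) simp
  then have q: "cpos q" using cpos_add [OF _ c, of "q - c"] by simp
  have zc: "z * c = - (q * z)" using zz by (metis minus_mult_right mult.assoc q_def minus_minus)
  have "z * (c * c) = (q * q) * z" by (metis zc mult.assoc minus_mult_left minus_mult_right minus_minus)
  then have "z * fc sqrt (c * c) = fc sqrt (q * q) * z"
    by (intro fc_intertwine cpos_square cpos_sa c q continuous_intros)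
  then have "z * c = q * z" by (simp add: fc_sqrt_square c q)
  then have "z * c + z * c = 0" using zc by (simp add: add_eq_0_iff)
  then have "z * c = 0" by (simp flip: scaleR_2)
  then have "star z * z * c = 0" by (simp add: mult.assoc)
  then have "star c * c = 0" by (simp add: zz cpos_sa [OF c])
  then have "c = 0" by (simp add: star_mult_self_eq_0)
  then have "star z * z = 0" by (simp add: zz)
  have "star (n * n) * (n * n) = c * n" by (simp add: c_def star_mult sn mult.assoc)
  then have "n * n = 0" using \<open>c = 0\<close> by (simp add: star_mult_self_eq_0 del: mult_eq_0_iff)
  then have "n = 0" using sn by (metis star_mult_self_eq_0)
  then show ?thesis using pn by simp
qed

lemma cpos_conj:
  assumes "cpos a"
  shows "cpos (star x * a * x)"
proof -
  obtain q where "star q = q" "q * q = a" using cpos_sqrt [OF assms] by metis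
  then have "star x * a * x = star (q * x) * (q * x)" by (metis mult.assoc star_mult)
  then show ?thesis by (simp add: cpos_star_mult_self)
qed

lemma norm_mono: "cpos a \<Longrightarrow> cpos (b - a) \<Longrightarrow> norm a \<le> norm b"
proof (rule norm_le_if_cpos)
  assume a: "cpos a" and ba: "cpos (b - a)"
  show "star a = a" using a by (rule cpos_sa)
  have "star b = b" using cpos_sa [OF cpos_add [OF a ba]] by simp
  then have "cpos ((of_real (norm b) - b) + (b - a))" by (intro cpos_add ba cpos_diff_of_real) auto
  then show "cpos (of_real (norm b) - a)" by simp
  show "cpos (of_real (norm b) + a)" by (intro cpos_add cpos_of_real a) simp
qed simp

text \<open>Meaningful for r > 0: as \<open>0 powr 0 = 0\<close>, the function t^r fails to be
  continuous at 0 for r = 0. Where a zeroth power is wanted, 1 is written instead.\<close>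

definition upow :: "'a::cstar_algebra_1 \<Rightarrow> real \<Rightarrow> 'a"
  where "upow a r = fc (\<lambda>t. t powr r) a"

lemma continuous_on_powr_pos: "0 < r \<Longrightarrow> continuous_on {0..} (\<lambda>t::real. t powr r)"
  by (intro continuous_on_powr') (auto intro: continuous_intros)

lemma continuous_on_powr_shift: "0 < e \<Longrightarrow> continuous_on {0..} (\<lambda>t::real. (t + e) powr r)"
  by (intro continuous_on_powr' continuous_intros) auto

lemma cpos_upow: "cpos a \<Longrightarrow> 0 < r \<Longrightarrow> cpos (upow a r)"
  unfolding upow_def by (rule cpos_fc) (auto intro: continuous_on_powr_pos)

lemma star_upow: "cpos a \<Longrightarrow> 0 < r \<Longrightarrow> star (upow a r) = upow a r"
  by (simp add: cpos_sa cpos_upow)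

lemma upow_add: "cpos a \<Longrightarrow> 0 < r \<Longrightarrow> 0 < s \<Longrightarrow> upow a (r + s) = upow a r * upow a s"
  unfolding upow_def by (subst fc_mult [symmetric]) (auto intro: continuous_on_powr_pos simp: powr_add)

lemma upow_one: "cpos a \<Longrightarrow> upow a 1 = a"
  unfolding upow_def by (subst fc_poly [of _ _ "[:0, 1:]"]) auto

lemma upow_upow: "cpos a \<Longrightarrow> 0 < r \<Longrightarrow> 0 < s \<Longrightarrow> upow (upow a r) s = upow a (r * s)"
  unfolding upow_def by (subst fc_compose) (auto intro: continuous_on_powr_pos simp: powr_powr)

lemma upow_scaleR:
  assumes a: "cpos a" and r: "0 < r" and c: "0 \<le> c"
  shows "upow (c *\<^sub>R a) r = (c powr r) *\<^sub>R upow a r"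
proof -
  have "c *\<^sub>R a = fc (\<lambda>t. c * t) a"
    using a by (subst fc_scale) (auto simp: fc_id intro: continuous_intros)
  then have "upow (c *\<^sub>R a) r = fc (\<lambda>t. (c * t) powr r) a"
    unfolding upow_def using c fc_compose [OF a continuous_on_powr_pos [OF r], of "\<lambda>t. c * t"]
    by (simp add: continuous_intros)
  also have "\<dots> = fc (\<lambda>t. c powr r * t powr r) a"
    using c by (intro fc_cong) (simp add: powr_mult)
  also have "\<dots> = (c powr r) *\<^sub>R upow a r"
    unfolding upow_def using a r by (intro fc_scale continuous_on_powr_pos)
  finally show ?thesis .
qed

lemma upow_intertwine: "cpos a \<Longrightarrow> cpos b \<Longrightarrow> 0 < r \<Longrightarrow> x * a = b * x \<Longrightarrow> x * upow a r = upow b r * x"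
  unfolding upow_def by (rule fc_intertwine) (auto intro: continuous_on_powr_pos)

section \<open>The Loewner-Heinz inequality\<close>

lemma norm_power_two_power:
  fixes h :: "'a::cstar_algebra_1"
  assumes "star h = h"
  shows "norm (h ^ (2 ^ k)) = norm h ^ (2 ^ k)"
proof (induction k)
  case (Suc k)
  have "star (h ^ n) = h ^ n" for n
    by (induction n) (simp_all add: star_mult assms power_commutes)
  then have "h ^ (2 ^ Suc k) = star (h ^ (2 ^ k)) * h ^ (2 ^ k)"
    by (simp add: mult_2 power_add)
  then show ?case
    using Suc by (simp only: norm_star_mult_self) (simp add: mult_2 power_add power2_eq_square)
qed simp

text \<open>A substitute for the spectral radius formula. Bounded powers, unlike a norm bound by 1,
  are inherited by similar elements; self-adjointness recovers the norm bound through the exponents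
  2^n.\<close>

lemma norm_le_one_if_powers_bounded:
  fixes h :: "'a::cstar_algebra_1"
  assumes h: "star h = h" and K: "\<And>n. norm (h ^ n) \<le> K"
  shows "norm h \<le> 1"
proof (rule ccontr)
  assume "\<not> norm h \<le> 1"
  then have 1: "1 < norm h" by simp
  then obtain n where "K < norm h ^ n" using real_arch_pow by blast
  also have "\<dots> \<le> norm h ^ (2 ^ n)" using 1 by (intro power_increasing) (auto intro: less_imp_le)
  also have "\<dots> \<le> K" using K [of "2 ^ n"] h by (simp add: norm_power_two_power)
  finally show False by simp
qed

lemma norm_le_one_if_cpos:
  "cpos (1 - star x * x) \<Longrightarrow> norm x \<le> 1" for x :: "'a::cstar_algebra_1"
  using norm_mono [OF cpos_star_mult_self, of 1 x] by (simp add: norm_star_mult_self abs_square_le_1)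

text \<open>The induction step of Pedersen's proof of the Loewner-Heinz inequality:
  \<open>h\<close> is similar to a contraction, and being self-adjoint it is itself a contraction.\<close>

lemma cpos_midpoint:
  fixes A :: "'a::cstar_algebra_1"
  assumes sa: "star A1 = A1" "star A2 = A2" "star B2 = B2" "star C = C" "star (A2 * A1) = A2 * A1"
    and n: "norm (A1 * B1) \<le> 1" "norm (A2 * B2) \<le> 1"
    and D: "D' * D = 1" "D * B2 = C" "B1 * D' = C"
  shows "cpos (1 - C * (A2 * A1) * C)"
proof -
  define W where "W = (B2 * A2) * (A1 * B1)"
  have "norm (B2 * A2) \<le> 1" using n(2) norm_star [of "A2 * B2"] by (simp add: star_mult sa)
  then have nW: "norm W \<le> 1"
    unfolding W_def using n(1) by (intro order_trans [OF norm_mult_ineq]) (auto intro: mult_le_one)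
  define h where "h = C * (A2 * A1) * C"
  have "D * W * D' = (D * B2) * (A2 * A1) * (B1 * D')" by (simp add: W_def mult.assoc)
  then have hW: "h = D * W * D'" by (simp only: D h_def)
  \<comment> \<open>The inner factors \<open>D' * D\<close> cancel, so the powers of h are bounded
    by the norms of \<open>D\<close> and \<open>D'\<close> alone.\<close>
  have hn: "h ^ Suc n = D * W ^ Suc n * D'" for n
  proof (induction n)
    case (Suc n)
    have "h ^ Suc (Suc n) = D * W * (D' * D) * W ^ Suc n * D'"
      by (subst power_Suc, subst Suc, subst hW) (simp only: mult.assoc)
    then show ?case by (simp only: D(1)) (simp add: mult.assoc)
  qed (simp add: hW)
  have sh: "star h = h" unfolding h_def star_mult [of "_ * _" C] star_mult [of C "_ * _"] sa by (simp add: mult.assoc)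
  have "norm h \<le> 1"
  proof (rule norm_le_one_if_powers_bounded)
    show "star h = h" by (rule sh)
    show "norm (h ^ n) \<le> max 1 (norm D * norm D')" for n
    proof (cases n)
      case (Suc k)
      have "norm (W ^ Suc k) \<le> 1"
        using nW power_le_one [of "norm W" "Suc k"] norm_power_ineq [of W "Suc k"] by simp
      then have "norm D * norm (W ^ Suc k) * norm D' \<le> norm D * 1 * norm D'"
        by (intro mult_mono) auto
      moreover have "norm (h ^ n) \<le> norm D * norm (W ^ Suc k) * norm D'"
        unfolding Suc hn by (meson norm_mult_ineq order_trans mult_right_mono norm_ge_zero)
      ultimately show ?thesis by simp
    qed simp
  qed
  then show ?thesis using sh cpos_diff_of_real [of h 1] by (simp add: h_def)
qed

lemma powr_shift_le:
  fixes t e r :: real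
  assumes "0 \<le> t" "0 < e" "0 < r" "r \<le> 1"
  shows "(t + e) powr r \<le> t powr r + e powr r"
proof -
  have "x / (t + e) \<le> (x / (t + e)) powr r" if "0 \<le> x" "x \<le> t + e" for x
    using powr_mono' [of r 1 "x / (t + e)"] that assms by (auto simp: field_simps)
  from this [of t] this [of e] have "t / (t + e) + e / (t + e) \<le> (t / (t + e)) powr r + (e / (t + e)) powr r"
    using assms by simp
  moreover have "t / (t + e) + e / (t + e) = 1" using assms by (simp flip: add_divide_distrib)
  ultimately show ?thesis using assms by (simp add: powr_divide field_simps)
qed

text \<open>The recursion r to (r + 1)/2 produces 1/2, 3/4, 7/8, ... from 0. Negative powers of b
  are needed on the way, so b is first replaced by the invertible b + e, and e tends to 0 at the
  end.\<close>

lemma loewner_heinz: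
  fixes a b :: "'a::cstar_algebra_1"
  assumes a: "cpos a" and b: "cpos b" and ab: "cpos (b - a)" and \<theta>: "\<theta> = 1 - (1/2) ^ Suc n"
  shows "cpos (upow b \<theta> - upow a \<theta>)"
proof -
  have \<theta>01: "0 < \<theta>" "\<theta> \<le> 1" using power_le_one [of "1/2::real" n] by (simp_all add: \<theta>)
  have main: "cpos (fc (\<lambda>t. (t + e) powr \<theta>) b - upow a \<theta>)" if e: "0 < e" for e
  proof -
    define B where "B r = fc (\<lambda>t. (t + e) powr r) b" for r
    have B_add: "B r * B s = B (r + s)" for r s
      unfolding B_def using b e
      by (subst fc_mult [symmetric]) (auto intro: continuous_on_powr_shift simp: powr_add)
    have "B 0 = fc (\<lambda>t. 1) b" unfolding B_def using e by (intro fc_cong) auto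
    then have B0: "B 0 = 1" using b by (simp add: fc_const)
    have "B 1 = peval [:e, 1:] b"
      unfolding B_def using e by (intro fc_poly [OF b]) auto
    then have B1: "B 1 = b + of_real e" by simp
    have sB: "star (B r) = B r" for r unfolding B_def by (rule star_fc [OF b continuous_on_powr_shift [OF e]])
    have le_imp: "norm (A * B (- r)) \<le> 1" if "star A = A" "cpos (B (2 * r) - A * A)" for A r
    proof (rule norm_le_one_if_cpos)
      have "cpos (star (B (- r)) * (B (2 * r) - A * A) * B (- r))" by (rule cpos_conj [OF that(2)])
      also have "star (B (- r)) * (B (2 * r) - A * A) * B (- r)
          = B (- r) * B (2 * r) * B (- r) - star (A * B (- r)) * (A * B (- r))"
        using that(1) by (simp add: sB algebra_simps star_mult)
      finally show "cpos (1 - star (A * B (- r)) * (A * B (- r)))" by (simp add: B_add B0)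
    qed
    \<comment> \<open>Here A stands for a^(r/2), so that r-th powers compare by hypothesis, first
      powers by ab, and the conclusion is their midpoint.\<close>
    have step: "cpos (B ((r + 1) / 2) - A * upow a (1/2))"
      if A: "star A = A" "A * a = a * A" "cpos (B r - A * A)" for r A
    proof -
      have ch: "upow a (1/2) * A = A * upow a (1/2)" using A(2) a by (simp add: upow_intertwine)
      \<comment> \<open>The contractions carry B^(-r/2) on one side and B^(-1/2) on the other.
        Conjugation by B^((1-r)/4) turns both into B^(-(r+1)/4), which makes the product
        self-adjoint.\<close>
      have "cpos (1 - B (- (r + 1) / 4) * (upow a (1/2) * A) * B (- (r + 1) / 4))"
      proof (rule cpos_midpoint [where ?B1.0 = "B (- (r / 2))" and ?B2.0 = "B (- (1 / 2))"
            and D = "B ((1 - r) / 4)" and D' = "B (- ((1 - r) / 4))"])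
        show "norm (A * B (- (r / 2))) \<le> 1" using A by (intro le_imp) auto
        have "upow a (1/2) * upow a (1/2) = a" using a by (simp add: upow_one flip: upow_add)
        moreover have "cpos (B 1 - a)" using cpos_add [OF ab cpos_of_real [of e]] e by (simp add: B1 algebra_simps)
        ultimately show "norm (upow a (1/2) * B (- (1 / 2))) \<le> 1" using a by (intro le_imp) (auto simp: star_upow)
        show "star (upow a (1/2) * A) = upow a (1/2) * A" using A(1) ch a by (simp add: star_mult star_upow)
        have "(1 - r) / 4 + - (1 / 2) = - (r + 1) / 4" "- (r / 2) + - ((1 - r) / 4) = - (r + 1) / 4"
          by (simp_all add: field_simps)
        then show "B ((1 - r) / 4) * B (- (1 / 2)) = B (- (r + 1) / 4)"
          "B (- (r / 2)) * B (- ((1 - r) / 4)) = B (- (r + 1) / 4)"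
          by (simp_all only: B_add)
      qed (use a A(1) in \<open>auto simp: sB star_upow B_add B0\<close>)
      from cpos_conj [OF this, of "B ((r + 1) / 4)"]
      have "cpos (B ((r + 1) / 4) * 1 * B ((r + 1) / 4)
          - B ((r + 1) / 4) * B (- (r + 1) / 4) * (upow a (1/2) * A) * (B (- (r + 1) / 4) * B ((r + 1) / 4)))"
        by (simp add: sB algebra_simps)
      then show ?thesis by (simp add: B_add ch add_divide_distrib) (simp add: field_simps B0)
    qed
    have "cpos (B (1 - (1/2) ^ Suc n) - upow a (1 - (1/2) ^ Suc n))"
    proof (induction n)
      case 0
      \<comment> \<open>This is r = 0 with A = 1 in the role of a^0.\<close>
      show ?case using step [of 1 0] by (simp add: B0)
    next
      case (Suc n)
      define r where "r = (1 - (1/2) ^ Suc n :: real)"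
      have r: "0 < r" using power_le_one [of "1/2::real" n] by (simp add: r_def)
      have "cpos (B ((r + 1) / 2) - upow a (r / 2) * upow a (1/2))"
      proof (rule step)
        show "star (upow a (r / 2)) = upow a (r / 2)" using a r by (simp add: star_upow)
        show "upow a (r / 2) * a = a * upow a (r / 2)" using a r upow_intertwine [of a a "r/2" a] by simp
        have "upow a (r / 2) * upow a (r / 2) = upow a r" using a r by (simp flip: upow_add)
        then show "cpos (B r - upow a (r / 2) * upow a (r / 2))" using Suc by (simp add: r_def)
      qed
      moreover have "upow a (r / 2) * upow a (1/2) = upow a ((r + 1) / 2)"
        using a r by (simp add: add_divide_distrib flip: upow_add)
      moreover have "(r + 1) / 2 = 1 - (1/2) ^ Suc (Suc n)" by (simp add: r_def field_simps)
      ultimately show ?case by simp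
    qed
    then show ?thesis by (simp add: B_def \<theta>)
  qed
  have shift: "cpos (upow b \<theta> - upow a \<theta> + of_real (e powr \<theta>))" if e: "0 < e" for e
  proof -
    have c: "continuous_on {0..} (\<lambda>t::real. t powr \<theta>)" "continuous_on {0..} (\<lambda>t::real. (t + e) powr \<theta>)"
      using \<theta>01 e by (auto intro: continuous_on_powr_pos continuous_on_powr_shift)
    have "cpos (fc (\<lambda>t. t powr \<theta> + e powr \<theta> - (t + e) powr \<theta>) b)"
      using powr_shift_le e \<theta>01 by (intro cpos_fc [OF b]) (auto intro!: continuous_intros c)
    also have "fc (\<lambda>t. t powr \<theta> + e powr \<theta> - (t + e) powr \<theta>) b
        = upow b \<theta> + of_real (e powr \<theta>) - fc (\<lambda>t. (t + e) powr \<theta>) b"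
      using b c by (simp add: fc_diff fc_add fc_const upow_def continuous_intros)
    finally have "cpos (upow b \<theta> + of_real (e powr \<theta>) - fc (\<lambda>t. (t + e) powr \<theta>) b)" .
    from cpos_add [OF this main [OF e]] show ?thesis by (simp add: algebra_simps)
  qed
  have "(\<lambda>n. inverse (real (Suc n)) powr \<theta>) \<longlonglongrightarrow> 0"
    by (rule tendsto_zero_powrI [OF LIMSEQ_inverse_real_of_nat tendsto_const _ \<theta>01(1)]) simp
  then have "(\<lambda>n. of_real (inverse (real (Suc n)) powr \<theta>)) \<longlonglongrightarrow> (of_real 0 :: 'a)"
    by (rule tendsto_of_real [where F = sequentially])
  then have "(\<lambda>n. upow b \<theta> - upow a \<theta> + of_real (inverse (real (Suc n)) powr \<theta>)) \<longlonglongrightarrow> upow b \<theta> - upow a \<theta> + of_real 0"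
    by (intro tendsto_add tendsto_const)
  then have lim: "(\<lambda>n. upow b \<theta> - upow a \<theta> + of_real (inverse (real (Suc n)) powr \<theta>)) \<longlonglongrightarrow> upow b \<theta> - upow a \<theta>"
    by (simp only: of_real_0 add_0_right)
  show ?thesis by (rule cpos_lim [OF lim shift]) simp
qed

section \<open>Quotients by powers, and the spectrum\<close>

text \<open>An approximation to y^(-\<alpha>) for y that need not be invertible; the shift keeps the
  function continuous at 0.\<close>

definition reg_inverse :: "real \<Rightarrow> 'a::cstar_algebra_1 \<Rightarrow> nat \<Rightarrow> 'a"
  where "reg_inverse \<alpha> y n = fc (\<lambda>t. (t + inverse (Suc n)) powr (- \<alpha>)) y"

text \<open>With x = t/(t + e) and \<beta> = \<gamma> - \<alpha>, the error is t^\<beta> (1 -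
  x^\<alpha>), and 1 - x^\<alpha> is at most 1 - x = e/(t + e), hence at most (e/(t + e))^\<beta>
  because \<beta> is at most 1. What remains is e^\<beta> x^\<beta>, a bound uniform in t.\<close>

lemma powr_quotient_bound:
  fixes t e :: real
  assumes t: "0 \<le> t" and e: "0 < e" and \<alpha>: "0 < \<alpha>" "\<alpha> \<le> 1" and \<gamma>: "\<alpha> < \<gamma>" "\<gamma> \<le> \<alpha> + 1"
  shows "\<bar>t powr \<gamma> * (t + e) powr (- \<alpha>) - t powr (\<gamma> - \<alpha>)\<bar> \<le> e powr (\<gamma> - \<alpha>)"
proof (cases "t = 0")
  case False
  define \<beta> where "\<beta> = \<gamma> - \<alpha>"
  define x where "x = t / (t + e)"
  have t: "0 < t" using False t by simp
  have \<beta>: "0 < \<beta>" "\<beta> \<le> 1" and x: "0 < x" "x \<le> 1" using \<gamma> t e by (auto simp: \<beta>_def x_def)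
  have "t powr \<gamma> * (t + e) powr (- \<alpha>) = t powr \<beta> * x powr \<alpha>"
    using t e by (simp add: \<beta>_def x_def powr_divide powr_diff powr_minus field_simps)
  then have eq: "t powr \<gamma> * (t + e) powr (- \<alpha>) - t powr \<beta> = - (t powr \<beta> * (1 - x powr \<alpha>))"
    by (simp add: algebra_simps)
  have x1: "x powr \<alpha> \<le> 1" using powr_mono2 [of \<alpha> x 1] x \<alpha> by simp
  have "x \<le> x powr \<alpha>" using powr_mono' [of \<alpha> 1 x] x \<alpha> by simp
  then have "1 - x powr \<alpha> \<le> 1 - x" by simp
  also have "\<dots> = e / (t + e)" using t e by (simp add: x_def field_simps)
  also have "\<dots> \<le> (e / (t + e)) powr \<beta>" using powr_mono' [of \<beta> 1 "e / (t + e)"] \<beta> t e by simp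
  finally have "t powr \<beta> * (1 - x powr \<alpha>) \<le> t powr \<beta> * (e / (t + e)) powr \<beta>" by (intro mult_left_mono) auto
  also have "\<dots> = e powr \<beta> * x powr \<beta>" using t e by (simp add: x_def powr_divide)
  also have "\<dots> \<le> e powr \<beta>" using powr_mono2 [of \<beta> x 1] x \<beta> by (simp add: mult_left_le)
  finally have "t powr \<beta> * (1 - x powr \<alpha>) \<le> e powr \<beta>" .
  moreover have "0 \<le> t powr \<beta> * (1 - x powr \<alpha>)" using x1 by simp
  ultimately show ?thesis using eq by (simp add: \<beta>_def)
qed simp

lemma reg_inverse_commute:
  "cpos y \<Longrightarrow> 0 < r \<Longrightarrow> reg_inverse \<alpha> y n * upow y r = upow y r * reg_inverse \<alpha> y n"
  unfolding reg_inverse_def upow_def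
  by (subst (1 2) fc_mult [symmetric])
    (auto intro!: continuous_on_powr_pos continuous_on_powr_shift simp: mult.commute)

lemma star_reg_inverse: "cpos y \<Longrightarrow> star (reg_inverse \<alpha> y n) = reg_inverse \<alpha> y n"
  unfolding reg_inverse_def by (rule star_fc) (auto intro!: continuous_on_powr_shift)

lemma upow_reg_inverse_tendsto:
  assumes y: "cpos y" and \<alpha>: "0 < \<alpha>" "\<alpha> \<le> 1" "\<alpha> < r"
  shows "(\<lambda>n. upow y r * reg_inverse \<alpha> y n) \<longlonglongrightarrow> upow y (r - \<alpha>)"
proof -
  have main: "(\<lambda>n. upow y \<gamma> * reg_inverse \<alpha> y n) \<longlonglongrightarrow> upow y (\<gamma> - \<alpha>)" if \<gamma>: "\<alpha> < \<gamma>" "\<gamma> \<le> \<alpha> + 1" for \<gamma>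
  proof (rule LIM_zero_cancel, rule Lim_null_comparison)
    have c: "continuous_on {0..} (\<lambda>t::real. t powr \<gamma>)" "continuous_on {0..} (\<lambda>t::real. t powr (\<gamma> - \<alpha>))"
      "continuous_on {0..} (\<lambda>t. (t + inverse (Suc n)) powr (- \<alpha>))" for n
      using \<alpha> \<gamma> by (auto intro!: continuous_on_powr_pos continuous_on_powr_shift)
    have "norm (upow y \<gamma> * reg_inverse \<alpha> y n - upow y (\<gamma> - \<alpha>)) \<le> inverse (Suc n) powr (\<gamma> - \<alpha>)" for n
    proof -
      let ?f = "\<lambda>t. t powr \<gamma> * (t + inverse (Suc n)) powr (- \<alpha>) - t powr (\<gamma> - \<alpha>)"
      have "upow y \<gamma> * reg_inverse \<alpha> y n - upow y (\<gamma> - \<alpha>) = fc ?f y"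
        unfolding upow_def reg_inverse_def
        by (subst fc_diff [OF y _ c(2)], intro continuous_intros c) (simp only: fc_mult [OF y c(1) c(3)])
      moreover have "norm (fc ?f y) \<le> inverse (Suc n) powr (\<gamma> - \<alpha>)"
      proof (rule fc_norm_le [OF y])
        show "continuous_on {0..} ?f" by (intro continuous_intros c)
        show "norm y \<le> norm y + 1" "0 < norm y + 1" by (auto intro: add_nonneg_pos)
        show "\<bar>?f t\<bar> \<le> inverse (Suc n) powr (\<gamma> - \<alpha>)" if "t \<in> {0..norm y + 1}" for t
          using that \<alpha> \<gamma> by (intro powr_quotient_bound) auto
      qed
      ultimately show ?thesis by (simp only:)
    qed
    then show "\<forall>\<^sub>F n in sequentially. norm (upow y \<gamma> * reg_inverse \<alpha> y n - upow y (\<gamma> - \<alpha>))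
        \<le> inverse (Suc n) powr (\<gamma> - \<alpha>)" by simp
    show "(\<lambda>n. inverse (real (Suc n)) powr (\<gamma> - \<alpha>)) \<longlonglongrightarrow> 0"
      using \<gamma> by (intro tendsto_zero_powrI [OF LIMSEQ_inverse_real_of_nat tendsto_const]) auto
  qed
  show ?thesis
  proof (cases "r \<le> \<alpha> + 1")
    case True
    then show ?thesis using main \<alpha> by simp
  next
    case False
    \<comment> \<open>The uniform bound reaches only up to \<alpha> + 1; the surplus y^s is
      multiplied on from the left.\<close>
    define s where "s = r - (\<alpha> + 1)"
    have s: "0 < s" "r = s + (\<alpha> + 1)" using False by (auto simp: s_def)
    have "(\<lambda>n. upow y s * (upow y (\<alpha> + 1) * reg_inverse \<alpha> y n)) \<longlonglongrightarrow> upow y s * upow y (\<alpha> + 1 - \<alpha>)"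
      by (intro tendsto_mult_left main) auto
    moreover have "upow y s * (upow y (\<alpha> + 1) * z) = upow y r * z" for z
      using s \<alpha> y by (simp add: upow_add mult.assoc)
    moreover have "upow y s * upow y (\<alpha> + 1 - \<alpha>) = upow y (s + 1)"
      using upow_add [OF y s(1), of 1] by simp
    moreover have "s + 1 = r - \<alpha>" using s by simp
    ultimately show ?thesis by simp
  qed
qed

text \<open>Conjugating the domination by k and applying the C*-identity compares x with
  y^(\<theta>/2) behind any right factor. Cauchy sequences y^(\<theta>/2) h_n thereby become Cauchy
  sequences x h_n.\<close>

lemma norm_mult_le_dominated:
  assumes y: "cpos y" and \<theta>: "0 < \<theta>" and C: "0 \<le> C" and d: "cpos (C *\<^sub>R upow y \<theta> - star x * x)"
  shows "norm (x * k) \<le> sqrt C * norm (upow y (\<theta> / 2) * k)"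
proof -
  let ?p = "upow y (\<theta> / 2)"
  have p: "?p * ?p = upow y \<theta>" "star ?p = ?p" using y \<theta> by (simp_all add: star_upow flip: upow_add)
  have "cpos (star k * (C *\<^sub>R upow y \<theta> - star x * x) * k)" by (rule cpos_conj [OF d])
  also have "star k * (C *\<^sub>R upow y \<theta> - star x * x) * k = C *\<^sub>R (star (?p * k) * (?p * k)) - star (x * k) * (x * k)"
    by (simp add: star_mult algebra_simps p flip: p(1))
  finally have "norm (star (x * k) * (x * k)) \<le> norm (C *\<^sub>R (star (?p * k) * (?p * k)))"
    by (rule norm_mono [OF cpos_star_mult_self])
  then have "(norm (x * k))\<^sup>2 \<le> C * (norm (?p * k))\<^sup>2" using C by (simp add: norm_star_mult_self)
  then have "sqrt ((norm (x * k))\<^sup>2) \<le> sqrt (C * (norm (?p * k))\<^sup>2)" by (rule real_sqrt_le_mono)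
  then show ?thesis by (simp add: real_sqrt_mult)
qed

text \<open>\<open>uquot \<alpha> y x\<close> plays the role of \<open>x y\<^sup>-\<^sup>\<alpha>\<close>. It makes sense if \<open>x\<^sup>* x \<le> C y\<^sup>\<theta>\<close> with \<open>2 \<alpha> < \<theta>\<close>.\<close>

definition uquot :: "real \<Rightarrow> 'a::cstar_algebra_1 \<Rightarrow> 'a \<Rightarrow> 'a"
  where "uquot \<alpha> y x = lim (\<lambda>n. x * reg_inverse \<alpha> y n)"

definition udominated :: "real \<Rightarrow> 'a::cstar_algebra_1 \<Rightarrow> 'a \<Rightarrow> bool"
  where "udominated \<alpha> y x \<longleftrightarrow> (\<exists>C \<theta>. 0 \<le> C \<and> 2 * \<alpha> < \<theta> \<and> cpos (C *\<^sub>R upow y \<theta> - star x * x))"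

lemma uquot_tendsto:
  assumes y: "cpos y" and \<alpha>: "0 < \<alpha>" "\<alpha> \<le> 1" and x: "udominated \<alpha> y x"
  shows "(\<lambda>n. x * reg_inverse \<alpha> y n) \<longlonglongrightarrow> uquot \<alpha> y x"
proof -
  obtain C \<theta> where C: "0 \<le> C" and \<theta>: "2 * \<alpha> < \<theta>" and d: "cpos (C *\<^sub>R upow y \<theta> - star x * x)"
    using x by (auto simp: udominated_def)
  let ?h = "reg_inverse \<alpha> y"
  let ?F = "\<lambda>n. upow y (\<theta> / 2) * ?h n"
  have "?F \<longlonglongrightarrow> upow y (\<theta> / 2 - \<alpha>)" using \<alpha> \<theta> by (intro upow_reg_inverse_tendsto y) auto
  then have F: "Cauchy ?F" by (rule LIMSEQ_imp_Cauchy)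
  have "Cauchy (\<lambda>n. x * ?h n)"
  proof (rule metric_CauchyI)
    fix e :: real assume e: "0 < e"
    have s: "0 < sqrt C + 1" using C by (simp add: add_nonneg_pos)
    then have "0 < e / (sqrt C + 1)" using e by simp
    then obtain N where N: "\<And>m n. m \<ge> N \<Longrightarrow> n \<ge> N \<Longrightarrow> dist (?F m) (?F n) < e / (sqrt C + 1)"
      using F unfolding Cauchy_def by meson
    have "dist (x * ?h m) (x * ?h n) < e" if "m \<ge> N" "n \<ge> N" for m n
    proof -
      have "dist (x * ?h m) (x * ?h n) = norm (x * (?h m - ?h n))" by (simp add: dist_norm right_diff_distrib)
      also have "\<dots> \<le> sqrt C * norm (upow y (\<theta> / 2) * (?h m - ?h n))"
        using \<alpha> \<theta> by (intro norm_mult_le_dominated y C d) auto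
      also have "\<dots> \<le> (sqrt C + 1) * dist (?F m) (?F n)"
        by (simp add: dist_norm right_diff_distrib mult_right_mono)
      also have "\<dots> < (sqrt C + 1) * (e / (sqrt C + 1))"
        using N [OF that] s by (intro mult_strict_left_mono)
      also have "\<dots> = e" using s by simp
      finally show ?thesis .
    qed
    then show "\<exists>M. \<forall>m\<ge>M. \<forall>n\<ge>M. dist (x * ?h m) (x * ?h n) < e" by blast
  qed
  then show ?thesis unfolding uquot_def by (simp add: Cauchy_convergent_iff convergent_LIMSEQ_iff)
qed

lemma uquot_mult_upow:
  assumes y: "cpos y" and \<alpha>: "0 < \<alpha>" "\<alpha> \<le> 1" and x: "udominated \<alpha> y x"
  shows "uquot \<alpha> y x * upow y \<alpha> = x"
proof -
  obtain C \<theta> where C: "0 \<le> C" and \<theta>: "2 * \<alpha> < \<theta>" and d: "cpos (C *\<^sub>R upow y \<theta> - star x * x)"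
    using x by (auto simp: udominated_def)
  let ?h = "reg_inverse \<alpha> y" and ?p = "upow y (\<theta> / 2)"
  have "(\<lambda>n. ?p * ?h n * upow y \<alpha> - ?p) \<longlonglongrightarrow> upow y (\<theta> / 2 - \<alpha>) * upow y \<alpha> - ?p"
    using \<alpha> \<theta> by (intro tendsto_diff tendsto_mult_right upow_reg_inverse_tendsto y tendsto_const) auto
  also have "upow y (\<theta> / 2 - \<alpha>) * upow y \<alpha> - ?p = 0"
    using \<alpha> \<theta> y by (simp flip: upow_add)
  finally have lim0: "(\<lambda>n. sqrt C * norm (?p * ?h n * upow y \<alpha> - ?p)) \<longlonglongrightarrow> 0"
    by (intro tendsto_mult_right_zero tendsto_norm_zero)
  have "norm (x * ?h n * upow y \<alpha> - x) \<le> sqrt C * norm (?p * ?h n * upow y \<alpha> - ?p)" for n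
    using norm_mult_le_dominated [OF y _ C d, of "?h n * upow y \<alpha> - 1"] \<alpha> \<theta>
    by (simp add: right_diff_distrib mult.assoc)
  then have "\<forall>\<^sub>F n in sequentially. norm (x * ?h n * upow y \<alpha> - x) \<le> sqrt C * norm (?p * ?h n * upow y \<alpha> - ?p)"
    by (intro always_eventually allI)
  then have "(\<lambda>n. x * ?h n * upow y \<alpha> - x) \<longlonglongrightarrow> 0"
    using lim0 by (rule Lim_null_comparison)
  then have "(\<lambda>n. x * ?h n * upow y \<alpha>) \<longlonglongrightarrow> x" by (rule LIM_zero_cancel)
  moreover have "(\<lambda>n. x * ?h n * upow y \<alpha>) \<longlonglongrightarrow> uquot \<alpha> y x * upow y \<alpha>"
    by (intro tendsto_mult_right uquot_tendsto y \<alpha> x)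
  ultimately show ?thesis using LIMSEQ_unique by blast
qed

lemma star_uquot_mult_self_le:
  assumes y: "cpos y" and \<alpha>: "0 < \<alpha>" "\<alpha> \<le> 1" and C: "0 \<le> C" and \<theta>: "2 * \<alpha> < \<theta>"
    and d: "cpos (C *\<^sub>R upow y \<theta> - star x * x)"
  shows "cpos (C *\<^sub>R upow y (\<theta> - 2 * \<alpha>) - star (uquot \<alpha> y x) * uquot \<alpha> y x)"
proof -
  let ?h = "reg_inverse \<alpha> y" and ?p = "upow y (\<theta> / 2)"
  have x: "udominated \<alpha> y x" using C \<theta> d by (auto simp: udominated_def)
  have sq: "upow y (r / 2) * upow y (r / 2) = upow y r" if "0 < r" for r using y that by (simp flip: upow_add)
  have F: "(\<lambda>n. ?p * ?h n) \<longlonglongrightarrow> upow y (\<theta> / 2 - \<alpha>)"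
    using \<alpha> \<theta> by (intro upow_reg_inverse_tendsto y) auto
  have X: "(\<lambda>n. x * ?h n) \<longlonglongrightarrow> uquot \<alpha> y x" by (intro uquot_tendsto y \<alpha> x)
  have "(\<lambda>n. C *\<^sub>R ((?p * ?h n) * (?p * ?h n)) - star (x * ?h n) * (x * ?h n))
      \<longlonglongrightarrow> C *\<^sub>R (upow y (\<theta> / 2 - \<alpha>) * upow y (\<theta> / 2 - \<alpha>)) - star (uquot \<alpha> y x) * uquot \<alpha> y x"
    by (intro tendsto_intros F X tendsto_star)
  moreover have "cpos (C *\<^sub>R ((?p * ?h n) * (?p * ?h n)) - star (x * ?h n) * (x * ?h n))" for n
  proof -
    have "cpos (star (?h n) * (C *\<^sub>R upow y \<theta> - star x * x) * ?h n)" by (rule cpos_conj [OF d])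
    moreover have "?p * ?h n = ?h n * ?p" using y \<alpha> \<theta> by (simp add: reg_inverse_commute)
    then have "(?p * ?h n) * (?p * ?h n) = ?h n * upow y \<theta> * ?h n"
    proof -
      assume ph: "?p * ?h n = ?h n * ?p"
      have "(?p * ?h n) * (?p * ?h n) = ?h n * ?p * (?p * ?h n)" by (subst (1) ph) (rule refl)
      also have "\<dots> = ?h n * (?p * ?p) * ?h n" by (simp only: mult.assoc)
      also have "?p * ?p = upow y \<theta>" using \<alpha> \<theta> by (intro sq) simp
      finally show ?thesis .
    qed
    ultimately show ?thesis
      by (simp add: star_mult star_reg_inverse y algebra_simps)
  qed
  ultimately have "cpos (C *\<^sub>R (upow y (\<theta> / 2 - \<alpha>) * upow y (\<theta> / 2 - \<alpha>)) - star (uquot \<alpha> y x) * uquot \<alpha> y x)"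
    by (rule cpos_lim)
  moreover have "\<theta> / 2 - \<alpha> = (\<theta> - 2 * \<alpha>) / 2" by simp
  ultimately show ?thesis using sq [of "\<theta> - 2 * \<alpha>"] \<theta> by simp
qed

text \<open>The identity is multiplied on the right by the approximations to y^(-\<alpha>), and each
  summand converges separately.\<close>

lemma sum_list_mult_uquot:
  assumes y: "cpos y" and \<alpha>: "0 < \<alpha>" "\<alpha> \<le> 1" "\<alpha> < r"
    and d: "\<And>p. p \<in> set ps \<Longrightarrow> udominated \<alpha> y (w p)"
    and s: "(\<Sum>p\<leftarrow>ps. z p * w p) = upow y r"
  shows "(\<Sum>p\<leftarrow>ps. z p * uquot \<alpha> y (w p)) = upow y (r - \<alpha>)"
proof -
  let ?h = "reg_inverse \<alpha> y"
  have "(\<lambda>n. \<Sum>p\<leftarrow>ps. z p * (w p * ?h n)) \<longlonglongrightarrow> (\<Sum>p\<leftarrow>ps. z p * uquot \<alpha> y (w p))"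
    using d by (induction ps) (auto intro!: tendsto_add tendsto_mult_left uquot_tendsto y \<alpha>)
  moreover have "(\<Sum>p\<leftarrow>ps. z p * (w p * ?h n)) = upow y r * ?h n" for n
    unfolding s [symmetric] by (induction ps) (simp_all add: distrib_right mult.assoc)
  moreover have "(\<lambda>n. upow y r * ?h n) \<longlonglongrightarrow> upow y (r - \<alpha>)"
    using \<alpha> by (intro upow_reg_inverse_tendsto y)
  ultimately show ?thesis using LIMSEQ_unique by fastforce
qed

section \<open>The embedding into the unitization and the spectrum\<close>

definition embed :: "'a::cstar_algebra \<Rightarrow> 'a unitization"
  where "embed a = Unitization a 0"

lemma embed_simps:
  "embed (a + b) = embed a + embed b" "embed (a - b) = embed a - embed b" "embed (- a) = - embed a"
  "embed 0 = 0" "embed (a * b) = embed a * embed b" "embed (star a) = star (embed a)"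
  "embed (r *\<^sub>R a) = r *\<^sub>R embed a" "embed (c *\<^sub>C a) = c *\<^sub>C embed a"
  by (simp_all add: embed_def unitization_ops star_unitization_def scaleC_unitization_def)

lemma embed_sum_list: "embed (\<Sum>x\<leftarrow>xs. f x) = (\<Sum>x\<leftarrow>xs. embed (f x))"
  by (induction xs) (simp_all add: embed_simps)

lemma embed_eq_iff: "embed a = embed b \<longleftrightarrow> a = b"
  by (simp add: embed_def)

lemma uscalar_embed [simp]: "uscalar (embed a) = 0"
  by (simp add: embed_def)

lemma embed_ubase: "uscalar u = 0 \<Longrightarrow> embed (ubase u) = u"
  by (simp add: embed_def unitization_eqI)

lemma uscalar_mult [simp]: "uscalar (u * v) = uscalar u * uscalar v"
  and uscalar_add [simp]: "uscalar (u + v) = uscalar u + uscalar v"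
  and uscalar_diff [simp]: "uscalar (u - v) = uscalar u - uscalar v"
  by (simp_all add: unitization_ops)

lemma of_real_unitization: "of_real r = Unitization 0 (of_real r)"
  by (simp add: of_real_def unitization_ops)

text \<open>Functions vanishing at 0 keep elements of A inside A. This is why positive powers, but
  not the approximate inverses, make sense without a unit.\<close>

lemma uscalar_fc:
  fixes a :: "'a::cstar_algebra unitization"
  assumes a: "cpos a" "uscalar a = 0" and f: "continuous_on {0..} f"
  shows "uscalar (fc f a) = of_real (f 0)"
proof -
  let ?M = "norm a + 1"
  have M: "norm a \<le> ?M" "0 < ?M" by (auto intro: add_nonneg_pos)
  obtain p where p: "uniform_limit {0..?M} (\<lambda>n. poly (p n)) f sequentially" by (rule poly_uniform_limit [OF f])
  have "uscalar (peval q a) = of_real (poly q 0)" for q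
    by (cases q) (simp add: a(2) of_real_unitization)
  then have "(\<lambda>n. complex_of_real (poly (p n) 0)) \<longlonglongrightarrow> uscalar (fc f a)"
    using bounded_linear.tendsto [OF bounded_linear_uscalar fc_tendsto [OF a(1) f M p]] by simp
  moreover have "(\<lambda>n. complex_of_real (poly (p n) 0)) \<longlonglongrightarrow> of_real (f 0)"
    using M by (intro tendsto_of_real tendsto_uniform_limitI [OF p]) auto
  ultimately show ?thesis by (rule LIMSEQ_unique)
qed

lemma norm_one_minus_mult_power_le:
  fixes b :: "'a::cstar_algebra_1"
  assumes b: "cpos b" and n: "norm b \<le> 1"
  shows "norm ((1 - b) * b ^ k) \<le> 1 / (Suc k)"
proof -
  have pow: "peval ([:0, 1:] ^ k) b = b ^ k" by (induction k) (simp_all add: one_pCons)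
  have "norm (peval ([:1, -1:] * [:0, 1:] ^ k) b) \<le> 1 / (Suc k)"
  proof (rule norm_peval_le [OF b n])
    fix t :: real assume t: "t \<in> {0..1}"
    have "(\<Sum>i<Suc k. t ^ k) \<le> (\<Sum>i<Suc k. t ^ i)"
      using t by (intro sum_mono power_decreasing) auto
    then have "real (Suc k) * t ^ k * (1 - t) \<le> (\<Sum>i<Suc k. t ^ i) * (1 - t)"
      using t by (intro mult_right_mono) auto
    also have "\<dots> = 1 - t ^ Suc k"
      using one_diff_power_eq [of t "Suc k"] by (simp add: mult.commute)
    also have "\<dots> \<le> 1" using t by simp
    finally have "(1 - t) * t ^ k \<le> 1 / Suc k" by (simp add: field_simps)
    moreover have "0 \<le> (1 - t) * t ^ k" using t by simp
    moreover have "poly ([:1, -1:] * [:0, 1:] ^ k) t = (1 - t) * t ^ k" unfolding poly_mult poly_power by simp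
    ultimately show "\<bar>poly ([:1, -1:] * [:0, 1:] ^ k) t\<bar> \<le> 1 / Suc k" by (simp only: abs_of_nonneg)
  qed simp
  then show ?thesis by (simp only: peval_mult pow) simp
qed

text \<open>If \<open>h\<close> is not positive and \<open>m\<close> is the norm of its negative part, then \<open>h + m\<close> almost annihilates
  high powers of the normalized negative part, hence is not invertible.\<close>

lemma cpos_if_invertible_shifts:
  fixes h :: "'a::cstar_algebra_1"
  assumes h: "star h = h" and inv: "\<And>m. 0 < m \<Longrightarrow> \<exists>v. v * (h + of_real m) = 1"
  shows "cpos h"
proof -
  obtain p n where pn: "cpos p" "cpos n" "h = p - n" "p * n = 0" "n * p = 0"
    using positive_negative_parts [OF h] by blast
  have "n = 0"
  proof (rule ccontr)
    assume "n \<noteq> 0"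
    define m where "m = norm n"
    have m: "0 < m" using \<open>n \<noteq> 0\<close> by (simp add: m_def)
    define b where "b = (1 / m) *\<^sub>R n"
    have b: "cpos b" "norm b = 1" using pn(2) m by (auto simp: b_def m_def intro: cpos_scaleR)
    obtain v where v: "v * (h + of_real m) = 1" using inv [OF m] by blast
    have "(h + of_real m) * b = m *\<^sub>R ((1 - b) * b)"
      using m pn(4) by (simp add: b_def pn(3) algebra_simps of_real_def power2_eq_square)
    then have *: "(h + of_real m) * (b * b ^ k) = m *\<^sub>R ((1 - b) * b ^ Suc k)" for k
      by (simp add: mult.assoc flip: mult.assoc [of "h + of_real m"])
    have "1 \<le> norm v * m / (2 ^ k)" for k
    proof -
      \<comment> \<open>Exponents 2^k are taken because \<open>norm_power_two_power\<close> gives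
        these powers of b norm exactly 1.\<close>
      obtain j where j: "2 ^ k = Suc j" by (metis not0_implies_Suc power_not_zero zero_neq_numeral)
      have "1 = norm (b ^ (2 ^ k))" using norm_power_two_power [OF cpos_sa [OF b(1)], of k] b(2) by simp
      also have "b ^ (2 ^ k) = v * ((h + of_real m) * (b * b ^ j))"
        by (simp add: j v flip: mult.assoc)
      also have "\<dots> = v * (m *\<^sub>R ((1 - b) * b ^ Suc j))" by (simp only: *)
      also have "norm \<dots> \<le> norm v * (m * norm ((1 - b) * b ^ Suc j))"
        using m norm_mult_ineq [of v "m *\<^sub>R ((1 - b) * b ^ Suc j)"] by simp
      also have "\<dots> \<le> norm v * (m * (1 / Suc (Suc j)))"
        using m b by (intro mult_left_mono norm_one_minus_mult_power_le) auto
      also have "\<dots> \<le> norm v * m / Suc j"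
        using m by (simp add: frac_le mult_left_mono)
      also have "real (Suc j) = 2 ^ k" using j by (metis of_nat_numeral of_nat_power)
      finally show ?thesis .
    qed
    then have "2 ^ k \<le> norm v * m" for k :: nat by (simp add: field_simps)
    then show False using real_arch_pow [of 2 "norm v * m"] by (metis linorder_not_less one_less_numeral_iff semiring_norm(76))
  qed
  then show ?thesis using pn by simp
qed

lemma cpos_shift_invertible:
  fixes d :: "'a::cstar_algebra_1"
  assumes d: "cpos d" and e: "0 < e"
  obtains v where "v * (d + of_real e) = 1" "(d + of_real e) * v = 1"
    "\<And>x. x * d = d * x \<Longrightarrow> x * v = v * x"
proof -
  have c: "continuous_on {0..} (\<lambda>t::real. t + e)" "continuous_on {0..} (\<lambda>t::real. 1 / (t + e))"
    using e by (auto intro!: continuous_intros)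
  have eq: "fc (\<lambda>t. t + e) d = d + of_real e"
    using d by (subst fc_poly [of _ _ "[:e, 1:]"]) auto
  have one: "fc f d = 1" if "\<And>t. 0 \<le> t \<Longrightarrow> f t = 1" for f :: "real \<Rightarrow> real"
    using d that by (subst fc_poly [of _ _ "[:1:]"]) auto
  have "fc (\<lambda>t. 1 / (t + e) * (t + e)) d = 1" "fc (\<lambda>t. (t + e) * (1 / (t + e))) d = 1"
    using e by (auto intro!: one)
  then have 1: "fc (\<lambda>t. 1 / (t + e)) d * (d + of_real e) = 1" "(d + of_real e) * fc (\<lambda>t. 1 / (t + e)) d = 1"
    by (simp_all only: fc_mult [OF d c(2) c(1)] fc_mult [OF d c(1) c(2)] eq)
  show ?thesis by (rule that [OF 1 fc_commute [OF d c(2)]])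
qed

lemma notin_spectrum_iff:
  "l \<notin> spectrum a \<longleftrightarrow> (\<exists>v. Unitization a (- l) * v = 1 \<and> v * Unitization a (- l) = 1)"
proof -
  have eq: "unitization_mult (ubase u, uscalar u) (ubase v, uscalar v) = (ubase (u * v), uscalar (u * v))" for u v :: "'a unitization"
    by (simp add: unitization_mult_def unitization_ops)
  have one: "w = 1 \<longleftrightarrow> (ubase w, uscalar w) = (0, 1)" for w :: "'a unitization"
    by (auto simp: unitization_ops unitization_eqI)
  have ex: "(\<exists>v. P v) \<longleftrightarrow> (\<exists>u. P (ubase u, uscalar u))" for P :: "'a \<times> complex \<Rightarrow> bool"
    by (metis surj_pair unitization.sel)
  show ?thesis
    unfolding spectrum_def one mem_Collect_eq not_not
    by (subst ex) (simp only: eq [symmetric] unitization.sel)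
qed

text \<open>The bridge from the spectral definition. Forwards, only the absence of negative reals
  from the spectrum is used. Backwards, a nonreal l is excluded because (a - l)(a - cnj l) = (a - Re
  l)^2 + (Im l)^2 is a positive element shifted by a positive number, hence invertible.\<close>

lemma positives_iff: "a \<in> positives \<longleftrightarrow> cpos (embed a)"
proof
  assume a: "a \<in> positives"
  show "cpos (embed a)"
  proof (rule cpos_if_invertible_shifts)
    show "star (embed a) = embed a" using a by (simp add: positives_def flip: embed_simps)
    fix m :: real assume "0 < m"
    then have "complex_of_real (- m) \<notin> spectrum a" using a by (auto simp: positives_def)
    then obtain v where "v * Unitization a (of_real m) = 1" by (auto simp: notin_spectrum_iff)
    moreover have "embed a + of_real m = Unitization a (of_real m)"
      by (simp add: of_real_unitization embed_def unitization_ops)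
    ultimately show "\<exists>v. v * (embed a + of_real m) = 1" by metis
  qed
next
  assume pos: "cpos (embed a)"
  have "star a = a" using cpos_sa [OF pos] by (simp add: embed_eq_iff flip: embed_simps)
  moreover have "l \<notin> spectrum a" if l: "l \<notin> \<real>\<^sub>\<ge>\<^sub>0" for l
    proof (cases "Im l = 0")
      case True
      then have lr: "l = of_real (Re l)" by (simp add: complex_eq_iff)
      then have "0 < - Re l" using l by (metis nonneg_Reals_of_real_iff not_le neg_0_less_iff_less)
      then obtain v where "v * (embed a + of_real (- Re l)) = 1" "(embed a + of_real (- Re l)) * v = 1"
        using cpos_shift_invertible [OF pos] by metis
      moreover have "complex_of_real (- Re l) = - l" by (simp add: True complex_eq_iff)
      then have "embed a + of_real (- Re l) = Unitization a (- l)"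
        by (simp only: of_real_unitization embed_def unitization_ops unitization.sel add_0_right add_0)
      ultimately show ?thesis by (auto simp: notin_spectrum_iff)
    next
      case False
      define k where "k = embed a - of_real (Re l)"
      have sk: "star k = k" using cpos_sa [OF pos] by (simp add: k_def star_diff)
      have "0 < (Im l)\<^sup>2" using False by simp
      then obtain v where v: "v * (k * k + of_real ((Im l)\<^sup>2)) = 1" "(k * k + of_real ((Im l)\<^sup>2)) * v = 1"
        "\<And>x. x * (k * k) = k * k * x \<Longrightarrow> x * v = v * x"
        using cpos_shift_invertible [OF cpos_square [OF sk]] by metis
      define h h' where "h = Unitization a (- l)" and "h' = Unitization a (- cnj l)"
      have hk: "h = k - (\<i> * Im l) *\<^sub>C 1" "h' = k + (\<i> * Im l) *\<^sub>C 1"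
        by (simp_all add: h_def h'_def k_def embed_def of_real_unitization unitization_ops
            scaleC_unitization_def complex_eq_iff)
      have "h * h' = k * k + of_real ((Im l)\<^sup>2)" "h' * h = k * k + of_real ((Im l)\<^sup>2)"
        unfolding hk by (simp_all add: algebra_simps mult_scaleC_left mult_scaleC_right scaleC_scaleC
            power2_eq_square scaleC_of_real [symmetric] of_real_def)
      moreover have "h' * v = v * h'"
        by (rule v(3)) (simp add: hk algebra_simps mult_scaleC_left mult_scaleC_right)
      ultimately have "h * (h' * v) = 1" "(h' * v) * h = 1"
        using v by (metis mult.assoc)+
      then show ?thesis unfolding h_def by (auto simp: notin_spectrum_iff)
    qed
  ultimately show "a \<in> positives" by (auto simp: positives_def)
qed

section \<open>Powers of positive elements in nonunital algebras\<close>

lemma positives_star: "a \<in> positives \<Longrightarrow> star a = a"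
  by (simp add: positives_def)

lemma positives_zero [simp]: "0 \<in> positives"
  by (simp add: positives_iff embed_simps)

lemma positives_add: "a \<in> positives \<Longrightarrow> b \<in> positives \<Longrightarrow> a + b \<in> positives"
  by (simp add: positives_iff embed_simps cpos_add)

lemma positives_scaleR: "a \<in> positives \<Longrightarrow> 0 \<le> r \<Longrightarrow> r *\<^sub>R a \<in> positives"
  by (simp add: positives_iff embed_simps cpos_scaleR)

lemma positives_star_mult_self: "star x * x \<in> positives"
  by (simp add: positives_iff embed_simps cpos_star_mult_self)

lemma positives_mult_star_self: "x * star x \<in> positives"
  using positives_star_mult_self [of "star x"] by (simp add: star_star)

lemma positives_conj: "a \<in> positives \<Longrightarrow> star x * a * x \<in> positives"
  by (simp add: positives_iff embed_simps cpos_conj)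

lemma positives_sum_list: "(\<And>x. x \<in> set xs \<Longrightarrow> f x \<in> positives) \<Longrightarrow> (\<Sum>x\<leftarrow>xs. f x) \<in> positives"
  by (induction xs) (auto intro: positives_add)

lemma cstar_le_refl [simp]: "cstar_le a a"
  by (simp add: cstar_le_def)

lemma cstar_le_trans: "cstar_le a b \<Longrightarrow> cstar_le b c \<Longrightarrow> cstar_le a c"
  unfolding cstar_le_def using positives_add [of "c - b" "b - a"] by simp

lemma cstar_le_add: "cstar_le a b \<Longrightarrow> cstar_le c d \<Longrightarrow> cstar_le (a + c) (b + d)"
  unfolding cstar_le_def using positives_add [of "b - a" "d - c"] by (simp add: algebra_simps)

lemma cstar_le_scaleR: "cstar_le a b \<Longrightarrow> 0 \<le> r \<Longrightarrow> cstar_le (r *\<^sub>R a) (r *\<^sub>R b)"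
  unfolding cstar_le_def by (simp add: positives_scaleR flip: scaleR_diff_right)

lemma cstar_le_conj: "cstar_le a b \<Longrightarrow> cstar_le (star x * a * x) (star x * b * x)"
  unfolding cstar_le_def using positives_conj [of "b - a" x] by (simp add: algebra_simps)

lemma cstar_le_conj': "cstar_le a b \<Longrightarrow> cstar_le (x * a * star x) (x * b * star x)"
  using cstar_le_conj [of a b "star x"] by (simp add: star_star)

lemma cstar_le_sum_list_member:
  assumes "\<And>x. x \<in> set xs \<Longrightarrow> f x \<in> positives" "w \<in> set xs"
  shows "cstar_le (f w) (\<Sum>x\<leftarrow>xs. f x)"
  using assms
proof (induction xs)
  case (Cons v xs)
  have rest: "(\<Sum>x\<leftarrow>xs. f x) \<in> positives" "f v \<in> positives" using Cons.prems by (auto intro: positives_sum_list)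
  show ?case
  proof (cases "w = v")
    case False
    then have "cstar_le (f w) (\<Sum>x\<leftarrow>xs. f x)" using Cons by auto
    moreover have "cstar_le (\<Sum>x\<leftarrow>xs. f x) (\<Sum>x\<leftarrow>v # xs. f x)" using rest by (simp add: cstar_le_def)
    ultimately show ?thesis by (rule cstar_le_trans)
  qed (use rest in \<open>simp add: cstar_le_def\<close>)
qed simp

lemma conj_le_norm:
  assumes "c \<in> positives"
  shows "cstar_le (star z * c * z) (norm c *\<^sub>R (star z * z))"
proof -
  have "cpos (of_real (norm c) - embed c)"
    using assms by (intro cpos_diff_of_real) (auto simp: positives_iff cpos_sa, simp add: embed_def)
  from cpos_conj [OF this, of "embed z"] show ?thesis
    by (simp add: cstar_le_def positives_iff embed_simps algebra_simps of_real_def)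
qed

lemma star_mult_self_mult_le: "cstar_le (star (a * w) * (a * w)) ((norm a)\<^sup>2 *\<^sub>R (star w * w))"
  using conj_le_norm [OF positives_star_mult_self, of w a] by (simp add: star_mult mult.assoc norm_star_mult_self)

text \<open>Reduces products to squares \<open>star w * w\<close>. The coefficients are complex, so
  inside an ideal it can be used only once closure under complex scalars is known.\<close>

lemma star_mult_polarization:
  "4 *\<^sub>R (star y * z) = star (y + z) * (y + z) - star (z - y) * (z - y)
    + (\<i> *\<^sub>C (star (\<i> *\<^sub>C y + z) * (\<i> *\<^sub>C y + z)) - \<i> *\<^sub>C (star (z - \<i> *\<^sub>C y) * (z - \<i> *\<^sub>C y)))"
proof -
  have "4 *\<^sub>R (star y * z) = star y * z + star y * z + (star y * z + star y * z)"
    by (simp flip: scaleR_2)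
  then show ?thesis
    by (simp add: algebra_simps star_add star_diff star_scaleC mult_scaleC_left mult_scaleC_right
        scaleC_scaleC scaleC_add_right scaleC_diff_right)
qed

definition ppow :: "'a::cstar_algebra \<Rightarrow> real \<Rightarrow> 'a"
  where "ppow a r = ubase (upow (embed a) r)"

lemma embed_ppow: "a \<in> positives \<Longrightarrow> 0 < r \<Longrightarrow> embed (ppow a r) = upow (embed a) r"
  unfolding ppow_def upow_def
  by (intro embed_ubase) (simp add: uscalar_fc positives_iff continuous_on_powr_pos)

lemma ppow_positives: "a \<in> positives \<Longrightarrow> 0 < r \<Longrightarrow> ppow a r \<in> positives"
  by (simp add: positives_iff [of "ppow _ _"] embed_ppow) (simp add: positives_iff cpos_upow)

lemma star_ppow: "a \<in> positives \<Longrightarrow> 0 < r \<Longrightarrow> star (ppow a r) = ppow a r"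
  by (simp add: positives_star ppow_positives)

lemma ppow_eqI: "a \<in> positives \<Longrightarrow> 0 < r \<Longrightarrow> embed x = upow (embed a) r \<Longrightarrow> x = ppow a r"
  by (metis embed_eq_iff embed_ppow)

lemma ppow_add: "a \<in> positives \<Longrightarrow> 0 < r \<Longrightarrow> 0 < s \<Longrightarrow> ppow a (r + s) = ppow a r * ppow a s"
  by (rule sym, rule ppow_eqI) (auto simp: embed_simps embed_ppow, simp add: upow_add positives_iff)

lemma ppow_one [simp]: "a \<in> positives \<Longrightarrow> ppow a 1 = a"
  by (rule sym, rule ppow_eqI) (auto simp: positives_iff upow_one)

lemma ppow_ppow: "a \<in> positives \<Longrightarrow> 0 < r \<Longrightarrow> 0 < s \<Longrightarrow> ppow (ppow a r) s = ppow a (r * s)"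
  by (rule ppow_eqI) (auto simp: embed_ppow ppow_positives, simp add: upow_upow positives_iff)

lemma ppow_scaleR: "a \<in> positives \<Longrightarrow> 0 < r \<Longrightarrow> 0 \<le> c \<Longrightarrow> ppow (c *\<^sub>R a) r = (c powr r) *\<^sub>R ppow a r"
  by (rule sym, rule ppow_eqI)
    (auto simp: embed_simps embed_ppow positives_scaleR, simp add: upow_scaleR positives_iff)

lemma ppow_zero [simp]: "0 < r \<Longrightarrow> ppow 0 r = 0"
  using ppow_scaleR [of 0 r 0] by simp

lemma ppow_intertwine:
  assumes "a \<in> positives" "b \<in> positives" "0 < r" "x * a = b * x"
  shows "x * ppow a r = ppow b r * x"
proof -
  have "embed x * upow (embed a) r = upow (embed b) r * embed x"
    using assms by (intro upow_intertwine) (auto simp: positives_iff simp flip: embed_simps)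
  then show ?thesis using assms by (simp add: embed_eq_iff flip: embed_ppow embed_simps)
qed

lemma ppow_two: "a \<in> positives \<Longrightarrow> ppow a 2 = a * a"
  using ppow_add [of a 1 1] by simp

lemma ppow_half_mult: "a \<in> positives \<Longrightarrow> 0 < r \<Longrightarrow> ppow a (r / 2) * ppow a (r / 2) = ppow a r"
  by (simp flip: ppow_add)

lemma ppow_mono:
  assumes "a \<in> positives" "b \<in> positives" "cstar_le a b" "\<theta> = 1 - (1/2) ^ Suc n"
  shows "cstar_le (ppow a \<theta>) (ppow b \<theta>)"
proof -
  have "0 < \<theta>" using power_le_one [of "1/2::real" n] by (simp add: assms(4))
  moreover have "cpos (upow (embed b) \<theta> - upow (embed a) \<theta>)"
    using assms by (intro loewner_heinz) (auto simp: positives_iff cstar_le_def embed_simps)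
  ultimately show ?thesis using assms by (simp add: cstar_le_def positives_iff [of "_ - _"] embed_simps embed_ppow)
qed

lemma list_product_replicate: "b \<in> positives \<Longrightarrow> list_product (replicate (Suc n) b) = ppow b (Suc n)"
proof (induction n)
  case (Suc n)
  then show ?case using ppow_add [of b 1 "real (Suc n)"] by simp
qed simp

lemma positive_root_eq:
  assumes a: "a \<in> positives" and n: "1 \<le> n"
  shows "positive_root n a = ppow a (1 / n)"
  unfolding positive_root_def
proof (rule the_equality)
  obtain k where k: "n = Suc k" using n by (cases n) auto
  have n0: "0 < real n" using n by simp
  show "ppow a (1 / n) \<in> positives \<and> list_product (replicate n (ppow a (1 / n))) = a"
    using a n0 by (simp add: ppow_positives ppow_ppow k list_product_replicate del: replicate.simps of_nat_Suc)
  show "b = ppow a (1 / n)" if "b \<in> positives \<and> list_product (replicate n b) = a" for b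
  proof -
    have "a = ppow b n" using that list_product_replicate [of b k] unfolding k by metis
    then show ?thesis using that n0 by (simp add: ppow_ppow)
  qed
qed

section \<open>Quotients, polar decomposition and Riesz decomposition in A\<close>

definition dominated :: "real \<Rightarrow> 'a::cstar_algebra \<Rightarrow> 'a \<Rightarrow> bool"
  where "dominated \<alpha> y x \<longleftrightarrow> (\<exists>C \<theta>. 0 \<le> C \<and> 2 * \<alpha> < \<theta> \<and> cstar_le (star x * x) (C *\<^sub>R ppow y \<theta>))"

definition pquot :: "real \<Rightarrow> 'a::cstar_algebra \<Rightarrow> 'a \<Rightarrow> 'a"
  where "pquot \<alpha> y x = ubase (uquot \<alpha> (embed y) (embed x))"

lemma dominatedI: "0 \<le> C \<Longrightarrow> 2 * \<alpha> < \<theta> \<Longrightarrow> cstar_le (star x * x) (C *\<^sub>R ppow y \<theta>) \<Longrightarrow> dominated \<alpha> y x"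
  by (auto simp: dominated_def)

lemma udominated_embed: "y \<in> positives \<Longrightarrow> 0 < \<alpha> \<Longrightarrow> dominated \<alpha> y x \<Longrightarrow> udominated \<alpha> (embed y) (embed x)"
proof -
  assume y: "y \<in> positives" and \<alpha>: "0 < \<alpha>" and "dominated \<alpha> y x"
  then obtain C \<theta> where *: "0 \<le> C" "2 * \<alpha> < \<theta>" "cstar_le (star x * x) (C *\<^sub>R ppow y \<theta>)"
    by (auto simp: dominated_def)
  have "embed (ppow y \<theta>) = upow (embed y) \<theta>" using y \<alpha> * by (simp add: embed_ppow)
  then have "cpos (C *\<^sub>R upow (embed y) \<theta> - star (embed x) * embed x)"
    using *(3) by (simp add: cstar_le_def positives_iff embed_simps)
  then show ?thesis using * by (auto simp: udominated_def)
qed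

text \<open>Multiplication by \<open>embed x\<close> annihilates the scalar part of the approximate
  inverses, so the limit stays in A.\<close>

lemma embed_pquot:
  assumes "y \<in> positives" "0 < \<alpha>" "\<alpha> \<le> 1" "dominated \<alpha> y x"
  shows "embed (pquot \<alpha> y x) = uquot \<alpha> (embed y) (embed x)"
  unfolding pquot_def
proof (rule embed_ubase)
  have "(\<lambda>n. uscalar (embed x * reg_inverse \<alpha> (embed y) n)) \<longlonglongrightarrow> uscalar (uquot \<alpha> (embed y) (embed x))"
    using assms by (intro bounded_linear.tendsto [OF bounded_linear_uscalar] uquot_tendsto udominated_embed)
      (auto simp: positives_iff)
  then show "uscalar (uquot \<alpha> (embed y) (embed x)) = 0" by (simp add: LIMSEQ_const_iff)
qed

lemma pquot_mult_ppow:
  assumes "y \<in> positives" "0 < \<alpha>" "\<alpha> \<le> 1" "dominated \<alpha> y x"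
  shows "pquot \<alpha> y x * ppow y \<alpha> = x"
proof -
  have "embed (pquot \<alpha> y x * ppow y \<alpha>) = embed x"
    using assms by (simp add: embed_simps embed_pquot embed_ppow)
      (simp add: uquot_mult_upow udominated_embed positives_iff [symmetric] flip: positives_iff)
  then show ?thesis by (simp add: embed_eq_iff)
qed

lemma star_pquot_mult_self_le:
  assumes y: "y \<in> positives" and \<alpha>: "0 < \<alpha>" "\<alpha> \<le> 1" and C: "0 \<le> C" and \<theta>: "2 * \<alpha> < \<theta>"
    and d: "cstar_le (star x * x) (C *\<^sub>R ppow y \<theta>)"
  shows "cstar_le (star (pquot \<alpha> y x) * pquot \<alpha> y x) (C *\<^sub>R ppow y (\<theta> - 2 * \<alpha>))"
proof -
  have x: "dominated \<alpha> y x" using C \<theta> d by (rule dominatedI)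
  have e: "embed (ppow y \<theta>) = upow (embed y) \<theta>" "embed (ppow y (\<theta> - 2 * \<alpha>)) = upow (embed y) (\<theta> - 2 * \<alpha>)"
    using y \<alpha> \<theta> by (simp_all add: embed_ppow)
  have "cpos (C *\<^sub>R upow (embed y) \<theta> - star (embed x) * embed x)"
    using d by (simp add: cstar_le_def positives_iff embed_simps e)
  then have "cpos (C *\<^sub>R upow (embed y) (\<theta> - 2 * \<alpha>)
      - star (uquot \<alpha> (embed y) (embed x)) * uquot \<alpha> (embed y) (embed x))"
    using y by (intro star_uquot_mult_self_le \<alpha> C \<theta>) (auto simp: positives_iff)
  then show ?thesis
    by (simp add: cstar_le_def positives_iff [of "_ - _"] embed_simps e embed_pquot [OF y \<alpha> x])
qed

lemma sum_list_mult_pquot: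
  assumes y: "y \<in> positives" and \<alpha>: "0 < \<alpha>" "\<alpha> \<le> 1" "\<alpha> < r"
    and d: "\<And>p. p \<in> set ps \<Longrightarrow> dominated \<alpha> y (w p)"
    and s: "(\<Sum>p\<leftarrow>ps. z p * w p) = ppow y r"
  shows "(\<Sum>p\<leftarrow>ps. z p * pquot \<alpha> y (w p)) = ppow y (r - \<alpha>)"
proof (rule ppow_eqI [OF y])
  have "embed (\<Sum>p\<leftarrow>ps. z p * w p) = upow (embed y) r" unfolding s using y \<alpha> by (simp add: embed_ppow)
  then have "(\<Sum>p\<leftarrow>ps. embed (z p) * uquot \<alpha> (embed y) (embed (w p))) = upow (embed y) (r - \<alpha>)"
    using y \<alpha> d by (intro sum_list_mult_uquot udominated_embed) (auto simp: embed_sum_list embed_simps positives_iff)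
  moreover have "map (\<lambda>p. embed (z p) * uquot \<alpha> (embed y) (embed (w p))) ps = map (\<lambda>p. embed (z p * pquot \<alpha> y (w p))) ps"
    using y \<alpha> d by (intro map_cong) (auto simp: embed_simps embed_pquot)
  ultimately show "embed (\<Sum>p\<leftarrow>ps. z p * pquot \<alpha> y (w p)) = upow (embed y) (r - \<alpha>)"
    by (simp add: embed_sum_list)
qed (use \<alpha> in auto)

lemma mult_pquot:
  assumes "y \<in> positives" "0 < \<alpha>" "\<alpha> \<le> 1" "\<alpha> < r" "dominated \<alpha> y w" "z * w = ppow y r"
  shows "z * pquot \<alpha> y w = ppow y (r - \<alpha>)"
  using sum_list_mult_pquot [of y \<alpha> r "[()]" "\<lambda>_. w" "\<lambda>_. z"] assms by simp

text \<open>Here u is the quotient x (star x * x)^(-\<alpha>), and the identities are the ones that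
  this expression predicts formally. Domination holds with C = 1 and \<theta> = 1, whence \<alpha> <
  1/2; at 1/2 one would get the partial isometry, which A may lack.\<close>

lemma polar_decomposition:
  fixes x :: "'a::cstar_algebra"
  assumes \<alpha>: "0 < \<alpha>" "\<alpha> < 1/2"
  obtains u where "x = u * ppow (star x * x) \<alpha>" "star u * x = ppow (star x * x) (1 - \<alpha>)"
    "\<And>r. 0 < r \<Longrightarrow> star u * ppow (x * star x) r * u = ppow (star x * x) (r + 1 - 2 * \<alpha>)"
proof -
  define y where "y = star x * x"
  have y: "y \<in> positives" and xx: "x * star x \<in> positives"
    by (simp_all add: y_def positives_star_mult_self positives_mult_star_self)
  have \<alpha>1: "0 < \<alpha>" "\<alpha> \<le> 1" using \<alpha> by auto
  have d: "dominated \<alpha> y x"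
    using \<alpha> y by (intro dominatedI [of 1 _ 1]) (auto simp: y_def)
  define u where "u = pquot \<alpha> y x"
  note quot = mult_pquot [OF y \<alpha>1 _ d, folded u_def]
  have 1: "x = u * ppow y \<alpha>" unfolding u_def by (rule pquot_mult_ppow [OF y \<alpha>1 d, symmetric])
  have "star x * u = ppow y (1 - \<alpha>)" using \<alpha> y by (intro quot) (auto simp: y_def)
  then have "star (star x * u) = star (ppow y (1 - \<alpha>))" by simp
  then have 2: "star u * x = ppow y (1 - \<alpha>)" using y \<alpha> by (simp add: star_mult star_star star_ppow)
  have 3: "star u * ppow (x * star x) r * u = ppow y (r + 1 - 2 * \<alpha>)" if r: "0 < r" for r
  proof -
    have "star x * (ppow (x * star x) r * x) = star x * (x * ppow y r)"
      using ppow_intertwine [OF y xx r, of x] by (simp add: y_def mult.assoc)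
    also have "\<dots> = ppow y (1 + r)" using y r by (simp add: ppow_add) (simp add: y_def mult.assoc)
    finally have "(star x * ppow (x * star x) r) * x = ppow y (1 + r)" by (simp add: mult.assoc)
    then have "(star x * ppow (x * star x) r) * u = ppow y (1 + r - \<alpha>)"
      using \<alpha> r by (intro quot) auto
    then have "star ((star x * ppow (x * star x) r) * u) = star (ppow y (1 + r - \<alpha>))" by simp
    then have "(star u * ppow (x * star x) r) * x = ppow y (1 + r - \<alpha>)"
      using y xx r \<alpha> by (simp add: star_mult star_star star_ppow mult.assoc)
    then have "(star u * ppow (x * star x) r) * u = ppow y (1 + r - \<alpha> - \<alpha>)"
      using \<alpha> r by (intro quot) auto
    then show ?thesis by (simp add: algebra_simps)
  qed
  show ?thesis by (rule that [folded y_def, OF 1 2 3])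
qed

lemma dominated_factor:
  assumes "y \<in> positives" "0 < \<alpha>" "\<alpha> < 1/2" "0 \<le> C" "cstar_le (star x * x) (C *\<^sub>R y)"
  obtains u where "x = u * ppow y \<alpha>"
proof -
  have "dominated \<alpha> y x" using assms by (intro dominatedI [of C _ 1]) auto
  then have "pquot \<alpha> y x * ppow y \<alpha> = x" using assms by (intro pquot_mult_ppow) auto
  then show ?thesis using that [of "pquot \<alpha> y x"] by simp
qed

text \<open>Formally, \<open>k w = w y\<^sup>-\<^sup>1\<^sup>/\<^sup>2 x\<^sup>*\<close> with
  \<open>y = \<Sum> w\<^sup>* w\<close>.\<close>

lemma riesz_decomposition:
  assumes le: "cstar_le (star x * x) (\<Sum>w\<leftarrow>ws. star w * w)"
  obtains k where "x * star x = (\<Sum>w\<leftarrow>ws. star (k w) * k w)"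
    "\<And>w. w \<in> set ws \<Longrightarrow> cstar_le (k w * star (k w)) (w * star w)"
proof -
  define y where "y = (\<Sum>w\<leftarrow>ws. star w * w)"
  have y: "y \<in> positives" unfolding y_def by (intro positives_sum_list positives_star_mult_self)
  \<comment> \<open>The exponent 1/2 is just out of reach, so y^(-1/2) is written as y^(-3/8)
    y^(1/4) y^(-3/8). The middle factor q = y^(1/4) then coincides with the bound 1 - 2 * 3/8 for
    the exponents of the squares of the quotients.\<close>
  define U where "U = pquot (3/8) y"
  define u where "u = U x"
  have xle: "cstar_le (star x * x) (1 *\<^sub>R ppow y 1)" using le y by (simp add: y_def)
  have xd: "dominated (3/8) y x" by (rule dominatedI [OF _ _ xle]) auto
  have wd: "dominated (3/8) y w" if "w \<in> set ws" for w
  proof (rule dominatedI [of 1 _ 1])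
    show "cstar_le (star w * w) (1 *\<^sub>R ppow y 1)"
      using that y by (simp, subst y_def) (intro cstar_le_sum_list_member positives_star_mult_self)
  qed auto
  have ux: "u * ppow y (3/8) = x" unfolding u_def U_def by (rule pquot_mult_ppow [OF y _ _ xd]) auto
  have Uw: "U w * ppow y (3/8) = w" if "w \<in> set ws" for w
    unfolding U_def by (rule pquot_mult_ppow [OF y _ _ wd [OF that]]) auto
  have uu: "cstar_le (star u * u) (ppow y (1/4))"
    using star_pquot_mult_self_le [OF y _ _ _ _ xle, of "3/8"] by (simp add: u_def U_def)
  have "(\<Sum>w\<leftarrow>ws. star w * U w) = ppow y (1 - 3/8)"
    unfolding U_def using y wd by (intro sum_list_mult_pquot) (auto simp: y_def)
  then have "star (\<Sum>w\<leftarrow>ws. star w * U w) = star (ppow y (1 - 3/8))" by simp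
  then have "(\<Sum>w\<leftarrow>ws. star (U w) * w) = ppow y (1 - 3/8)"
    using y by (simp add: star_sum_list star_mult star_star star_ppow)
  then have UU: "(\<Sum>w\<leftarrow>ws. star (U w) * U w) = ppow y (1 - 3/8 - 3/8)"
    unfolding U_def using y wd by (intro sum_list_mult_pquot) auto
  define q where "q = ppow y (1/4)"
  have sq: "star q = q" using y by (simp add: q_def star_ppow)
  have q3: "q * q * q = ppow y (3/8) * ppow y (3/8)" using y by (simp add: q_def flip: ppow_add)
  define k where "k w = U w * q * star u" for w
  show ?thesis
  proof (rule that [of k])
    have "(\<Sum>w\<leftarrow>ws. star (k w) * k w) = u * q * (\<Sum>w\<leftarrow>ws. star (U w) * U w) * q * star u"
      by (induction ws) (simp_all add: k_def star_mult star_star sq algebra_simps)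
    also have "\<dots> = u * (q * q * q) * star u" unfolding UU by (simp add: q_def mult.assoc)
    also have "\<dots> = x * star x"
      using y unfolding q3 ux [symmetric] by (simp add: star_mult star_ppow mult.assoc)
    finally show "x * star x = (\<Sum>w\<leftarrow>ws. star (k w) * k w)" ..
    fix w assume w: "w \<in> set ws"
    have "k w * star (k w) = (U w * q) * (star u * u) * star (U w * q)"
      by (simp add: k_def star_mult star_star sq mult.assoc)
    moreover have "cstar_le \<dots> ((U w * q) * q * star (U w * q))"
      using uu unfolding q_def by (rule cstar_le_conj')
    moreover have "(U w * q) * q * star (U w * q) = U w * (q * q * q) * star (U w)"
      by (simp add: star_mult sq mult.assoc)
    moreover have "\<dots> = (U w * ppow y (3/8)) * star (U w * ppow y (3/8))"
      using y unfolding q3 by (simp add: star_mult star_ppow mult.assoc)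
    ultimately show "cstar_le (k w * star (k w)) (w * star w)" by (simp add: Uw [OF w])
  qed
qed

section \<open>Ideals closed under square roots\<close>

lemma
  assumes "is_ideal I"
  shows ideal_zero: "0 \<in> I"
    and ideal_add: "\<And>x y. x \<in> I \<Longrightarrow> y \<in> I \<Longrightarrow> x + y \<in> I"
    and ideal_minus: "\<And>x. x \<in> I \<Longrightarrow> - x \<in> I"
    and ideal_mult_left: "\<And>a x. x \<in> I \<Longrightarrow> a * x \<in> I"
    and ideal_mult_right: "\<And>a x. x \<in> I \<Longrightarrow> x * a \<in> I"
  using assms by (auto simp: is_ideal_def)

lemma ideal_diff: "is_ideal I \<Longrightarrow> x \<in> I \<Longrightarrow> y \<in> I \<Longrightarrow> x - y \<in> I"
  using ideal_add [of I x "- y"] ideal_minus by auto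

lemma ideal_sum_list: "is_ideal I \<Longrightarrow> (\<And>x. x \<in> set xs \<Longrightarrow> f x \<in> I) \<Longrightarrow> (\<Sum>x\<leftarrow>xs. f x) \<in> I"
  by (induction xs) (auto intro: ideal_zero ideal_add)

text \<open>The scalar is put on the surplus a^(r-s), an arbitrary element of A. Raising an exponent
  thus compensates for the missing complex scalars.\<close>

lemma ideal_ppow_increase:
  assumes "is_ideal I" "a \<in> positives" "ppow a s \<in> I" "0 < s" "s < r"
  shows "c *\<^sub>C ppow a r \<in> I"
proof -
  have "c *\<^sub>C ppow a r = (c *\<^sub>C ppow a (r - s)) * ppow a s"
    using assms by (simp add: mult_scaleC_left flip: ppow_add)
  then show ?thesis using assms by (simp add: ideal_mult_left)
qed

lemmas ideal_ppow_increase_real = ideal_ppow_increase [where c = 1, unfolded scaleC_one]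

lemma ideal_ppow_flip:
  assumes I: "is_ideal I" and r: "0 < r" "r < s" and x: "ppow (x * star x) r \<in> I"
  shows "ppow (star x * x) s \<in> I"
proof -
  \<comment> \<open>The polar decomposition reaches the exponents r + 1 - 2\<alpha> between r and r
    + 1. The target is cut down to r + 1/2 to stay in that range; the rest is an increase of the
    exponent.\<close>
  define t where "t = min s (r + 1/2)"
  define \<alpha> where "\<alpha> = (1 - (t - r)) / 2"
  have t: "r < t" "t \<le> s" "t \<le> r + 1/2" using r by (auto simp: t_def)
  then have "0 < \<alpha>" "\<alpha> < 1/2" by (auto simp: \<alpha>_def)
  then obtain u where "star u * ppow (x * star x) r * u = ppow (star x * x) (r + 1 - 2 * \<alpha>)"
    using polar_decomposition [of \<alpha> x] r(1) by metis
  moreover have "2 * \<alpha> = 1 - (t - r)" by (simp add: \<alpha>_def)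
  then have "r + 1 - 2 * \<alpha> = t" by simp
  ultimately have "ppow (star x * x) t = star u * ppow (x * star x) r * u" by simp
  then have "ppow (star x * x) t \<in> I" using I x by (simp add: ideal_mult_left ideal_mult_right)
  then show ?thesis
    using ideal_ppow_increase_real [OF I positives_star_mult_self, of x t s] t r by (cases "t = s") auto
qed

text \<open>Exponents below 1 are the gain over the obvious membership of the products. The second
  claim uses the adjoint of the polar identity for \<open>star x\<close>, which ends in x u, so it
  does not require \<open>star x\<close> to lie in I.\<close>

lemma ideal_ppow_star_mult_self:
  assumes I: "is_ideal I" and x: "x \<in> I" and r: "1/2 < r" "r < 1"
  shows "ppow (star x * x) r \<in> I" "ppow (x * star x) r \<in> I"
proof -
  have *: "0 < 1 - r" "1 - r < 1/2" using r by auto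
  obtain u where "star u * x = ppow (star x * x) (1 - (1 - r))"
    using polar_decomposition [OF *, of x] by metis
  then have "ppow (star x * x) r = star u * x" by simp
  then show "ppow (star x * x) r \<in> I" using I x by (simp add: ideal_mult_left)
  obtain u where "star u * star x = ppow (star (star x) * star x) (1 - (1 - r))"
    using polar_decomposition [OF *, of "star x"] by metis
  then have "star (star u * star x) = star (ppow (x * star x) r)" by (simp add: star_star)
  then have "ppow (x * star x) r = x * u"
    using r by (simp add: star_mult star_star star_ppow positives_mult_star_self)
  then show "ppow (x * star x) r \<in> I" using I x by (simp add: ideal_mult_right)
qed

text \<open>Put x = a^(\<theta>/2). Operator monotonicity bounds x^2 by a multiple of b^\<theta>, so
  x = u (b^\<theta>)^\<alpha>, and \<alpha> = \<tau>/(2\<theta>) < 1/2 makes x x^* equal to u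
  b^\<tau> u^*.\<close>

lemma ppow_dominated_factor:
  assumes a: "a \<in> positives" and b: "b \<in> positives" and C: "0 \<le> C" and le: "cstar_le a (C *\<^sub>R b)"
    and \<theta>: "\<theta> = 1 - (1/2) ^ Suc n \<or> \<theta> = 1" and \<tau>: "0 < \<tau>" "\<tau> < \<theta>"
  obtains u where "ppow a \<theta> = u * ppow b \<tau> * star u"
proof -
  have \<theta>0: "0 < \<theta>" using \<tau> by simp
  define \<alpha> where "\<alpha> = \<tau> / (2 * \<theta>)"
  have \<alpha>: "0 < \<alpha>" "\<alpha> < 1/2" using \<tau> \<theta>0 by (auto simp: \<alpha>_def field_simps)
  define x where "x = ppow a (\<theta> / 2)"
  have sx: "star x = x" "x * x = ppow a \<theta>" using a \<theta>0 by (simp_all add: x_def star_ppow ppow_half_mult)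
  have "cstar_le (ppow a \<theta>) ((C powr \<theta>) *\<^sub>R ppow b \<theta>)"
    using \<theta>
  proof
    assume "\<theta> = 1 - (1/2) ^ Suc n"
    then have "cstar_le (ppow a \<theta>) (ppow (C *\<^sub>R b) \<theta>)"
      by (intro ppow_mono a positives_scaleR b C le)
    then show ?thesis using b C \<theta>0 by (simp add: ppow_scaleR)
  qed (use a b le C in simp)
  then obtain u where u: "x = u * ppow (ppow b \<theta>) \<alpha>"
    using dominated_factor [of "ppow b \<theta>" \<alpha> "C powr \<theta>" x] \<alpha> \<theta>0 b sx by (auto simp: ppow_positives)
  have b2: "ppow (ppow b \<theta>) \<alpha> = ppow b (\<tau> / 2)" using b \<theta>0 \<alpha> by (simp add: ppow_ppow \<alpha>_def)
  have "ppow a \<theta> = x * star x" by (simp add: sx)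
  also have "\<dots> = u * (ppow b (\<tau> / 2) * ppow b (\<tau> / 2)) * star u"
    unfolding u b2 using b \<tau> by (simp add: star_mult star_ppow mult.assoc)
  also have "\<dots> = u * ppow b \<tau> * star u" using b \<tau> by (simp only: ppow_half_mult)
  finally show ?thesis by (rule that)
qed

lemma ideal_ppow_hereditary:
  assumes I: "is_ideal I" and a: "a \<in> positives" and b: "b \<in> positives" and C: "0 \<le> C" and le: "cstar_le a (C *\<^sub>R b)"
    and \<theta>: "\<theta> = 1 - (1/2) ^ Suc n \<or> \<theta> = 1" and \<sigma>: "0 < \<sigma>" "\<sigma> < \<theta>" and bI: "ppow b \<sigma> \<in> I"
  shows "c *\<^sub>C ppow a \<theta> \<in> I"
proof -
  \<comment> \<open>Strictly above \<sigma>, so that the passage from b^\<sigma> to b^\<tau> can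
    absorb the scalar c.\<close>
  obtain \<tau> where \<tau>: "\<sigma> < \<tau>" "\<tau> < \<theta>" using \<sigma> dense by blast
  then obtain u where "ppow a \<theta> = u * ppow b \<tau> * star u"
    using ppow_dominated_factor [OF a b C le \<theta>, of \<tau>] \<sigma> by auto
  then have "c *\<^sub>C ppow a \<theta> = u * (c *\<^sub>C ppow b \<tau>) * star u" by (simp add: mult_scaleC_left mult_scaleC_right)
  then show ?thesis
    using ideal_ppow_increase [OF I b bI \<sigma>(1) \<tau>(1)] I by (simp add: ideal_mult_left ideal_mult_right)
qed

lemma closed_under_square_roots_iff:
  "closed_under_square_roots I \<longleftrightarrow> (\<forall>a\<in>I. a \<in> positives \<longrightarrow> ppow a (1/2) \<in> I)"
  by (auto simp: closed_under_square_roots_def positive_root_eq)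

lemma ideal_power_two_square: "x \<in> J \<Longrightarrow> y \<in> J \<Longrightarrow> x * y \<in> ideal_power J 2"
  unfolding ideal_power_def
  by (intro group_closure.base insertI2) (auto intro!: exI [of _ "[x, y]"])

context
  fixes I :: "'a::cstar_algebra set"
  assumes I: "is_ideal I" and sqrt_closed: "closed_under_square_roots I"
begin

lemma sqrt_closed_ppow:
  assumes a: "a \<in> I" "a \<in> positives" and r: "0 < r"
  shows "c *\<^sub>C ppow a r \<in> I"
proof -
  have "ppow a ((1/2) ^ k) \<in> I" for k
  proof (induction k)
    case (Suc k)
    then have "ppow (ppow a ((1/2) ^ k)) (1/2) \<in> I"
      using sqrt_closed a by (simp add: closed_under_square_roots_iff ppow_positives)
    then show ?case using a by (simp add: ppow_ppow)
  qed (simp add: a)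
  moreover obtain k where "(1/2) ^ k < r" using real_arch_pow_inv [of r "1/2"] r by auto
  ultimately show ?thesis using ideal_ppow_increase [OF I a(2), of "(1/2) ^ k" r c] by simp
qed

lemmas sqrt_closed_ppow_real = sqrt_closed_ppow [where c = 1, unfolded scaleC_one]

text \<open>Assuming membership of the square rather than of x makes this yield x itself
  (\<open>sqrt_closed_mem\<close>), and from that closure under \<open>star\<close>. The quarter
  power of the polar decomposition is split so that each factor receives an eighth power.\<close>

lemma sqrt_closed_factor:
  assumes x: "star x * x \<in> I"
  obtains y z where "y \<in> I" "z \<in> I" "x = y * z" "star z = z"
proof -
  let ?y = "star x * x"
  obtain u where "x = u * ppow ?y (1/4)" using polar_decomposition [of "1/4" x] by auto
  also have "ppow ?y (1/4) = ppow ?y (1/8) * ppow ?y (1/8)"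
    by (simp add: positives_star_mult_self flip: ppow_add)
  finally have "x = u * ppow ?y (1/8) * ppow ?y (1/8)" by (simp add: mult.assoc)
  moreover have "ppow ?y (1/8) \<in> I" by (intro sqrt_closed_ppow_real x positives_star_mult_self) auto
  moreover have "star (ppow ?y (1/8)) = ppow ?y (1/8)" by (simp add: star_ppow positives_star_mult_self)
  ultimately show ?thesis using that ideal_mult_left [OF I] by metis
qed

lemma sqrt_closed_mem: "star x * x \<in> I \<Longrightarrow> x \<in> I"
  by (metis I ideal_mult_left sqrt_closed_factor)

lemma sqrt_closed_star: "x \<in> I \<Longrightarrow> star x \<in> I"
  using sqrt_closed_mem [of "star x"] by (simp add: star_star ideal_mult_right I)

lemma sqrt_closed_scaleC: "x \<in> I \<Longrightarrow> c *\<^sub>C x \<in> I"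
  by (metis I ideal_mult_left mult_scaleC_left sqrt_closed_factor)

lemma sqrt_closed_factors: "factors I"
  unfolding factors_def by (metis I ideal_mult_left sqrt_closed_factor)

lemma sqrt_closed_roots: "closed_under_roots I"
  using sqrt_closed_ppow_real by (auto simp: closed_under_roots_def positive_root_eq)

lemma sqrt_closed_semiprime: "semiprime I"
  unfolding semiprime_def
proof (intro conjI allI impI subsetI I)
  fix J x
  assume J: "is_ideal J" "ideal_power J 2 \<subseteq> I" and x: "x \<in> J"
  let ?y = "star x * x"
  have "?y \<in> J" using J(1) x by (rule ideal_mult_left)
  then have "?y * ?y \<in> I" using J(2) ideal_power_two_square by blast
  then have "ppow ?y 2 \<in> I" by (simp add: ppow_two positives_star_mult_self)
  then have "ppow (ppow ?y 2) (1/2) \<in> I"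
    by (rule sqrt_closed_ppow_real) (auto simp: ppow_positives positives_star_mult_self)
  then have "?y \<in> I" by (simp add: ppow_ppow positives_star_mult_self)
  then show "x \<in> I" by (rule sqrt_closed_mem)
qed

lemma sqrt_closed_dixmier: "dixmier_ideal I"
  unfolding dixmier_ideal_def
proof (intro conjI I)
  have her: "a \<in> I" if "a \<in> positives" "b \<in> positives" "cstar_le a b" "b \<in> I" for a b
  proof -
    have "1 *\<^sub>C ppow a 1 \<in> I"
      using that sqrt_closed_ppow_real [of b "1/2"] by (intro ideal_ppow_hereditary [OF I, of a b 1 1 _ "1/2"]) auto
    then show ?thesis using that by simp
  qed
  then show "order_ideal (I \<inter> positives)"
    unfolding order_ideal_def using I by (auto intro: positives_add ideal_add ideal_zero)
  show "strongly_invariant (I \<inter> positives)"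
    unfolding strongly_invariant_def
  proof (intro allI)
    fix x
    have "star x * x \<in> I \<longleftrightarrow> x \<in> I" using sqrt_closed_mem I ideal_mult_left by blast
    moreover have "x * star x \<in> I \<longleftrightarrow> star x \<in> I"
      using sqrt_closed_mem [of "star x"] I ideal_mult_left by (auto simp: star_star)
    moreover have "x \<in> I \<longleftrightarrow> star x \<in> I" using sqrt_closed_star star_star by metis
    ultimately show "star x * x \<in> I \<inter> positives \<longleftrightarrow> x * star x \<in> I \<inter> positives"
      by (simp add: positives_star_mult_self positives_mult_star_self)
  qed
  have "complex_space.subspace I"
    by (intro complex_space.subspaceI) (auto intro: ideal_zero ideal_add I sqrt_closed_scaleC)
  then have "complex_span (I \<inter> positives) \<subseteq> I" by (intro complex_space.span_minimal) auto
  moreover have "x \<in> complex_span (I \<inter> positives)" if x: "x \<in> I" for x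
  proof -
    let ?S = "complex_span (I \<inter> positives)"
    obtain y z where yz: "y \<in> I" "z \<in> I" "x = y * z"
      using sqrt_closed_factor [of x] x I ideal_mult_left by metis
    have sq: "star w * w \<in> ?S" if "w \<in> I" for w
      using that I by (intro complex_space.span_base) (auto intro: ideal_mult_left positives_star_mult_self)
    define y' where "y' = star y"
    have y': "y' \<in> I" "x = star y' * z" using yz by (simp_all add: y'_def star_star sqrt_closed_star)
    have "4 *\<^sub>R x \<in> ?S"
      unfolding y'(2) star_mult_polarization
      using y'(1) yz(2) I
      by (intro complex_space.span_add complex_space.span_diff complex_space.span_scale sq
          ideal_add ideal_diff sqrt_closed_scaleC)
    then have "complex_of_real (1/4) *\<^sub>C (4 *\<^sub>R x) \<in> ?S" by (rule complex_space.span_scale)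
    then show ?thesis unfolding scaleC_of_real by simp
  qed
  ultimately show "I = complex_span (I \<inter> positives)" by blast
qed

end

lemma dixmier_interior_closure_eq: "dixmier_ideal I \<Longrightarrow> dixmier_interior I = I \<and> dixmier_closure I = I"
proof
  assume D: "dixmier_ideal I"
  then have I: "is_ideal I" by (simp add: dixmier_ideal_def)
  show "dixmier_closure I = I" using D by (auto simp: dixmier_closure_def)
  have "sum_list xs \<in> I" if "set xs \<subseteq> \<Union>{J. dixmier_ideal J \<and> J \<subseteq> I}" for xs
    using ideal_sum_list [OF I, of xs "\<lambda>x. x"] that by auto
  moreover have "\<exists>xs. x = sum_list xs \<and> set xs \<subseteq> \<Union>{J. dixmier_ideal J \<and> J \<subseteq> I}" if "x \<in> I" for x
    using D that by (intro exI [of _ "[x]"]) auto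
  ultimately show "dixmier_interior I = I" by (auto simp: dixmier_interior_def)
qed

lemma ideal_power_subset:
  assumes "is_ideal I" "\<And>xs. length xs = n \<Longrightarrow> set xs \<subseteq> J \<Longrightarrow> list_product xs \<in> I"
  shows "ideal_power J n \<subseteq> I"
proof
  fix x assume "x \<in> ideal_power J n"
  then show "x \<in> I" unfolding ideal_power_def
    by induction (use assms in \<open>auto intro: ideal_diff ideal_zero\<close>)
qed

lemma ideal_power_two_subset:
  assumes I: "is_ideal I" and J: "\<And>y z. y \<in> J \<Longrightarrow> z \<in> J \<Longrightarrow> y * z \<in> I"
  shows "ideal_power J 2 \<subseteq> I"
proof (rule ideal_power_subset [OF I])
  fix xs assume "length xs = 2" and xs: "set xs \<subseteq> J"
  then obtain y z where "xs = [y, z]" by (auto simp: numeral_2_eq_2 length_Suc_conv)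
  then show "list_product xs \<in> I" using J xs by simp
qed

section \<open>Semiprime ideals\<close>

text \<open>\<open>J\<close> below is the intersection of a left annihilator \<open>L\<close> of \<open>x\<close> modulo \<open>I\<close> with the right annihilator of \<open>L\<close>.\<close>

lemma semiprime_elementwise:
  assumes s: "semiprime I" and xx: "x * x \<in> I" and xax: "\<And>a. x * a * x \<in> I"
  shows "x \<in> I"
proof -
  have I: "is_ideal I" using s by (simp add: semiprime_def)
  define L where "L = {y. y * x \<in> I \<and> (\<forall>a. y * a * x \<in> I)}"
  define J where "J = L \<inter> {z. \<forall>y\<in>L. y * z \<in> I}"
  have L: "b * y \<in> L" "y * b \<in> L" if "y \<in> L" for b y
  proof -
    have y: "y * x \<in> I" "y * c * x \<in> I" for c using that by (auto simp: L_def)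
    have "b * (y * x) \<in> I" "b * (y * c * x) \<in> I" "y * (b * c) * x \<in> I" for c
      using y I by (auto intro: ideal_mult_left)
    then show "b * y \<in> L" "y * b \<in> L" using y by (auto simp: L_def mult.assoc)
  qed
  have "is_ideal L" unfolding is_ideal_def
    using I by (auto simp: L) (auto simp: L_def distrib_right ideal_zero ideal_add ideal_minus)
  then have "is_ideal J" unfolding is_ideal_def J_def using I L
    by (auto simp: distrib_left ideal_zero ideal_add ideal_minus ideal_mult_right simp flip: mult.assoc)
  moreover have "ideal_power J 2 \<subseteq> I"
    by (rule ideal_power_two_subset [OF I]) (auto simp: J_def)
  ultimately have "J \<subseteq> I" using s by (auto simp: semiprime_def)
  moreover have "x \<in> J" using xx xax by (auto simp: J_def L_def)
  ultimately show ?thesis by blast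
qed

text \<open>In (c x) a (c x) both scalars can be moved to the left of the last x, which leaves an
  element of A times x.\<close>

lemma semiprime_scaleC:
  assumes s: "semiprime I" and x: "x \<in> I"
  shows "c *\<^sub>C x \<in> I"
proof (rule semiprime_elementwise [OF s])
  have I: "is_ideal I" using s by (simp add: semiprime_def)
  show "c *\<^sub>C x * c *\<^sub>C x \<in> I" by (simp add: mult_scaleC_right I x ideal_mult_left flip: mult_scaleC_left)
  show "c *\<^sub>C x * a * c *\<^sub>C x \<in> I" for a
    by (simp add: mult_scaleC_right I x ideal_mult_left flip: mult_scaleC_left)
qed

text \<open>Every element is, up to the factor 4, a complex combination of four elements \<open>v\<^sup>* v\<close>.\<close>

lemma semiprime_conj_mem:
  assumes s: "semiprime I" and p: "p \<in> positives" and pv: "\<And>v. p * (star v * v) * p \<in> I"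
  shows "p * a * p \<in> I"
proof -
  have I: "is_ideal I" using s by (simp add: semiprime_def)
  obtain u where "a = u * ppow (star a * a) (1/4)" using polar_decomposition [of "1/4" a] by auto
  then obtain y z where a: "a = star y * z" by (metis star_star)
  have lin: "p * (x + y) * p = p * x * p + p * y * p" "p * (x - y) * p = p * x * p - p * y * p"
    "p * (c *\<^sub>C x) * p = c *\<^sub>C (p * x * p)" for x y c
    by (simp_all add: algebra_simps mult_scaleC_left mult_scaleC_right)
  have "4 *\<^sub>R (p * a * p) = p * (4 *\<^sub>R (star y * z)) * p" by (simp add: a)
  also have "\<dots> \<in> I"
    unfolding star_mult_polarization lin
    by (intro ideal_add [OF I] ideal_diff [OF I] semiprime_scaleC [OF s] pv)
  finally have "complex_of_real (1/4) *\<^sub>C (4 *\<^sub>R (p * a * p)) \<in> I" by (rule semiprime_scaleC [OF s])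
  then show ?thesis unfolding scaleC_of_real by simp
qed

lemma semiprime_closed_under_square_roots:
  assumes s: "semiprime I"
  shows "closed_under_square_roots I"
  unfolding closed_under_square_roots_iff
proof (intro ballI impI)
  fix a assume aI: "a \<in> I" and a: "a \<in> positives"
  have I: "is_ideal I" using s by (simp add: semiprime_def)
  define b where "b = ppow a (1/2)"
  have b: "b \<in> positives" "star b = b" "b * b = a"
    using a ppow_half_mult [of a 1] by (simp_all add: b_def ppow_positives star_ppow)
  have t_in: "b * (star z * z) * b \<in> I" for z
  proof -
    define t where "t = star (z * b) * (z * b)"
    have t: "t \<in> positives" by (simp add: t_def positives_star_mult_self)
    have "(z * b) * star (z * b) = z * a * star z" by (simp add: star_mult b mult.assoc flip: b(3))
    moreover have "z * a * star z \<in> I" using aI I by (simp add: ideal_mult_left ideal_mult_right)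
    ultimately have "ppow ((z * b) * star (z * b)) 1 \<in> I" by (metis ppow_one positives_mult_star_self)
    \<comment> \<open>Any exponent strictly between 1 and 2 would serve: the flip, starting from z a
      z^*, needs more than 1, and half of the exponent must be below 1 for the heredity argument
      under t^2.\<close>
    then have t54: "ppow t (5/4) \<in> I" unfolding t_def by (rule ideal_ppow_flip [OF I, rotated 2]) auto
    have "t * (star v * v) * t \<in> I" for v
    proof -
      define r where "r = star (v * t) * (v * t)"
      have r: "r \<in> positives" by (simp add: r_def positives_star_mult_self)
      have "cstar_le r ((norm v)\<^sup>2 *\<^sub>R ppow t 2)"
        using star_mult_self_mult_le [of v t] t by (simp add: r_def ppow_two positives_star)
      moreover have "ppow (ppow t 2) (5/8) \<in> I" using t54 t by (simp add: ppow_ppow)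
      ultimately have "1 *\<^sub>C ppow r 1 \<in> I"
        using t r by (intro ideal_ppow_hereditary [OF I, of r "ppow t 2" "(norm v)\<^sup>2" 1 _ "5/8"]) (auto simp: ppow_positives)
      then have "r \<in> I" using r by simp
      then show ?thesis using t by (simp add: r_def star_mult positives_star mult.assoc)
    qed
    then have "t * c * t \<in> I" for c by (rule semiprime_conj_mem [OF s t])
    moreover have "ppow t 2 \<in> I" by (rule ideal_ppow_increase_real [OF I t t54]) auto
    then have "t * t \<in> I" using t by (simp add: ppow_two)
    ultimately have "t \<in> I" using semiprime_elementwise [OF s] by blast
    then show ?thesis by (simp add: t_def star_mult b mult.assoc)
  qed
  then have "b * c * b \<in> I" for c by (rule semiprime_conj_mem [OF s b(1)])
  then show "ppow a (1/2) \<in> I"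
    using semiprime_elementwise [OF s, of b] aI b by (simp add: b_def)
qed

lemma semiprime_iff_closed_under_square_roots:
  "is_ideal I \<Longrightarrow> semiprime I \<longleftrightarrow> closed_under_square_roots I"
  using semiprime_closed_under_square_roots sqrt_closed_semiprime by blast

section \<open>Powers of ideals\<close>

lemma list_product_append:
  "xs \<noteq> [] \<Longrightarrow> ys \<noteq> [] \<Longrightarrow> list_product (xs @ ys) = list_product xs * list_product ys"
proof (induction xs rule: list_product.induct)
  case (2 x)
  then show ?case by (cases ys) auto
qed (auto simp: mult.assoc)

lemma list_product_Cons: "xs \<noteq> [] \<Longrightarrow> list_product (x # xs) = x * list_product xs"
  using list_product_append [of "[x]" xs] by simp

lemma ideal_power_closure:
  assumes "x \<in> ideal_power I n"
    and "\<And>xs. length xs = n \<Longrightarrow> set xs \<subseteq> I \<Longrightarrow> P (list_product xs)"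
    and "P 0" "\<And>x y. P x \<Longrightarrow> P y \<Longrightarrow> P (x - y)"
  shows "P x"
  using assms(1) unfolding ideal_power_def
  by induction (use assms in auto)

lemma list_product_in_ideal_power: "length xs = n \<Longrightarrow> set xs \<subseteq> I \<Longrightarrow> list_product xs \<in> ideal_power I n"
  unfolding ideal_power_def by (intro group_closure.base) auto

lemma ideal_power_zero: "0 \<in> ideal_power I n"
  and ideal_power_diff: "x \<in> ideal_power I n \<Longrightarrow> y \<in> ideal_power I n \<Longrightarrow> x - y \<in> ideal_power I n"
  by (simp_all add: ideal_power_def group_closure.diff)

lemma ideal_power_one:
  assumes "is_ideal I"
  shows "ideal_power I 1 = I"
proof
  show "ideal_power I 1 \<subseteq> I"
    by (rule ideal_power_subset [OF assms]) (auto simp: length_Suc_conv)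
  show "I \<subseteq> ideal_power I 1"
    using list_product_in_ideal_power [of "[_]" 1 I] by auto
qed

lemma is_ideal_ideal_power:
  assumes I: "is_ideal I" and n: "1 \<le> n"
  shows "is_ideal (ideal_power I n)"
  unfolding is_ideal_def
proof (intro conjI ballI allI)
  show "x + y \<in> ideal_power I n" if "x \<in> ideal_power I n" "y \<in> ideal_power I n" for x y
    using that by (simp add: ideal_power_def group_closure_add)
  show "- x \<in> ideal_power I n" if "x \<in> ideal_power I n" for x
    using that by (simp add: ideal_power_def)
  fix a x assume x: "x \<in> ideal_power I n"
  show "a * x \<in> ideal_power I n"
    using x
  proof (rule ideal_power_closure)
    fix xs assume xs: "length xs = n" "set xs \<subseteq> I"
    then obtain y ys where y: "xs = y # ys" using n by (cases xs) auto
    have "a * list_product xs = list_product ((a * y) # ys)"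
      unfolding y by (cases ys) (auto simp: mult.assoc)
    then show "a * list_product xs \<in> ideal_power I n"
      using xs I by (simp only:) (intro list_product_in_ideal_power, auto simp: y ideal_mult_left)
  qed (auto simp: right_diff_distrib intro: ideal_power_zero ideal_power_diff)
  show "x * a \<in> ideal_power I n"
    using x
  proof (rule ideal_power_closure)
    fix xs assume xs: "length xs = n" "set xs \<subseteq> I"
    then obtain y ys where y: "xs = ys @ [y]" using n by (cases xs rule: rev_cases) auto
    have "list_product xs * a = list_product (ys @ [y * a])"
      unfolding y by (cases "ys = []") (auto simp: mult.assoc list_product_append)
    then show "list_product xs * a \<in> ideal_power I n"
      using xs I by (simp only:) (intro list_product_in_ideal_power, auto simp: y ideal_mult_right)
  qed (auto simp: left_diff_distrib intro: ideal_power_zero ideal_power_diff)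
qed (rule ideal_power_zero)

lemma ideal_power_mult_left:
  assumes x: "x \<in> I" and y: "y \<in> ideal_power I n" and n: "1 \<le> n"
  shows "x * y \<in> ideal_power I (Suc n)"
  using y
proof (rule ideal_power_closure)
  fix xs assume xs: "length xs = n" "set xs \<subseteq> I"
  then have "x * list_product xs = list_product (x # xs)" using n by (subst list_product_Cons) auto
  then show "x * list_product xs \<in> ideal_power I (Suc n)"
    using xs x by (simp only:) (intro list_product_in_ideal_power, auto)
qed (auto simp: right_diff_distrib intro: ideal_power_zero ideal_power_diff)

lemma ideal_power_Suc_mono:
  assumes I: "is_ideal I" and sub: "ideal_power I a \<subseteq> ideal_power I b" and ab: "1 \<le> a" "1 \<le> b"
  shows "ideal_power I (Suc a) \<subseteq> ideal_power I (Suc b)"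
proof (rule ideal_power_subset)
  show "is_ideal (ideal_power I (Suc b))" using I by (rule is_ideal_ideal_power) simp
  fix xs assume xs: "length xs = Suc a" "set xs \<subseteq> I"
  then obtain y ys where y: "xs = y # ys" by (cases xs) auto
  then have ys: "length ys = a" "set ys \<subseteq> I" "y \<in> I" "ys \<noteq> []" using xs ab by auto
  have "list_product ys \<in> ideal_power I b" using sub list_product_in_ideal_power [OF ys(1,2)] by blast
  then have "y * list_product ys \<in> ideal_power I (Suc b)" using ys(3) ab by (intro ideal_power_mult_left)
  then show "list_product xs \<in> ideal_power I (Suc b)" using ys by (simp add: y list_product_Cons)
qed

lemma ideal_power_add_mono:
  assumes "is_ideal I" "ideal_power I a \<subseteq> ideal_power I b" "1 \<le> a" "1 \<le> b"
  shows "ideal_power I (a + j) \<subseteq> ideal_power I (b + j)"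
proof (induction j)
  case (Suc j)
  then show ?case using ideal_power_Suc_mono [OF assms(1) Suc] assms(3,4) by simp
qed (use assms in simp)

lemma ideal_power_antimono:
  assumes I: "is_ideal I" and ab: "1 \<le> a" "a \<le> b"
  shows "ideal_power I b \<subseteq> ideal_power I a"
  using ab(2)
proof (induction b rule: dec_induct)
  case (step n)
  have "ideal_power I (Suc n) \<subseteq> ideal_power I n"
  proof (rule ideal_power_subset)
    show "is_ideal (ideal_power I n)" using I ab step by (intro is_ideal_ideal_power) auto
    fix xs assume xs: "length xs = Suc n" "set xs \<subseteq> I"
    then obtain y z zs where y: "xs = y # z # zs"
      using ab step by (metis length_Suc_conv Suc_le_D order_trans One_nat_def)
    have "list_product xs = list_product ((y * z) # zs)" unfolding y by (cases zs) (auto simp: mult.assoc)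
    then show "list_product xs \<in> ideal_power I n"
      using xs I by (simp only:) (intro list_product_in_ideal_power, auto simp: y ideal_mult_left)
  qed
  then show ?case using step by blast
qed simp

text \<open>Multiplying the equality by further powers of I raises the exponent in steps of n - m.
  After m steps it is at least 2m, as n - m is at least 1.\<close>

lemma ideal_power_stationary:
  assumes I: "is_ideal I" and mn: "1 \<le> m" "m < n" "ideal_power I m = ideal_power I n"
  shows "ideal_power I m \<subseteq> ideal_power I (m + m)"
proof -
  have "ideal_power I m \<subseteq> ideal_power I (m + k * (n - m))" for k
  proof (induction k)
    case (Suc k)
    have "ideal_power I (m + k * (n - m)) \<subseteq> ideal_power I (n + k * (n - m))"
      using mn by (intro ideal_power_add_mono I) auto
    also have "n + k * (n - m) = m + Suc k * (n - m)" using mn by simp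
    finally show ?case using Suc by (rule order_trans [rotated])
  qed simp
  from this [of m] have "ideal_power I m \<subseteq> ideal_power I (m + m * (n - m))" .
  also have "\<dots> \<subseteq> ideal_power I (m + m)" using mn by (intro ideal_power_antimono I) auto
  finally show ?thesis .
qed

lemma ideal_power_double_sum:
  assumes I: "is_ideal I" and m: "1 \<le> m" and x: "x \<in> ideal_power I (m + m)"
  shows "\<exists>ps. (\<forall>p\<in>set ps. fst p \<in> ideal_power I m \<and> snd p \<in> ideal_power I m) \<and> x = (\<Sum>p\<leftarrow>ps. fst p * snd p)"
  using x
proof (rule ideal_power_closure)
  fix xs assume xs: "length xs = m + m" "set xs \<subseteq> I"
  define ys zs where "ys = take m xs" and "zs = drop m xs"
  have yz: "xs = ys @ zs" "length ys = m" "length zs = m" using xs by (auto simp: ys_def zs_def)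
  then have "list_product xs = list_product ys * list_product zs"
    using m by (metis list_product_append One_nat_def Suc_n_not_le_n list.size(3) le_zero_eq nat.simps(3))
  moreover have "list_product ys \<in> ideal_power I m" "list_product zs \<in> ideal_power I m"
    using xs yz by (auto intro!: list_product_in_ideal_power)
  ultimately show "\<exists>ps. (\<forall>p\<in>set ps. fst p \<in> ideal_power I m \<and> snd p \<in> ideal_power I m)
      \<and> list_product xs = (\<Sum>p\<leftarrow>ps. fst p * snd p)"
    by (intro exI [of _ "[(list_product ys, list_product zs)]"]) auto
next
  fix x y
  let ?P = "\<lambda>x ps. (\<forall>p\<in>set ps. fst p \<in> ideal_power I m \<and> snd p \<in> ideal_power I m) \<and> x = (\<Sum>p\<leftarrow>ps. fst p * snd p)"
  assume "\<exists>ps. ?P x ps" "\<exists>ps. ?P y ps"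
  then obtain ps qs where ps: "?P x ps" and qs: "?P y qs" by blast
  have "(\<Sum>p\<leftarrow>map (\<lambda>p. (- fst p, snd p)) qs. fst p * snd p) = - (\<Sum>p\<leftarrow>qs. fst p * snd p)"
    by (induction qs) auto
  moreover have "- fst p \<in> ideal_power I m" if "p \<in> set qs" for p
    using qs that ideal_minus [OF is_ideal_ideal_power [OF I m]] by blast
  ultimately have "?P (x - y) (ps @ map (\<lambda>p. (- fst p, snd p)) qs)"
    using ps qs by auto
  then show "\<exists>ps. ?P (x - y) ps" ..
qed (auto intro: exI [of _ "[]"])

text \<open>A power of a sum b is not a sum of powers, but b^(11/16) is the sum of the y^(5/8)
  (y^(3/8) b^(-5/16)). The quotients exist because y^(3/4) is at most b^(3/4) and 2 * 5/16 < 3/4.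
  The resulting 11/16 still lies below 3/4.\<close>

lemma ppow_sum_list_mem:
  assumes J: "is_ideal J" and ys: "\<And>y. y \<in> set ys \<Longrightarrow> y \<in> positives \<and> ppow y (5/8) \<in> J"
  shows "ppow (\<Sum>y\<leftarrow>ys. y) (11/16) \<in> J"
proof -
  define b where "b = (\<Sum>y\<leftarrow>ys. y)"
  have b: "b \<in> positives" unfolding b_def using ys by (intro positives_sum_list) auto
  have "(\<Sum>y\<leftarrow>ys. ppow y (5/8) * pquot (5/16) b (ppow y (3/8))) = ppow b (1 - 5/16)"
  proof (rule sum_list_mult_pquot [OF b])
    show "dominated (5/16) b (ppow y (3/8))" if y: "y \<in> set ys" for y
    proof (rule dominatedI [of 1 _ "3/4"])
      have yp: "y \<in> positives" using y ys by auto
      have "cstar_le y b" unfolding b_def using y ys by (intro cstar_le_sum_list_member) auto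
      then have "cstar_le (ppow y (3/4)) (ppow b (3/4))"
        by (intro ppow_mono [where n = 1] yp b) (auto simp: power2_eq_square)
      moreover have "star (ppow y (3/8)) * ppow y (3/8) = ppow y (3/4)"
        using yp ppow_half_mult [of y "3/4"] by (simp add: star_ppow)
      ultimately show "cstar_le (star (ppow y (3/8)) * ppow y (3/8)) (1 *\<^sub>R ppow b (3/4))" by simp
    qed auto
    have "map (\<lambda>y. ppow y (5/8) * ppow y (3/8)) ys = map (\<lambda>y. y) ys"
      using ys by (intro map_cong) (auto simp flip: ppow_add)
    then show "(\<Sum>y\<leftarrow>ys. ppow y (5/8) * ppow y (3/8)) = ppow b 1" using b by (simp add: b_def)
  qed auto
  moreover have "(\<Sum>y\<leftarrow>ys. ppow y (5/8) * pquot (5/16) b (ppow y (3/8))) \<in> J"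
    using ys J by (intro ideal_sum_list) (auto intro: ideal_mult_right)
  ultimately show ?thesis by (simp add: b_def)
qed

text \<open>Each pair p, q contributes the inequality that expands (p^* - q)^* (p^* - q) being
  positive.\<close>

lemma sum_list_products_le:
  "cstar_le ((\<Sum>p\<leftarrow>ps. fst p * snd p) + star (\<Sum>p\<leftarrow>ps. fst p * snd p))
    (\<Sum>y\<leftarrow>concat (map (\<lambda>p. [fst p * star (fst p), star (snd p) * snd p]) ps). y)"
proof (induction ps)
  case (Cons p ps)
  have "cstar_le (fst p * snd p + star (fst p * snd p)) (fst p * star (fst p) + star (snd p) * snd p)"
    using positives_star_mult_self [of "star (fst p) - snd p"]
    by (simp add: cstar_le_def star_diff star_mult star_star algebra_simps)
  from cstar_le_add [OF this Cons] show ?case by (simp add: star_add algebra_simps)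
qed simp

lemma factors_weakly_closed_under_square_roots:
  assumes J: "is_ideal J"
    and fac: "\<And>x. x \<in> J \<Longrightarrow> \<exists>ps. (\<forall>p\<in>set ps. fst p \<in> J \<and> snd p \<in> J) \<and> x = (\<Sum>p\<leftarrow>ps. fst p * snd p)"
  shows "closed_under_square_roots J"
proof -
  have step: "ppow y (3/4) \<in> J" if y: "y \<in> J" "y \<in> positives" for y
  proof -
    obtain ps where ps: "\<forall>p\<in>set ps. fst p \<in> J \<and> snd p \<in> J" "y = (\<Sum>p\<leftarrow>ps. fst p * snd p)"
      using fac [OF y(1)] by blast
    define ys where "ys = concat (map (\<lambda>p. [fst p * star (fst p), star (snd p) * snd p]) ps)"
    have ys: "z \<in> positives \<and> ppow z (5/8) \<in> J" if "z \<in> set ys" for z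
      using that ps(1) ideal_ppow_star_mult_self [OF J, of _ "5/8"]
      by (auto simp: ys_def positives_star_mult_self positives_mult_star_self)
    have "cstar_le (y + star y) (\<Sum>z\<leftarrow>ys. z)" unfolding ys_def ps(2) by (rule sum_list_products_le)
    then have "cstar_le ((1/2) *\<^sub>R (y + star y)) ((1/2) *\<^sub>R (\<Sum>z\<leftarrow>ys. z))" by (rule cstar_le_scaleR) simp
    then have "cstar_le y ((1/2) *\<^sub>R (\<Sum>z\<leftarrow>ys. z))" using y(2) by (simp add: positives_star flip: scaleR_2)
    then have "1 *\<^sub>C ppow y (3/4) \<in> J"
      using ys by (intro ideal_ppow_hereditary [OF J y(2), of "\<Sum>z\<leftarrow>ys. z" "1/2" _ 1 "11/16"]
          positives_sum_list ppow_sum_list_mem J) (auto simp: power2_eq_square)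
    then show ?thesis by simp
  qed
  show ?thesis unfolding closed_under_square_roots_iff
  proof (intro ballI impI)
    fix a assume a: "a \<in> J" "a \<in> positives"
    \<comment> \<open>Three rounds, since 27/64 is the first power of 3/4 below 1/2.\<close>
    have "ppow (ppow (ppow a (3/4)) (3/4)) (3/4) \<in> J" using a by (intro step ppow_positives) auto
    then have "ppow a (27/64) \<in> J" using a by (simp add: ppow_ppow ppow_positives)
    then show "ppow a (1/2) \<in> J" by (rule ideal_ppow_increase_real [OF J a(2)]) auto
  qed
qed

text \<open>In fact I = I^m. The power I^m is closed under roots because it factors weakly, and for
  x in I it contains the m-th power of \<open>star x * x\<close>, hence \<open>star x * x\<close>,
  hence x.\<close>

lemma stationary_powers_closed_under_square_roots:
  assumes I: "is_ideal I" and mn: "1 \<le> m" "m < n" "ideal_power I m = ideal_power I n"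
  shows "closed_under_square_roots I"
proof -
  define J where "J = ideal_power I m"
  have J: "is_ideal J" unfolding J_def using I mn(1) by (rule is_ideal_ideal_power)
  have Jc: "closed_under_square_roots J"
    using ideal_power_double_sum [OF I mn(1)] ideal_power_stationary [OF I mn]
    by (intro factors_weakly_closed_under_square_roots [OF J]) (auto simp: J_def)
  have "J \<subseteq> I" unfolding J_def using ideal_power_antimono [OF I _ mn(1)] ideal_power_one [OF I] by simp
  moreover have "x \<in> J" if x: "x \<in> I" for x
  proof -
    let ?s = "star x * x"
    have s: "?s \<in> I" "?s \<in> positives" using x I by (auto simp: ideal_mult_left positives_star_mult_self)
    obtain k where k: "m = Suc k" using mn(1) by (cases m) auto
    have "list_product (replicate m ?s) \<in> J" unfolding J_def using s by (intro list_product_in_ideal_power) auto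
    then have "ppow ?s m \<in> J" using s list_product_replicate [of ?s k] unfolding k by metis
    then have "ppow (ppow ?s m) (1 / m) \<in> J"
      using mn(1) s by (intro sqrt_closed_ppow_real [OF J Jc, of "ppow ?s m"] ppow_positives) auto
    then have "?s \<in> J" using mn(1) s by (simp add: ppow_ppow)
    then show "x \<in> J" by (rule sqrt_closed_mem [OF J Jc])
  qed
  ultimately show ?thesis using Jc by (metis subsetI subset_antisym)
qed

section \<open>Constructing Dixmier ideals\<close>

text \<open>A set \<open>G\<close> as below generates a Dixmier ideal by its squares \<open>w\<^sup>* w\<close>. It is not required to be closed
  under addition, which would be hard to verify for the sets used here.\<close>

definition dixmier_root :: "'a::cstar_algebra set \<Rightarrow> bool"
  where "dixmier_root G \<longleftrightarrow> 0 \<in> G \<and> (\<forall>w\<in>G. star w \<in> G) \<and>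
    (\<forall>w\<in>G. \<forall>x C. 0 \<le> C \<longrightarrow> cstar_le (star x * x) (C *\<^sub>R (star w * w)) \<longrightarrow> x \<in> G)"

definition square_sums :: "'a::cstar_algebra set \<Rightarrow> 'a set"
  where "square_sums G = {\<Sum>w\<leftarrow>ws. star w * w | ws. set ws \<subseteq> G}"

lemma square_sumsI: "set ws \<subseteq> G \<Longrightarrow> (\<Sum>w\<leftarrow>ws. star w * w) \<in> square_sums G"
  by (auto simp: square_sums_def)

lemma square_in_square_sums: "w \<in> G \<Longrightarrow> star w * w \<in> square_sums G"
  using square_sumsI [of "[w]" G] by simp

lemma square_sums_positives: "square_sums G \<subseteq> positives"
  by (auto simp: square_sums_def intro!: positives_sum_list positives_star_mult_self)

lemma square_sums_zero: "0 \<in> square_sums G"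
  using square_sumsI [of "[]" G] by simp

lemma square_sums_add: "x \<in> square_sums G \<Longrightarrow> y \<in> square_sums G \<Longrightarrow> x + y \<in> square_sums G"
proof -
  assume "x \<in> square_sums G" "y \<in> square_sums G"
  then obtain vs ws where "set vs \<subseteq> G" "set ws \<subseteq> G" "x = (\<Sum>w\<leftarrow>vs. star w * w)" "y = (\<Sum>w\<leftarrow>ws. star w * w)"
    by (auto simp: square_sums_def)
  then show ?thesis using square_sumsI [of "vs @ ws" G] by simp
qed

context
  fixes G :: "'a::cstar_algebra set"
  assumes G: "dixmier_root G"
begin

lemma root_star: "w \<in> G \<Longrightarrow> star w \<in> G"
  using G by (simp add: dixmier_root_def)

lemma root_dominated: "w \<in> G \<Longrightarrow> 0 \<le> C \<Longrightarrow> cstar_le (star x * x) (C *\<^sub>R (star w * w)) \<Longrightarrow> x \<in> G"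
  using G by (auto simp: dixmier_root_def)

lemma root_star_dominated: "w \<in> G \<Longrightarrow> cstar_le (x * star x) (w * star w) \<Longrightarrow> x \<in> G"
  using root_star [of "star x"] root_dominated [of "star w" 1 "star x"] root_star by (simp add: star_star)

text \<open>The element is w (a + c) with a + c in the unitization. Polarizing a (star w * w)
  produces such elements, since one of the factors is w itself.\<close>

lemma root_mult_add:
  assumes w: "w \<in> G"
  shows "w * a + c *\<^sub>C w \<in> G"
proof -
  define s p q where "s = star w" and "p = star a * s" and "q = cnj c *\<^sub>C s"
  have 1: "cstar_le (star (p + q) * (p + q)) (2 *\<^sub>R (star p * p) + 2 *\<^sub>R (star q * q))"
    using positives_star_mult_self [of "p - q"]
    by (simp add: cstar_le_def star_diff star_add algebra_simps scaleR_2)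
  have 2: "cstar_le (star p * p) ((norm a)\<^sup>2 *\<^sub>R (star s * s))"
    unfolding p_def using star_mult_self_mult_le [of "star a" s] by simp
  have 3: "star q * q = (cmod c)\<^sup>2 *\<^sub>R (star s * s)"
    using complex_norm_square [of c]
    by (simp add: q_def star_scaleC mult_scaleC_left mult_scaleC_right scaleC_scaleC mult.commute
        flip: scaleC_of_real)
  have "cstar_le (star (p + q) * (p + q))
      (2 *\<^sub>R ((norm a)\<^sup>2 *\<^sub>R (star s * s)) + 2 *\<^sub>R ((cmod c)\<^sup>2 *\<^sub>R (star s * s)))"
    unfolding 3 [symmetric]
    by (rule cstar_le_trans [OF 1 cstar_le_add [OF cstar_le_scaleR [OF 2] cstar_le_refl]]) simp
  also have "\<dots> = (2 * (norm a)\<^sup>2 + 2 * (cmod c)\<^sup>2) *\<^sub>R (star s * s)"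
    by (simp add: scaleR_add_left)
  finally have "cstar_le (star (p + q) * (p + q)) ((2 * (norm a)\<^sup>2 + 2 * (cmod c)\<^sup>2) *\<^sub>R (star s * s))" .
  moreover have "s \<in> G" unfolding s_def using w by (rule root_star)
  ultimately have "p + q \<in> G" using root_dominated [of s "2 * (norm a)\<^sup>2 + 2 * (cmod c)\<^sup>2" "p + q"] by simp
  then have "star (p + q) \<in> G" by (rule root_star)
  then show ?thesis by (simp add: p_def q_def s_def star_add star_mult star_scaleC star_star)
qed

lemma square_sums_scaleR:
  assumes "x \<in> square_sums G" "0 \<le> r"
  shows "r *\<^sub>R x \<in> square_sums G"
proof -
  obtain ws where ws: "set ws \<subseteq> G" "x = (\<Sum>w\<leftarrow>ws. star w * w)" using assms by (auto simp: square_sums_def)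
  have "sqrt r *\<^sub>R w \<in> G" if "w \<in> G" for w
    using root_mult_add [OF that, of 0 "of_real (sqrt r)"] by (simp add: scaleC_of_real)
  then have "set (map (\<lambda>w. sqrt r *\<^sub>R w) ws) \<subseteq> G" using ws by auto
  then have "(\<Sum>w\<leftarrow>map (\<lambda>w. sqrt r *\<^sub>R w) ws. star w * w) \<in> square_sums G" by (rule square_sumsI)
  also have "(\<Sum>w\<leftarrow>map (\<lambda>w. sqrt r *\<^sub>R w) ws. star w * w) = r *\<^sub>R x"
    unfolding ws(2) using assms(2) by (induction ws) (simp_all add: scaleR_add_right)
  finally show ?thesis .
qed

text \<open>The Riesz decomposition writes x x^* as a sum of squares of elements k with k k^* below
  some w w^*, so k lies in G. With x a positive square root this is heredity; with equality in the
  hypothesis it is strong invariance.\<close>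

lemma square_sums_flip:
  assumes m: "m \<in> square_sums G" and le: "cstar_le (star x * x) m"
  shows "x * star x \<in> square_sums G"
proof -
  obtain ws where ws: "set ws \<subseteq> G" "m = (\<Sum>w\<leftarrow>ws. star w * w)" using m by (auto simp: square_sums_def)
  obtain k where k: "x * star x = (\<Sum>w\<leftarrow>ws. star (k w) * k w)"
    "\<And>w. w \<in> set ws \<Longrightarrow> cstar_le (k w * star (k w)) (w * star w)"
    using riesz_decomposition le unfolding ws(2) by blast
  have "set (map k ws) \<subseteq> G" using ws k(2) root_star_dominated by auto
  from square_sumsI [OF this] show ?thesis by (simp add: k(1) comp_def)
qed

lemma square_sums_hereditary:
  assumes "m \<in> square_sums G" "y \<in> positives" "cstar_le y m"
  shows "y \<in> square_sums G"
proof -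
  have "ppow y (1/2) * ppow y (1/2) = y" "star (ppow y (1/2)) = ppow y (1/2)"
    using assms(2) ppow_half_mult [of y 1] by (simp_all add: star_ppow)
  then show ?thesis using square_sums_flip [OF assms(1), of "ppow y (1/2)"] assms(3) by simp
qed

text \<open>Passing to the span creates no new positive elements. V consists of the x for which c x
  + (c x)^* is dominated by a square sum for every c; quantifying over all c makes V a complex
  subspace. For positive y the choice c = 1/2 puts y itself below a square sum, and heredity
  applies.\<close>

lemma span_square_sums_positives: "complex_span (square_sums G) \<inter> positives = square_sums G"
proof
  define V where "V = {x. \<forall>c. \<exists>m\<in>square_sums G. cstar_le (c *\<^sub>C x + star (c *\<^sub>C x)) m}"
  have "complex_space.subspace V"
  proof (rule complex_space.subspaceI)
    show "0 \<in> V" by (auto simp: V_def intro!: bexI [OF _ square_sums_zero])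
    show "x + y \<in> V" if xy: "x \<in> V" "y \<in> V" for x y
      unfolding V_def
    proof (intro CollectI allI)
      fix c
      obtain m n where mn: "m \<in> square_sums G" "cstar_le (c *\<^sub>C x + star (c *\<^sub>C x)) m"
        "n \<in> square_sums G" "cstar_le (c *\<^sub>C y + star (c *\<^sub>C y)) n"
        using xy unfolding V_def by blast
      have "c *\<^sub>C (x + y) + star (c *\<^sub>C (x + y)) = (c *\<^sub>C x + star (c *\<^sub>C x)) + (c *\<^sub>C y + star (c *\<^sub>C y))"
        by (simp add: scaleC_add_right star_add)
      then show "\<exists>m\<in>square_sums G. cstar_le (c *\<^sub>C (x + y) + star (c *\<^sub>C (x + y))) m"
        using mn cstar_le_add square_sums_add by metis
    qed
    show "c *\<^sub>C x \<in> V" if "x \<in> V" for c x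
      using that by (auto simp: V_def scaleC_scaleC)
  qed
  moreover have "square_sums G \<subseteq> V"
  proof
    fix m assume m: "m \<in> square_sums G"
    have mp: "m \<in> positives" using m square_sums_positives by blast
    show "m \<in> V" unfolding V_def
    proof (intro CollectI allI bexI)
      fix c
      show "(2 * \<bar>Re c\<bar>) *\<^sub>R m \<in> square_sums G" using m by (intro square_sums_scaleR) auto
      have "c *\<^sub>C m + star (c *\<^sub>C m) = (2 * Re c) *\<^sub>R m"
        using mp by (simp add: star_scaleC positives_star complex_add_cnj flip: scaleC_add_left scaleC_of_real)
      moreover have "(2 * \<bar>Re c\<bar>) *\<^sub>R m - (2 * Re c) *\<^sub>R m \<in> positives"
        using mp unfolding scaleR_diff_left [symmetric] by (intro positives_scaleR) auto
      ultimately show "cstar_le (c *\<^sub>C m + star (c *\<^sub>C m)) ((2 * \<bar>Re c\<bar>) *\<^sub>R m)"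
        by (simp add: cstar_le_def)
    qed
  qed
  ultimately have V: "complex_span (square_sums G) \<subseteq> V" by (intro complex_space.span_minimal)
  show "complex_span (square_sums G) \<inter> positives \<subseteq> square_sums G"
  proof
    fix y assume y: "y \<in> complex_span (square_sums G) \<inter> positives"
    then have "\<exists>m\<in>square_sums G. cstar_le (of_real (1/2) *\<^sub>C y + star (of_real (1/2) *\<^sub>C y)) m"
      using V by (auto simp: V_def)
    then obtain m where m: "m \<in> square_sums G" "cstar_le ((1/2) *\<^sub>R y + star ((1/2) *\<^sub>R y)) m"
      unfolding scaleC_of_real by blast
    have "(1/2) *\<^sub>R y + star ((1/2) *\<^sub>R y) = y" using y by (simp add: positives_star flip: scaleR_add_left)
    then have "cstar_le y m" using m(2) by (simp only:)
    then show "y \<in> square_sums G" using m(1) y square_sums_hereditary by blast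
  qed
  show "square_sums G \<subseteq> complex_span (square_sums G) \<inter> positives"
    using square_sums_positives complex_space.span_superset by blast
qed

lemma is_ideal_span_square_sums: "is_ideal (complex_span (square_sums G))"
proof -
  let ?J = "complex_span (square_sums G)"
  have v: "star (w * a + c *\<^sub>C w) * (w * b + d *\<^sub>C w) \<in> ?J" if w: "w \<in> G" for w a b c d
  proof -
    let ?y = "w * a + c *\<^sub>C w" and ?z = "w * b + d *\<^sub>C w"
    have sq: "star x * x \<in> ?J" if "x = w * e + f *\<^sub>C w" for x e f
      using that w root_mult_add by (intro complex_space.span_base square_in_square_sums) auto
    have "star (?y + ?z) * (?y + ?z) \<in> ?J"
      by (rule sq [of _ "a + b" "c + d"]) (simp add: algebra_simps scaleC_add_left)
    moreover have "star (?z - ?y) * (?z - ?y) \<in> ?J"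
      by (rule sq [of _ "b - a" "d + - c"]) (simp add: algebra_simps scaleC_add_left)
    moreover have "star (\<i> *\<^sub>C ?y + ?z) * (\<i> *\<^sub>C ?y + ?z) \<in> ?J"
      by (rule sq [of _ "\<i> *\<^sub>C a + b" "\<i> * c + d"])
        (simp add: algebra_simps scaleC_add_left scaleC_add_right scaleC_scaleC mult_scaleC_right)
    moreover have "star (?z - \<i> *\<^sub>C ?y) * (?z - \<i> *\<^sub>C ?y) \<in> ?J"
      by (rule sq [of _ "b - \<i> *\<^sub>C a" "d + - (\<i> * c)"])
        (simp add: algebra_simps scaleC_add_left scaleC_add_right scaleC_scaleC mult_scaleC_right)
    ultimately have "4 *\<^sub>R (star ?y * ?z) \<in> ?J"
      unfolding star_mult_polarization
      by (intro complex_space.span_add complex_space.span_diff complex_space.span_scale)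
    then have "complex_of_real (1/4) *\<^sub>C (4 *\<^sub>R (star ?y * ?z)) \<in> ?J" by (rule complex_space.span_scale)
    then show ?thesis unfolding scaleC_of_real by simp
  qed
  have gen: "a * (star w * w) \<in> ?J" "star w * w * a \<in> ?J" if "w \<in> G" for a w
    using v [OF that, of "star a" 0 0 1] v [OF that, of 0 1 a 0]
    by (simp_all add: star_mult star_star mult.assoc)
  have mult: "a * m \<in> ?J" "m * a \<in> ?J" if m: "m \<in> square_sums G" for a m
  proof -
    obtain ws where ws: "set ws \<subseteq> G" "m = (\<Sum>w\<leftarrow>ws. star w * w)" using m by (auto simp: square_sums_def)
    have "a * (\<Sum>w\<leftarrow>ws. star w * w) \<in> ?J \<and> (\<Sum>w\<leftarrow>ws. star w * w) * a \<in> ?J"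
      using ws(1) by (induction ws) (auto simp: distrib_left distrib_right gen
          intro!: complex_space.span_add complex_space.span_zero)
    then show "a * m \<in> ?J" "m * a \<in> ?J" by (simp_all add: ws(2))
  qed
  have "complex_space.subspace {x. a * x \<in> ?J \<and> x * a \<in> ?J}" for a
    by (rule complex_space.subspaceI)
      (auto simp: distrib_left distrib_right mult_scaleC_left mult_scaleC_right
        intro: complex_space.span_add complex_space.span_zero complex_space.span_scale)
  then have "?J \<subseteq> {x. a * x \<in> ?J \<and> x * a \<in> ?J}" for a
    using mult by (intro complex_space.span_minimal) auto
  then show ?thesis
    unfolding is_ideal_def
    by (auto intro: complex_space.span_add complex_space.span_zero complex_space.span_neg)
qed

lemma dixmier_ideal_span_square_sums: "dixmier_ideal (complex_span (square_sums G))"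
  unfolding dixmier_ideal_def span_square_sums_positives
proof (intro conjI refl is_ideal_span_square_sums)
  show "order_ideal (square_sums G)"
    unfolding order_ideal_def
    using square_sums_positives square_sums_zero square_sums_add square_sums_hereditary by blast
  show "strongly_invariant (square_sums G)"
    unfolding strongly_invariant_def
    using square_sums_flip square_sums_flip [of _ "star _"] by (metis cstar_le_refl star_star)
qed

end

section \<open>Dixmier ideals below and above a given ideal\<close>

definition lower_root :: "'a::cstar_algebra set \<Rightarrow> 'a set"
  where "lower_root I = {w. \<exists>r. 0 < r \<and> r < 1 \<and> ppow (star w * w) r \<in> I}"

definition upper_root :: "'a::cstar_algebra set \<Rightarrow> 'a set"
  where "upper_root D = {w. \<exists>r. 0 < r \<and> r < 2 \<and> ppow (star w * w) r \<in> D}"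

lemma one_minus_half_power_dense:
  fixes r :: real
  assumes "r < 1"
  obtains n \<theta> where "\<theta> = 1 - (1/2) ^ Suc n" "r < \<theta>" "\<theta> < 1"
proof -
  obtain n where n: "(1/2) ^ n < 1 - r" using real_arch_pow_inv [of "1 - r" "1/2"] assms by auto
  have "(1/2::real) ^ Suc n \<le> (1/2) ^ n" "0 < (1/2::real) ^ Suc n" by auto
  then show ?thesis using n that [OF refl, of n] by linarith
qed

text \<open>The strict bound r < 1 is an open condition, so it survives the arbitrarily small
  increases of r caused by the adjoint and by domination.\<close>

lemma dixmier_root_lower_root:
  assumes I: "is_ideal I"
  shows "dixmier_root (lower_root I)"
  unfolding dixmier_root_def
proof (intro conjI ballI allI impI)
  show "0 \<in> lower_root I" using I by (auto simp: lower_root_def ideal_zero intro!: exI [of _ "1/2"])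
next
  fix w assume "w \<in> lower_root I"
  then obtain r where r: "0 < r" "r < 1" "ppow (star w * w) r \<in> I" by (auto simp: lower_root_def)
  then obtain s where s: "r < s" "s < 1" using dense by blast
  then have "ppow (star (star w) * star w) s \<in> I"
    using r by (intro ideal_ppow_flip [OF I, of r]) (auto simp: star_star)
  then show "star w \<in> lower_root I" using r s unfolding lower_root_def by (intro CollectI exI [of _ s]) auto
next
  fix w x and C :: real
  assume "w \<in> lower_root I" and C: "0 \<le> C" and le: "cstar_le (star x * x) (C *\<^sub>R (star w * w))"
  then obtain r where r: "0 < r" "r < 1" "ppow (star w * w) r \<in> I" by (auto simp: lower_root_def)
  obtain n \<theta> where \<theta>: "\<theta> = 1 - (1/2) ^ Suc n" "r < \<theta>" "\<theta> < 1" using one_minus_half_power_dense [OF r(2)] .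
  have "1 *\<^sub>C ppow (star x * x) \<theta> \<in> I"
    using \<theta> r by (intro ideal_ppow_hereditary [OF I _ _ C le, of _ n r]) (auto simp: positives_star_mult_self)
  then show "x \<in> lower_root I" using r \<theta> by (auto simp: lower_root_def intro!: exI [of _ \<theta>])
qed

lemma dixmier_is_ideal: "dixmier_ideal D \<Longrightarrow> is_ideal D"
  unfolding dixmier_ideal_def by blast

lemma dixmier_hereditary:
  assumes D: "dixmier_ideal D" and "a \<in> positives" "b \<in> positives" "cstar_le a b" "b \<in> D"
  shows "a \<in> D"
  using assms unfolding dixmier_ideal_def order_ideal_def by blast

lemma dixmier_scaleR:
  assumes D: "dixmier_ideal D" and x: "x \<in> D"
  shows "r *\<^sub>R x \<in> D"
proof -
  have "complex_span (D \<inter> positives) = D" using D unfolding dixmier_ideal_def by blast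
  then show ?thesis using complex_space.span_scale x scaleC_of_real by metis
qed

lemma dixmier_root_upper_root:
  assumes D: "dixmier_ideal D"
  shows "dixmier_root (upper_root D)"
  unfolding dixmier_root_def
proof (intro conjI ballI allI impI)
  have I: "is_ideal D" by (rule dixmier_is_ideal [OF D])
  show "0 \<in> upper_root D" using I by (auto simp: upper_root_def ideal_zero intro!: exI [of _ "1"])
  {
    fix w assume "w \<in> upper_root D"
    then obtain r where r: "0 < r" "r < 2" "ppow (star w * w) r \<in> D" by (auto simp: upper_root_def)
    then obtain s where s: "r < s" "s < 2" using dense by blast
    then have "ppow (star (star w) * star w) s \<in> D"
      using r by (intro ideal_ppow_flip [OF I, of r]) (auto simp: star_star)
    then show "star w \<in> upper_root D" using r s unfolding upper_root_def by (intro CollectI exI [of _ s]) auto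
  }
  fix w x and C :: real
  assume "w \<in> upper_root D" and C: "0 \<le> C" and le: "cstar_le (star x * x) (C *\<^sub>R (star w * w))"
  then obtain r where r: "0 < r" "r < 2" "ppow (star w * w) r \<in> D" by (auto simp: upper_root_def)
  define a b where "a = star x * x" and "b = star w * w"
  have a: "a \<in> positives" and b: "b \<in> positives" by (simp_all add: a_def b_def positives_star_mult_self)
  have "r / 2 < 1" using r by simp
  then obtain n \<theta> where \<theta>: "\<theta> = 1 - (1/2) ^ Suc n" "r / 2 < \<theta>" "\<theta> < 1" using one_minus_half_power_dense by blast
  have \<theta>0: "0 < \<theta>" using r(1) \<theta>(2) by simp
  obtain \<tau> where \<tau>: "r / 2 < \<tau>" "\<tau> < \<theta>" using dense \<theta>(2) by blast
  obtain u where u: "ppow a \<theta> = u * ppow b \<tau> * star u"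
    using ppow_dominated_factor [OF a b C, of \<theta> n \<tau>] le \<theta> \<tau> r by (auto simp: a_def b_def)
  define p where "p = ppow b \<tau>"
  have p: "star p = p" "p * p = ppow b (2 * \<tau>)"
    using b \<tau> r ppow_half_mult [of b "2 * \<tau>"] by (simp_all add: p_def star_ppow)
  have p2: "u * (p * p) * star u \<in> D"
    unfolding p(2) using ideal_ppow_increase_real [OF I b, of r "2 * \<tau>"] r \<tau>
    by (simp add: b_def ideal_mult_left ideal_mult_right I)
  have "ppow a (2 * \<theta>) = ppow a \<theta> * ppow a \<theta>"
    using a \<theta>0 ppow_half_mult [of a "2 * \<theta>"] by simp
  also have "\<dots> = star (p * star u) * (star u * u) * (p * star u)"
    by (simp add: u star_mult star_star p(1) mult.assoc flip: p_def)
  finally have eq: "ppow a (2 * \<theta>) = star (p * star u) * (star u * u) * (p * star u)" .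
  have "cstar_le (ppow a (2 * \<theta>)) (norm (star u * u) *\<^sub>R (star (p * star u) * (p * star u)))"
    unfolding eq by (rule conj_le_norm [OF positives_star_mult_self])
  moreover have "star (p * star u) * (p * star u) = u * (p * p) * star u"
    by (simp add: star_mult star_star p(1) mult.assoc)
  ultimately have "ppow a (2 * \<theta>) \<in> D"
    using a \<theta>0 positives_star_mult_self [of "p * star u"]
    by (intro dixmier_hereditary [OF D _ _ _ dixmier_scaleR [OF D p2]]) (auto simp: ppow_positives positives_scaleR)
  then show "x \<in> upper_root D" using \<theta>0 \<theta>(3) unfolding upper_root_def a_def
    by (intro CollectI exI [of _ "2 * \<theta>"]) auto
qed

definition lower_dixmier :: "'a::cstar_algebra set \<Rightarrow> 'a set"
  where "lower_dixmier I = complex_span (square_sums (lower_root I))"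

text \<open>Built on \<open>lower_dixmier I\<close> rather than on I, because
  \<open>dixmier_root_upper_root\<close> draws on the heredity of a Dixmier ideal.\<close>

definition upper_dixmier :: "'a::cstar_algebra set \<Rightarrow> 'a set"
  where "upper_dixmier I = complex_span (square_sums (upper_root (lower_dixmier I)))"

context
  fixes I :: "'a::cstar_algebra set"
  assumes I: "is_ideal I"
begin

lemma dixmier_lower_dixmier: "dixmier_ideal (lower_dixmier I)"
  unfolding lower_dixmier_def by (intro dixmier_ideal_span_square_sums dixmier_root_lower_root I)

lemma dixmier_upper_dixmier: "dixmier_ideal (upper_dixmier I)"
  unfolding upper_dixmier_def
  by (intro dixmier_ideal_span_square_sums dixmier_root_upper_root dixmier_lower_dixmier)

lemma lower_dixmier_subset: "lower_dixmier I \<subseteq> I"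
proof -
  have sq: "c *\<^sub>C (star w * w) \<in> I" if w: "w \<in> lower_root I" for c w
  proof -
    obtain r where "0 < r" "r < 1" "ppow (star w * w) r \<in> I" using w by (auto simp: lower_root_def)
    then have "c *\<^sub>C ppow (star w * w) 1 \<in> I"
      by (intro ideal_ppow_increase [OF I positives_star_mult_self, of w r]) auto
    then show ?thesis by (simp add: positives_star_mult_self)
  qed
  \<comment> \<open>I is not known to be a complex subspace, so its largest complex subspace is
    used.\<close>
  define V where "V = {x. \<forall>c. c *\<^sub>C x \<in> I}"
  have "complex_space.subspace V"
    by (rule complex_space.subspaceI) (auto simp: V_def I ideal_zero ideal_add scaleC_add_right scaleC_scaleC)
  moreover have "m \<in> V" if m: "m \<in> square_sums (lower_root I)" for m
  proof -
    obtain ws where ws: "set ws \<subseteq> lower_root I" "m = (\<Sum>w\<leftarrow>ws. star w * w)"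
      using m by (auto simp: square_sums_def)
    have "(\<Sum>w\<leftarrow>ws. star w * w) \<in> V"
      using ws(1) by (induction ws) (auto simp: V_def I ideal_zero ideal_add scaleC_add_right sq)
    then show ?thesis by (simp add: ws)
  qed
  ultimately have "lower_dixmier I \<subseteq> V"
    unfolding lower_dixmier_def by (intro complex_space.span_minimal) auto
  moreover have "V \<subseteq> I" by (auto simp: V_def dest: spec [of _ 1])
  ultimately show ?thesis by blast
qed

lemma ppow_mem_lower_dixmier:
  assumes a: "a \<in> positives" and s: "0 < s" "s < t" and aI: "ppow a s \<in> I"
  shows "ppow a t \<in> lower_dixmier I"
proof -
  let ?w = "ppow a (t / 2)"
  have w: "star ?w * ?w = ppow a t" using a s by (simp add: star_ppow ppow_half_mult)
  have "ppow (ppow a t) (s / t) \<in> I" using a s aI by (simp add: ppow_ppow)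
  then have "?w \<in> lower_root I" using s by (auto simp: lower_root_def w intro!: exI [of _ "s / t"])
  then have "star ?w * ?w \<in> lower_dixmier I"
    unfolding lower_dixmier_def by (intro complex_space.span_base square_in_square_sums)
  then show ?thesis by (simp only: w)
qed

lemma subset_upper_dixmier: "I \<subseteq> upper_dixmier I"
proof
  fix x assume x: "x \<in> I"
  let ?y = "star x * x"
  have y: "?y \<in> positives" by (rule positives_star_mult_self)
  have "ppow ?y (5/8) \<in> I" using ideal_ppow_star_mult_self [OF I x] by simp
  then have y34: "ppow ?y (3/4) \<in> lower_dixmier I" by (rule ppow_mem_lower_dixmier [OF y, rotated 2]) auto
  \<comment> \<open>Below, 7/16 has to be less than 1/2 for x to factor through it, and more than
    3/8 for the quotient (3/4)/(7/16) = 12/7 to be less than 2.\<close>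
  let ?w = "ppow ?y (7/32)"
  have w: "star ?w * ?w = ppow ?y (7/16)" using y ppow_half_mult [of ?y "7/16"] by (simp add: star_ppow)
  have "ppow (ppow ?y (7/16)) (12/7) \<in> lower_dixmier I" using y y34 by (simp add: ppow_ppow)
  then have "?w \<in> upper_root (lower_dixmier I)" by (auto simp: upper_root_def w intro!: exI [of _ "12/7"])
  then have "star ?w * ?w \<in> upper_dixmier I"
    unfolding upper_dixmier_def by (intro complex_space.span_base square_in_square_sums)
  moreover obtain u where "x = u * ppow ?y (7/16)" using polar_decomposition [of "7/16" x] by auto
  moreover have "is_ideal (upper_dixmier I)" by (rule dixmier_is_ideal [OF dixmier_upper_dixmier])
  ultimately show "x \<in> upper_dixmier I" unfolding w by (metis ideal_mult_left)
qed

text \<open>A positive m of the upper ideal is a sum of squares y whose own squares lie in the lower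
  one. The inequality (y + z)^2 \<le> 2 (y^2 + z^2) and heredity carry this over to sums.\<close>

lemma square_mem_lower_dixmier:
  assumes m: "m \<in> upper_dixmier I" "m \<in> positives"
  shows "m * m \<in> lower_dixmier I"
proof -
  let ?D = "lower_dixmier I"
  note D = dixmier_lower_dixmier and ID = dixmier_is_ideal [OF dixmier_lower_dixmier]
  have "m \<in> square_sums (upper_root ?D)"
    using m span_square_sums_positives [OF dixmier_root_upper_root [OF D]] by (auto simp: upper_dixmier_def)
  then obtain ws where ws: "set ws \<subseteq> upper_root ?D" "m = (\<Sum>w\<leftarrow>ws. star w * w)"
    by (auto simp: square_sums_def)
  have "(\<Sum>w\<leftarrow>ws. star w * w) * (\<Sum>w\<leftarrow>ws. star w * w) \<in> ?D"
    using ws(1)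
  proof (induction ws)
    case (Cons w ws)
    define y z where "y = star w * w" and "z = (\<Sum>w\<leftarrow>ws. star w * w)"
    have y: "y \<in> positives" and z: "z \<in> positives"
      by (auto simp: y_def z_def intro!: positives_sum_list positives_star_mult_self)
    have pos: "v * v \<in> positives" if "star v = v" for v :: 'a using positives_star_mult_self [of v] that by simp
    have sa: "star (y + z) = y + z" "star (y - z) = y - z" "star y = y" "star z = z"
      using y z by (simp_all add: star_add star_diff positives_star)
    obtain r where "0 < r" "r < 2" "ppow y r \<in> ?D" using Cons.prems by (auto simp: upper_root_def y_def)
    then have "ppow y 2 \<in> ?D" using ideal_ppow_increase_real [OF ID y, of r 2] by simp
    then have "y * y \<in> ?D" using y by (simp add: ppow_two)
    moreover have "z * z \<in> ?D" using Cons by (simp add: z_def)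
    ultimately have "2 *\<^sub>R (y * y + z * z) \<in> ?D" by (intro dixmier_scaleR [OF D] ideal_add [OF ID])
    moreover have "cstar_le ((y + z) * (y + z)) (2 *\<^sub>R (y * y + z * z))"
      using pos [OF sa(2)] by (simp add: cstar_le_def algebra_simps scaleR_2)
    moreover have "2 *\<^sub>R (y * y + z * z) \<in> positives" using pos [OF sa(3)] pos [OF sa(4)]
      by (intro positives_scaleR positives_add) auto
    ultimately have "(y + z) * (y + z) \<in> ?D" using pos [OF sa(1)] dixmier_hereditary [OF D] by blast
    then show ?case by (simp add: y_def z_def)
  qed (simp add: ideal_zero ID)
  then show ?thesis by (simp add: ws)
qed

section \<open>From the interior and the closure back to the ideal\<close>

lemma closed_if_semiprime_dixmier_interior:
  assumes s: "semiprime (dixmier_interior I)"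
  shows "closed_under_square_roots I"
proof -
  let ?D = "dixmier_interior I"
  have D: "is_ideal ?D" using s by (simp add: semiprime_def)
  have Dc: "closed_under_square_roots ?D" by (rule semiprime_closed_under_square_roots [OF s])
  have "sum_list xs \<in> I" if "set xs \<subseteq> \<Union>{J. dixmier_ideal J \<and> J \<subseteq> I}" for xs
    using ideal_sum_list [OF I, of xs "\<lambda>x. x"] that by auto
  then have sub: "?D \<subseteq> I" by (auto simp: dixmier_interior_def)
  have low: "lower_dixmier I \<subseteq> ?D"
  proof
    fix x assume "x \<in> lower_dixmier I"
    then show "x \<in> ?D" unfolding dixmier_interior_def
      using dixmier_lower_dixmier lower_dixmier_subset by (intro CollectI exI [of _ "[x]"]) auto
  qed
  have "x \<in> ?D" if x: "x \<in> I" for x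
  proof -
    let ?y = "star x * x"
    have y: "?y \<in> positives" "?y \<in> I" using x I by (auto simp: positives_star_mult_self ideal_mult_left)
    then have "ppow ?y 2 \<in> ?D" using low ppow_mem_lower_dixmier [OF y(1), of 1 2] by auto
    then have "ppow (ppow ?y 2) (1/2) \<in> ?D"
      using y by (intro sqrt_closed_ppow_real [OF D Dc, of "ppow ?y 2"] ppow_positives) auto
    then have "?y \<in> ?D" using y by (simp add: ppow_ppow)
    then show ?thesis by (rule sqrt_closed_mem [OF D Dc])
  qed
  then show ?thesis using sub Dc by (metis subsetI subset_antisym)
qed

lemma closed_if_semiprime_dixmier_closure:
  assumes s: "semiprime (dixmier_closure I)"
  shows "closed_under_square_roots I"
proof -
  let ?K = "dixmier_closure I"
  have K: "is_ideal ?K" using s by (simp add: semiprime_def)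
  have Kc: "closed_under_square_roots ?K" by (rule semiprime_closed_under_square_roots [OF s])
  have sub: "I \<subseteq> ?K" by (auto simp: dixmier_closure_def)
  have up: "?K \<subseteq> upper_dixmier I"
    unfolding dixmier_closure_def using dixmier_upper_dixmier subset_upper_dixmier by blast
  have "x \<in> I" if x: "x \<in> ?K" for x
  proof -
    \<comment> \<open>The square of the eighth power is the quarter power, and x is a left multiple
      of the latter because 1/4 < 1/2.\<close>
    let ?y = "star x * x" and ?z = "ppow (star x * x) (1/8)"
    have y: "?y \<in> positives" "?y \<in> ?K" using x K by (auto simp: positives_star_mult_self ideal_mult_left)
    have "?z \<in> ?K" using y by (intro sqrt_closed_ppow_real [OF K Kc, of ?y]) auto
    then have "?z \<in> upper_dixmier I" using up by blast
    moreover have "?z \<in> positives" using y by (simp add: ppow_positives)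
    ultimately have "?z * ?z \<in> I" using lower_dixmier_subset square_mem_lower_dixmier by blast
    moreover have "?z * ?z = ppow ?y (1/4)" using y by (simp flip: ppow_add)
    moreover obtain u where "x = u * ppow ?y (1/4)" using polar_decomposition [of "1/4" x] by auto
    ultimately show ?thesis using I by (metis ideal_mult_left)
  qed
  then show ?thesis using sub Kc by (metis subsetI subset_antisym)
qed

end

theorem theorem5p2:
  fixes I :: "'a::cstar_algebra set"
  assumes "is_ideal I"
  shows "(semiprime I \<longleftrightarrow> I = ideal_power I 2) \<and>
    (semiprime I \<longleftrightarrow> (\<exists>m n. m \<ge> 1 \<and> n \<ge> 1 \<and> m \<noteq> n \<and> ideal_power I m = ideal_power I n)) \<and>
    (semiprime I \<longleftrightarrow> factors I) \<and>
    (semiprime I \<longleftrightarrow> closed_under_roots I) \<and>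
    (semiprime I \<longleftrightarrow> closed_under_square_roots I) \<and>
    (semiprime I \<longleftrightarrow> semiprime (dixmier_interior I)) \<and>
    (semiprime I \<longleftrightarrow> semiprime (dixmier_closure I)) \<and>
    (semiprime I \<longrightarrow> dixmier_ideal I \<and> dixmier_interior I = I \<and> I = dixmier_closure I)"
proof -
  note I = assms
  let ?C = "closed_under_square_roots I"
  have 1: "semiprime I \<longleftrightarrow> ?C" by (rule semiprime_iff_closed_under_square_roots [OF I])
  have 4: "factors I" if ?C by (rule sqrt_closed_factors [OF I that])
  have 2: "I = ideal_power I 2" if fac: "factors I"
  proof
    show "I \<subseteq> ideal_power I 2"
    proof
      fix x assume "x \<in> I"
      then obtain y z where "y \<in> I" "z \<in> I" "x = y * z" using fac unfolding factors_def by meson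
      then show "x \<in> ideal_power I 2" by (simp add: ideal_power_two_square)
    qed
    show "ideal_power I 2 \<subseteq> I" by (rule ideal_power_two_subset [OF I]) (rule ideal_mult_left [OF I])
  qed
  have 3: "\<exists>m n. m \<ge> 1 \<and> n \<ge> 1 \<and> m \<noteq> n \<and> ideal_power I m = ideal_power I n" if "I = ideal_power I 2"
  proof (intro exI conjI)
    show "ideal_power I 1 = ideal_power I 2" unfolding ideal_power_one [OF I] by (rule that)
  qed auto
  have 6: ?C if ex: "\<exists>m n. m \<ge> 1 \<and> n \<ge> 1 \<and> m \<noteq> n \<and> ideal_power I m = ideal_power I n"
  proof -
    obtain m n where mn: "m \<ge> 1" "n \<ge> 1" "m \<noteq> n" "ideal_power I m = ideal_power I n" using ex by blast
    then consider "m < n" | "n < m" by linarith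
    then show ?thesis
      by cases (metis mn stationary_powers_closed_under_square_roots [OF I])+
  qed
  have 5: "closed_under_roots I \<longleftrightarrow> ?C"
    using sqrt_closed_roots [OF I]
    by (auto simp: closed_under_roots_def closed_under_square_roots_def)
  have d: "dixmier_ideal I \<and> dixmier_interior I = I \<and> dixmier_closure I = I" if ?C
    using sqrt_closed_dixmier [OF I that] dixmier_interior_closure_eq by blast
  have 7: "semiprime (dixmier_interior I) \<longleftrightarrow> ?C"
    using closed_if_semiprime_dixmier_interior [OF I] d 1 by metis
  have 8: "semiprime (dixmier_closure I) \<longleftrightarrow> ?C"
    using closed_if_semiprime_dixmier_closure [OF I] d 1 by metis
  have "(I = ideal_power I 2) \<longleftrightarrow> ?C" "factors I \<longleftrightarrow> ?C"
    "(\<exists>m n. m \<ge> 1 \<and> n \<ge> 1 \<and> m \<noteq> n \<and> ideal_power I m = ideal_power I n) \<longleftrightarrow> ?C"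
    using 2 3 4 6 by blast+
  then show ?thesis using 1 5 7 8 d by simp
qed

end
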